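(* Let $p\in(1,2)$ and let $M$ be an Orlicz function which is regularly varying at $\infty$ of order $p$. Then the unit ball $B_H=\{x\in H:\|x\|_{L_M}\le1\}$ of every strongly embedded subspace $H$ of $L_M=L_M[0,1]$ has equi-absolutely continuous norms in $L_M$ if and only if the function $t\mapsto t^{-1/p}$, $t\in(0,1]$, does not belong to $L_M$.
   Context: An Orlicz function is an increasing convex continuous function $M$ on $[0,\infty)$ with $M(0)=0$, $\lim_{t\to\infty}M(t)=\infty$, normalized by $M(1)=1$. $L_M=L_M[0,1]$ is the Orlicz space of measurable functions on $[0,1]$ with Lebesgue measure $m$, with norm $\|f\|_{L_M}=\inf\{\lambda>0:\int_0^1M(|f(t)|/\lambda)\,dt\le1\}$. An Orlicz function $M$ with $\sup_{u\ge1}M(2u)/M(u)<\infty$ is regularly varying at $\infty$ of order $p$ if $\lim_{t\to\infty}M(tu)/M(t)=u^p$ for all $u>0$. A subspace means a closed linear subspace. A subspace $H$ of $L_M$ is strongly embedded in $L_M$ if, for sequences in $H$, convergence in the $L_M$-norm is equivalent to convergence in measure. A set $K\subset L_M$ has equi-absolutely continuous norms in $L_M$ if $\lim_{\delta\to0}\sup_{m(E)<\delta}\sup_{x\in K}\|x\chi_E\|_{L_M}=0$. *)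

theory Defs
  imports "HOL-Analysis.Analysis"
begin

(* An Orlicz function lives on {0..}; its values at negative arguments are unconstrained and never
   used.  "Increasing" is read as nondecreasing. *)
definition orlicz_function :: "(real \<Rightarrow> real) \<Rightarrow> bool" where
  "orlicz_function M \<longleftrightarrow>
     mono_on {0..} M \<and> convex_on {0..} M \<and> continuous_on {0..} M \<and>
     M 0 = 0 \<and> filterlim M at_top at_top \<and> M 1 = 1"

definition regularly_varying :: "(real \<Rightarrow> real) \<Rightarrow> real \<Rightarrow> bool" where
  "regularly_varying M p \<longleftrightarrow>
     bdd_above ((\<lambda>u. M (2 * u) / M u) ` {1..}) \<and>
     (\<forall>u>0. ((\<lambda>t. M (t * u) / M t) \<longlongrightarrow> u powr p) at_top)"

abbreviation unit_interval :: "real measure" where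
  "unit_interval \<equiv> lebesgue_on {0..1}"

(* The modular is an extended nonnegative integral, so that it is infinite (rather than 0)
   when the integrand is not integrable. *)
definition orlicz_modular :: "(real \<Rightarrow> real) \<Rightarrow> (real \<Rightarrow> real) \<Rightarrow> ennreal" where
  "orlicz_modular M f = (\<integral>\<^sup>+ t. ennreal (M \<bar>f t\<bar>) \<partial>unit_interval)"

(* Elements are functions, not classes modulo equality a.e.; values outside [0,1] are irrelevant. *)
definition orlicz_space :: "(real \<Rightarrow> real) \<Rightarrow> (real \<Rightarrow> real) set" where
  "orlicz_space M =
     {f \<in> borel_measurable unit_interval. \<exists>r>0. orlicz_modular M (\<lambda>t. f t / r) \<le> 1}"

(* Only meaningful on orlicz_space M, where the infimum is over a nonempty set. *)
definition orlicz_norm :: "(real \<Rightarrow> real) \<Rightarrow> (real \<Rightarrow> real) \<Rightarrow> real" where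
  "orlicz_norm M f = Inf {r. r > 0 \<and> orlicz_modular M (\<lambda>t. f t / r) \<le> 1}"

definition norm_converges ::
    "(real \<Rightarrow> real) \<Rightarrow> (nat \<Rightarrow> real \<Rightarrow> real) \<Rightarrow> (real \<Rightarrow> real) \<Rightarrow> bool" where
  "norm_converges M X f \<longleftrightarrow> (\<lambda>n. orlicz_norm M (\<lambda>t. X n t - f t)) \<longlonglongrightarrow> 0"

definition converges_in_measure :: "(nat \<Rightarrow> real \<Rightarrow> real) \<Rightarrow> (real \<Rightarrow> real) \<Rightarrow> bool" where
  "converges_in_measure X f \<longleftrightarrow>
     (\<forall>\<epsilon>>0. (\<lambda>n. measure unit_interval {t \<in> {0..1}. \<bar>X n t - f t\<bar> > \<epsilon>}) \<longlonglongrightarrow> 0)"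

(* Since a.e. equal functions are at distance 0, closedness makes such a set saturated under
   equality a.e., so these sets correspond exactly to the closed linear subspaces of the space of
   classes. *)
definition closed_subspace :: "(real \<Rightarrow> real) \<Rightarrow> (real \<Rightarrow> real) set \<Rightarrow> bool" where
  "closed_subspace M H \<longleftrightarrow>
     H \<subseteq> orlicz_space M \<and>
     (\<lambda>t. 0) \<in> H \<and>
     (\<forall>f\<in>H. \<forall>g\<in>H. (\<lambda>t. f t + g t) \<in> H) \<and>
     (\<forall>c. \<forall>f\<in>H. (\<lambda>t. c * f t) \<in> H) \<and>
     (\<forall>X f. (\<forall>n. X n \<in> H) \<longrightarrow> f \<in> orlicz_space M \<longrightarrow> norm_converges M X f \<longrightarrow> f \<in> H)"

definition strongly_embedded :: "(real \<Rightarrow> real) \<Rightarrow> (real \<Rightarrow> real) set \<Rightarrow> bool" where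
  "strongly_embedded M H \<longleftrightarrow>
     closed_subspace M H \<and>
     (\<forall>X f. (\<forall>n. X n \<in> H) \<longrightarrow> f \<in> H \<longrightarrow>
        (norm_converges M X f \<longleftrightarrow> converges_in_measure X f))"

definition orlicz_unit_ball :: "(real \<Rightarrow> real) \<Rightarrow> (real \<Rightarrow> real) set \<Rightarrow> (real \<Rightarrow> real) set" where
  "orlicz_unit_ball M H = {x \<in> H. orlicz_norm M x \<le> 1}"

(* The suprema are taken in ennreal, where they always exist. *)
definition equi_absolutely_continuous_norms ::
    "(real \<Rightarrow> real) \<Rightarrow> (real \<Rightarrow> real) set \<Rightarrow> bool" where
  "equi_absolutely_continuous_norms M K \<longleftrightarrow>
     ((\<lambda>\<delta>. SUP E\<in>{E \<in> sets unit_interval. measure unit_interval E < \<delta>}.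
             SUP x\<in>K. ennreal (orlicz_norm M (\<lambda>t. x t * indicator E t)))
       \<longlongrightarrow> 0) (at_right 0)"

end

theory Submission
  imports Defs
begin

text \<open>
  Put \<open>\<beta> = 2 powr (1/p)\<close>. On the interval \<open>(2^-(k+1), 2^-k]\<close> the function \<open>t powr (-1/p)\<close> lies
  between \<open>\<beta>^k\<close> and \<open>\<beta>^(k+1)\<close>, so it belongs to \<open>L_M\<close> exactly when the series
  \<open>\<Sum>k. M(\<beta>^k) / 2^k\<close> converges (\<open>power_mem_orlicz_space_iff\<close>). The two cases are treated by
  elementary probabilistic arguments.

  Divergent series. Let \<open>H\<close> be strongly embedded and suppose that its unit ball fails to have
  equi-absolutely continuous norms. Then there are \<open>z_i\<close> in \<open>H\<close> of modular at most 1 and sets \<open>E_i\<close>,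
  of measure tending to 0, that carry a fixed amount \<open>c\<close> of the modular of \<open>z_i\<close>. Take \<open>N = 2^k\<close> of
  these functions, far out in the sequence, put \<open>s = \<beta>^k = N powr (1/p)\<close>, and average
  \<open>y = (\<Sum>i. \<epsilon>_i z_i) / s\<close> over all choices of signs. The modular of \<open>y\<close> does not degenerate: the
  sets \<open>E_i\<close> behave as if they were disjoint, and \<open>M(u/s)\<close> is about \<open>M(u)/N\<close> for large \<open>u\<close>. On the
  other hand the measure of \<open>{\<bar>y\<bar> > 1}\<close> is on average at most \<open>\<Sum>i. \<integral> min 1 (z_i\<^sup>2/s\<^sup>2)\<close>.
  Since \<open>p < 2\<close>, one has \<open>(\<Sum>k. M(\<beta>^k) min 1 (u\<^sup>2/\<beta>^(2k))) \<le> C (M u + 1)\<close>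
  (\<open>weighted_truncation_bound\<close>); integrating this, the divergence of the series prevents
  \<open>2^k \<integral> min 1 (z_i\<^sup>2/\<beta>^(2k))\<close> from staying away from 0 for every \<open>k\<close>. For a suitable \<open>k\<close> both
  estimates hold for one choice of signs (\<open>combination_small_in_measure\<close>), and \<open>H\<close> contains
  a sequence that tends to 0 in measure but not in norm.

  Convergent series. The binary digits of \<open>t\<close> provide symmetric, pairwise independent functions
  \<open>f_i\<close> that imitate independent \<open>p\<close>-stable variables: \<open>\<bar>f_i\<bar>\<close> exceeds \<open>\<beta>^k\<close> with probability about
  \<open>2^-k\<close>. A sum \<open>\<Sum>i. a_i f_i\<close> with \<open>(\<Sum>i. \<bar>a_i\<bar>^p) = 1\<close> has tail at most \<open>C / x^p\<close>, hence a bounded norm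
  because the series converges, and it exceeds 1 in absolute value with probability at least 1/16. To
  \<open>f_i\<close> one adds a spike of norm 1 supported on a tiny set. Disjoint spikes whose heights grow fast
  enough satisfy the same upper \<open>p\<close>-estimate, and the lower estimate in measure survives, so the closed
  span is strongly embedded (\<open>strongly_embedded_closed_span\<close>). But the spikes keep a fixed amount
  of norm on sets of measure tending to 0 (\<open>summable_imp_counterexample\<close>).
\<close>

section \<open>Lebesgue measure on the unit interval\<close>

lemma space_unit_interval [simp]: "space unit_interval = {0..1}"
  by (simp add: space_restrict_space)

lemma emeasure_unit_interval [simp]: "emeasure unit_interval {0..1} = 1"
  by (simp add: emeasure_restrict_space)

lemma finite_measure_unit_interval: "finite_measure unit_interval"
  by (rule finite_measureI) simp

interpretation unit_interval: finite_measure unit_interval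
  by (rule finite_measure_unit_interval)

lemma measure_unit_interval [simp]: "measure unit_interval {0..1} = 1"
  by (simp add: measure_def)

lemma borel_measurable_unit_interval [measurable (raw)]:
  "f \<in> borel_measurable borel \<Longrightarrow> f \<in> borel_measurable unit_interval"
  by (intro measurable_restrict_space1 measurable_completion) simp

abbreviation \<mu> :: "real measure" where
  "\<mu> \<equiv> unit_interval"

section \<open>Modular and norm\<close>

locale orlicz =
  fixes M :: "real \<Rightarrow> real"
  assumes orlicz: "orlicz_function M"
begin

lemma M_mono: "0 \<le> x \<Longrightarrow> x \<le> y \<Longrightarrow> M x \<le> M y"
  using orlicz unfolding orlicz_function_def mono_on_def by auto

lemma M_zero [simp]: "M 0 = 0" and M_one [simp]: "M 1 = 1"
  using orlicz unfolding orlicz_function_def by auto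

lemma M_nonneg [simp]: "0 \<le> x \<Longrightarrow> 0 \<le> M x"
  using M_mono[of 0 x] by simp

lemma M_at_top: "filterlim M at_top at_top"
  using orlicz unfolding orlicz_function_def by auto

lemma M_convex:
  assumes "0 \<le> u" "0 \<le> v" "0 \<le> a" "0 \<le> b" "a + b = 1"
  shows "M (a * u + b * v) \<le> a * M u + b * M v"
  using orlicz assms unfolding orlicz_function_def convex_on_def by auto

lemma M_contract: "0 \<le> c \<Longrightarrow> c \<le> 1 \<Longrightarrow> 0 \<le> u \<Longrightarrow> M (c * u) \<le> c * M u"
  using M_convex[of u 0 c "1 - c"] by simp

lemma M_expand:
  assumes "1 \<le> c" "0 \<le> u"
  shows "c * M u \<le> M (c * u)"
  using M_contract[of "1 / c" "c * u"] assms by (simp add: field_simps)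

lemma M_ge_self: "1 \<le> u \<Longrightarrow> u \<le> M u"
  using M_expand[of u 1] by simp

lemma continuous_on_M_abs: "continuous_on UNIV (\<lambda>u. M \<bar>u\<bar>)"
  using orlicz unfolding orlicz_function_def
  by (auto intro!: continuous_on_compose2[of "{0..}" M] continuous_intros)

lemma M_abs_measurable [measurable]: "(\<lambda>u. M \<bar>u\<bar>) \<in> borel_measurable borel"
  by (rule borel_measurable_continuous_onI[OF continuous_on_M_abs])

lemma M_abs_compose_measurable [measurable (raw)]:
  assumes "f \<in> borel_measurable N"
  shows "(\<lambda>t. M \<bar>f t\<bar>) \<in> borel_measurable N"
  using measurable_compose[OF assms M_abs_measurable] .

lemma modular_mono:
  "(\<And>t. t \<in> {0..1} \<Longrightarrow> \<bar>f t\<bar> \<le> \<bar>g t\<bar>) \<Longrightarrow> orlicz_modular M f \<le> orlicz_modular M g"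
  unfolding orlicz_modular_def
  by (intro nn_integral_mono ennreal_leI M_mono) auto

lemma modular_contract:
  assumes [measurable]: "f \<in> borel_measurable \<mu>" and c: "0 \<le> c" "c \<le> 1"
  shows "orlicz_modular M (\<lambda>t. c * f t) \<le> ennreal c * orlicz_modular M f"
proof -
  have "orlicz_modular M (\<lambda>t. c * f t) \<le> (\<integral>\<^sup>+ t. ennreal c * ennreal (M \<bar>f t\<bar>) \<partial>\<mu>)"
    unfolding orlicz_modular_def
    using c M_contract[of c] by (intro nn_integral_mono) (auto simp: abs_mult ennreal_mult[symmetric] intro!: ennreal_leI)
  also have "\<dots> = ennreal c * orlicz_modular M f"
    unfolding orlicz_modular_def by (intro nn_integral_cmult) measurable
  finally show ?thesis .
qed

lemma integrable_of_modular_le_1: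
  assumes [measurable]: "f \<in> borel_measurable \<mu>" and f: "orlicz_modular M f \<le> 1"
  shows "integrable \<mu> (\<lambda>t. M \<bar>f t\<bar>)"
proof (rule integrableI_nonneg)
  show "(\<integral>\<^sup>+ t. ennreal (M \<bar>f t\<bar>) \<partial>\<mu>) < \<infinity>"
    using f unfolding orlicz_modular_def by (auto intro: le_less_trans[OF _ ennreal_one_less_top])
qed auto

lemma orlicz_space_measurable: "f \<in> orlicz_space M \<Longrightarrow> f \<in> borel_measurable \<mu>"
  unfolding orlicz_space_def by auto

lemma norm_le: "0 < r \<Longrightarrow> orlicz_modular M (\<lambda>t. f t / r) \<le> 1 \<Longrightarrow> orlicz_norm M f \<le> r"
  unfolding orlicz_norm_def by (intro cInf_lower bdd_belowI[of _ 0]) auto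

lemma norm_nonneg: "f \<in> orlicz_space M \<Longrightarrow> 0 \<le> orlicz_norm M f"
  unfolding orlicz_norm_def orlicz_space_def by (intro cInf_greatest) auto

lemma modular_le_1:
  assumes f: "f \<in> orlicz_space M" and r: "orlicz_norm M f < r"
  shows "orlicz_modular M (\<lambda>t. f t / r) \<le> 1"
proof -
  let ?A = "{r. 0 < r \<and> orlicz_modular M (\<lambda>t. f t / r) \<le> 1}"
  have "?A \<noteq> {}" using f unfolding orlicz_space_def by auto
  then obtain s where s: "s \<in> ?A" "s < r"
    using r cInf_lessD[of ?A r] unfolding orlicz_norm_def by blast
  have "\<bar>f t / r\<bar> \<le> \<bar>f t / s\<bar>" for t
    using s by (auto simp: abs_divide intro!: divide_left_mono)
  then show ?thesis using s modular_mono[of "\<lambda>t. f t / r" "\<lambda>t. f t / s"] by auto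
qed

lemma norm_ge:
  assumes "f \<in> orlicz_space M" "1 < orlicz_modular M (\<lambda>t. f t / r)"
  shows "r \<le> orlicz_norm M f"
  using modular_le_1[OF assms(1), of r] assms(2) by (meson linorder_not_le)

lemma orlicz_space_of_modular:
  assumes f: "f \<in> borel_measurable \<mu>"
    and C: "1 \<le> C" "orlicz_modular M f \<le> ennreal C"
  shows "f \<in> orlicz_space M" "orlicz_norm M f \<le> C"
proof -
  have "orlicz_modular M (\<lambda>t. (1 / C) * f t) \<le> ennreal (1 / C) * orlicz_modular M f"
    by (rule modular_contract[OF f]) (use C in auto)
  also have "\<dots> \<le> ennreal (1 / C) * ennreal C" using C by (intro mult_left_mono) auto
  also have "\<dots> = 1" using C by (simp add: ennreal_mult[symmetric])
  finally have *: "orlicz_modular M (\<lambda>t. f t / C) \<le> 1" by simp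
  show "f \<in> orlicz_space M" using f * C unfolding orlicz_space_def
    by (auto intro!: exI[of _ C])
  show "orlicz_norm M f \<le> C" using norm_le[OF _ *] C by simp
qed

text \<open>The convex combination with weights \<open>r/(r+s)\<close> and \<open>s/(r+s)\<close> of \<open>f/r\<close> and \<open>g/s\<close> is
  \<open>(f+g)/(r+s)\<close>; this is the triangle inequality before passing to the infimum.\<close>
lemma modular_add_div:
  assumes [measurable]: "f \<in> borel_measurable \<mu>" "g \<in> borel_measurable \<mu>"
    and r: "0 < r" "0 < s"
    and f: "orlicz_modular M (\<lambda>t. f t / r) \<le> 1" and g: "orlicz_modular M (\<lambda>t. g t / s) \<le> 1"
  shows "orlicz_modular M (\<lambda>t. (f t + g t) / (r + s)) \<le> 1"
proof -
  let ?a = "r / (r + s)" and ?b = "s / (r + s)"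
  have ab: "0 \<le> ?a" "0 \<le> ?b" "?a + ?b = 1" using r by (auto simp: add_divide_distrib[symmetric])
  have "M \<bar>(f t + g t) / (r + s)\<bar> \<le> ?a * M \<bar>f t / r\<bar> + ?b * M \<bar>g t / s\<bar>" for t
  proof -
    have "\<bar>(f t + g t) / (r + s)\<bar> \<le> \<bar>f t / (r + s)\<bar> + \<bar>g t / (r + s)\<bar>"
      using abs_triangle_ineq[of "f t / (r + s)" "g t / (r + s)"] by (simp add: add_divide_distrib)
    also have "\<dots> = ?a * \<bar>f t / r\<bar> + ?b * \<bar>g t / s\<bar>" using r by (simp add: abs_divide)
    finally show ?thesis
      using M_mono[of "\<bar>(f t + g t) / (r + s)\<bar>" "?a * \<bar>f t / r\<bar> + ?b * \<bar>g t / s\<bar>"]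
        M_convex[of "\<bar>f t / r\<bar>" "\<bar>g t / s\<bar>" ?a ?b] ab by linarith
  qed
  then have "orlicz_modular M (\<lambda>t. (f t + g t) / (r + s))
     \<le> (\<integral>\<^sup>+ t. ennreal ?a * ennreal (M \<bar>f t / r\<bar>) + ennreal ?b * ennreal (M \<bar>g t / s\<bar>) \<partial>\<mu>)"
    unfolding orlicz_modular_def using ab
    by (intro nn_integral_mono)
       (simp only: ennreal_mult[symmetric] ennreal_plus[symmetric] M_nonneg abs_ge_zero mult_nonneg_nonneg ennreal_leI)
  also have "\<dots> = ennreal ?a * orlicz_modular M (\<lambda>t. f t / r) + ennreal ?b * orlicz_modular M (\<lambda>t. g t / s)"
    unfolding orlicz_modular_def
    by (subst nn_integral_add, measurable, subst (1 2) nn_integral_cmult, measurable)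
  also have "\<dots> \<le> ennreal ?a * 1 + ennreal ?b * 1" using f g by (intro add_mono mult_left_mono) auto
  also have "\<dots> = 1" using ab by (simp add: ennreal_plus[symmetric] del: ennreal_plus)
  finally show ?thesis .
qed

lemma orlicz_space_add:
  assumes f: "f \<in> orlicz_space M" and g: "g \<in> orlicz_space M"
  shows "(\<lambda>t. f t + g t) \<in> orlicz_space M"
    and "orlicz_norm M (\<lambda>t. f t + g t) \<le> orlicz_norm M f + orlicz_norm M g"
proof -
  note [measurable] = f[THEN orlicz_space_measurable] g[THEN orlicz_space_measurable]
  have *: "orlicz_modular M (\<lambda>t. (f t + g t) / (r + s)) \<le> 1"
    if "orlicz_norm M f < r" "orlicz_norm M g < s" for r s
    using that modular_add_div[of f g r s] modular_le_1[OF f] modular_le_1[OF g]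
      norm_nonneg[OF f] norm_nonneg[OF g] by auto
  show "(\<lambda>t. f t + g t) \<in> orlicz_space M"
    unfolding orlicz_space_def
    using *[of "orlicz_norm M f + 1" "orlicz_norm M g + 1"] norm_nonneg[OF f] norm_nonneg[OF g]
    by (auto intro!: exI[of _ "(orlicz_norm M f + 1) + (orlicz_norm M g + 1)"])
  show "orlicz_norm M (\<lambda>t. f t + g t) \<le> orlicz_norm M f + orlicz_norm M g"
  proof (rule field_le_epsilon)
    fix e :: real assume "0 < e"
    then show "orlicz_norm M (\<lambda>t. f t + g t) \<le> orlicz_norm M f + orlicz_norm M g + e"
      using *[of "orlicz_norm M f + e/2" "orlicz_norm M g + e/2"] norm_nonneg[OF f] norm_nonneg[OF g]
        norm_le[of "(orlicz_norm M f + e/2) + (orlicz_norm M g + e/2)" "\<lambda>t. f t + g t"]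
      by auto
  qed
qed

lemma zero_in_orlicz_space: "(\<lambda>t. 0) \<in> orlicz_space M"
  unfolding orlicz_space_def by (auto intro!: exI[of _ 1] simp: orlicz_modular_def)

lemma norm_zero: "orlicz_norm M (\<lambda>t. 0) = 0"
proof -
  have "orlicz_norm M (\<lambda>t. 0) \<le> 0 + e" if "0 < e" for e
    using norm_le[of e "\<lambda>t. 0"] that by (simp add: orlicz_modular_def)
  then have "orlicz_norm M (\<lambda>t. 0) \<le> 0" by (rule field_le_epsilon)
  with norm_nonneg[OF zero_in_orlicz_space] show ?thesis by simp
qed

lemma orlicz_space_scale:
  assumes f: "f \<in> orlicz_space M"
  shows "(\<lambda>t. c * f t) \<in> orlicz_space M"
    and "orlicz_norm M (\<lambda>t. c * f t) \<le> \<bar>c\<bar> * orlicz_norm M f"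
proof -
  have *: "(\<lambda>t. c * f t) \<in> orlicz_space M \<and> orlicz_norm M (\<lambda>t. c * f t) \<le> \<bar>c\<bar> * orlicz_norm M f"
  proof (cases "c = 0")
    case True
    then show ?thesis by (simp add: zero_in_orlicz_space norm_zero)
  next
    case False
    have m: "orlicz_modular M (\<lambda>t. c * f t / (\<bar>c\<bar> * r)) \<le> 1" if "orlicz_norm M f < r" for r
    proof -
      have "orlicz_modular M (\<lambda>t. c * f t / (\<bar>c\<bar> * r)) \<le> orlicz_modular M (\<lambda>t. f t / r)"
        using False by (intro modular_mono) (simp add: abs_mult abs_divide)
      then show ?thesis using modular_le_1[OF f that] by simp
    qed
    have 1: "(\<lambda>t. c * f t) \<in> orlicz_space M"
      unfolding orlicz_space_def
      using f[THEN orlicz_space_measurable] m[of "orlicz_norm M f + 1"] False norm_nonneg[OF f]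
      by (auto intro!: exI[of _ "\<bar>c\<bar> * (orlicz_norm M f + 1)"])
    have "orlicz_norm M (\<lambda>t. c * f t) \<le> \<bar>c\<bar> * orlicz_norm M f"
    proof (rule field_le_epsilon)
      fix e :: real assume e: "0 < e"
      have "orlicz_norm M (\<lambda>t. c * f t) \<le> \<bar>c\<bar> * (orlicz_norm M f + e / \<bar>c\<bar>)"
        using e False norm_nonneg[OF f] by (intro norm_le m mult_pos_pos add_nonneg_pos) auto
      then show "orlicz_norm M (\<lambda>t. c * f t) \<le> \<bar>c\<bar> * orlicz_norm M f + e"
        using False by (simp add: distrib_left)
    qed
    with 1 show ?thesis by simp
  qed
  then show "(\<lambda>t. c * f t) \<in> orlicz_space M"
    and "orlicz_norm M (\<lambda>t. c * f t) \<le> \<bar>c\<bar> * orlicz_norm M f" by auto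
qed

lemma orlicz_space_diff:
  assumes f: "f \<in> orlicz_space M" and g: "g \<in> orlicz_space M"
  shows "(\<lambda>t. f t - g t) \<in> orlicz_space M"
    and "orlicz_norm M (\<lambda>t. f t - g t) \<le> orlicz_norm M f + orlicz_norm M g"
  using orlicz_space_add[OF f orlicz_space_scale(1)[OF g, of "-1"]]
    orlicz_space_scale(2)[OF g, of "-1"] by auto

lemma norm_minus_commute: "orlicz_norm M (\<lambda>t. f t - g t) = orlicz_norm M (\<lambda>t. g t - f t)"
proof -
  have "(\<lambda>t. \<bar>(f t - g t) / r\<bar>) = (\<lambda>t. \<bar>(g t - f t) / r\<bar>)" for r
    by (rule ext) (metis abs_divide abs_minus_commute)
  then have eq: "orlicz_modular M (\<lambda>t. (f t - g t) / r) = orlicz_modular M (\<lambda>t. (g t - f t) / r)" for r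
    unfolding orlicz_modular_def
    by (rule arg_cong[of _ _ "\<lambda>h. \<integral>\<^sup>+ t. ennreal (M (h t)) \<partial>\<mu>"])
  show ?thesis
    unfolding orlicz_norm_def eq ..
qed

text \<open>For \<open>k \<ge> e\<close> one has \<open>M(k/e) \<ge> k/e\<close> by convexity, so Markov applied to the modular of \<open>f/e\<close>
  gives a weak type bound that mentions \<open>M\<close> no longer.\<close>
lemma chebyshev:
  assumes f: "f \<in> orlicz_space M" and e: "orlicz_norm M f < e" "e \<le> k"
  shows "measure \<mu> {t \<in> {0..1}. \<bar>f t\<bar> > k} \<le> e / k"
proof -
  note [measurable] = f[THEN orlicz_space_measurable]
  have e0: "0 < e" "0 < k" using e norm_nonneg[OF f] by auto
  let ?A = "{t \<in> {0..1}. \<bar>f t\<bar> > k}"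
  have "{t \<in> space unit_interval. \<bar>f t\<bar> > k} \<in> sets \<mu>" by measurable
  then have A: "?A \<in> sets \<mu>" by simp
  have "ennreal (k / e) * indicator ?A t \<le> ennreal (M \<bar>f t / e\<bar>)" for t
  proof (cases "t \<in> ?A")
    case True
    then have "k / e \<le> \<bar>f t / e\<bar>" using e0 by (auto simp: abs_divide divide_right_mono)
    moreover have "1 \<le> k / e" using e e0 by simp
    ultimately have "k / e \<le> M \<bar>f t / e\<bar>" using M_ge_self[of "\<bar>f t / e\<bar>"] by linarith
    then show ?thesis using True by (auto intro: ennreal_leI)
  qed auto
  then have "(\<integral>\<^sup>+ t. ennreal (k / e) * indicator ?A t \<partial>\<mu>) \<le> orlicz_modular M (\<lambda>t. f t / e)"
    unfolding orlicz_modular_def by (intro nn_integral_mono)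
  also have "\<dots> \<le> 1" using modular_le_1[OF f e(1)] .
  finally have "ennreal (k / e) * emeasure \<mu> ?A \<le> 1"
    using A by (simp add: nn_integral_cmult_indicator)
  then have "ennreal (k / e * measure \<mu> ?A) \<le> ennreal 1"
    using e0 by (simp only: unit_interval.emeasure_eq_measure ennreal_1 ennreal_mult[symmetric] measure_nonneg divide_nonneg_pos less_imp_le)
  then have "k / e * measure \<mu> ?A \<le> 1" by (subst (asm) ennreal_le_iff) auto
  then show ?thesis using e0 by (simp add: field_simps)
qed

lemma norm_converges_imp_converges_in_measure:
  assumes X: "\<And>n. X n \<in> orlicz_space M" and f: "f \<in> orlicz_space M" and c: "norm_converges M X f"
  shows "converges_in_measure X f"
  unfolding converges_in_measure_def
proof (intro allI impI)
  fix k :: real assume k: "0 < k"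
  show "(\<lambda>n. measure \<mu> {t \<in> {0..1}. \<bar>X n t - f t\<bar> > k}) \<longlonglongrightarrow> 0"
  proof (rule LIMSEQ_I)
    fix r :: real assume r: "0 < r"
    define e where "e = min k (r * k / 2)"
    have e: "0 < e" "e \<le> k" "e / k < r" using k r unfolding e_def by (auto simp: min_def field_simps)
    obtain N where N: "\<And>n. n \<ge> N \<Longrightarrow> \<bar>orlicz_norm M (\<lambda>t. X n t - f t)\<bar> < e"
      using LIMSEQ_D[OF c[unfolded norm_converges_def] e(1)] by (auto simp only: diff_zero real_norm_def)
    have "measure \<mu> {t \<in> {0..1}. \<bar>X n t - f t\<bar> > k} \<le> e / k" if "n \<ge> N" for n
      using N[OF that] chebyshev[OF orlicz_space_diff(1)[OF X[of n] f], of e k] e by auto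
    then show "\<exists>no. \<forall>n\<ge>no. norm (measure \<mu> {t \<in> {0..1}. \<bar>X n t - f t\<bar> > k} - 0) < r"
      using e by (intro exI[of _ N]) (auto intro: le_less_trans)
  qed
qed

end


lemma equi_absolutely_continuous_norms_iff:
  "equi_absolutely_continuous_norms M K \<longleftrightarrow>
     (\<forall>c>0. \<exists>\<delta>>0. \<forall>E\<in>sets unit_interval. measure \<mu> E < \<delta> \<longrightarrow>
        (\<forall>x\<in>K. orlicz_norm M (\<lambda>t. x t * indicator E t) \<le> c))"
    (is "_ \<longleftrightarrow> ?R")
proof -
  let ?f = "\<lambda>\<delta>. SUP E\<in>{E \<in> sets unit_interval. measure \<mu> E < \<delta>}.
             SUP x\<in>K. ennreal (orlicz_norm M (\<lambda>t. x t * indicator E t))"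
  have le: "?f \<delta> \<le> ennreal c \<longleftrightarrow> (\<forall>E\<in>sets unit_interval. measure \<mu> E < \<delta> \<longrightarrow>
        (\<forall>x\<in>K. orlicz_norm M (\<lambda>t. x t * indicator E t) \<le> c))" if "0 < c" for \<delta> c
    using that by (auto simp: SUP_le_iff ennreal_le_iff)
  have "(?f \<longlongrightarrow> 0) (at_right 0) \<longleftrightarrow> (\<forall>c>0. \<exists>\<delta>>0. ?f \<delta> \<le> ennreal c)"
  proof (intro iffI allI impI)
    fix c :: real assume L: "(?f \<longlongrightarrow> 0) (at_right 0)" and c: "0 < c"
    have "\<forall>\<^sub>F \<delta> in at_right 0. ?f \<delta> < ennreal c"
      using L c by (intro order_tendstoD) auto
    then obtain b where b: "0 < b" "\<And>y. 0 < y \<Longrightarrow> y < b \<Longrightarrow> ?f y < ennreal c"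
      unfolding eventually_at_right_field by blast
    have "?f (b / 2) < ennreal c" by (rule b(2)) (use b(1) in auto)
    then show "\<exists>\<delta>>0. ?f \<delta> \<le> ennreal c" using b(1) by (intro exI[of _ "b / 2"]) (auto intro: less_imp_le)
  next
    assume R: "\<forall>c>0. \<exists>\<delta>>0. ?f \<delta> \<le> ennreal c"
    show "(?f \<longlongrightarrow> 0) (at_right 0)"
    proof (rule tendsto_zero_ennreal)
      fix r :: real assume r: "0 < r"
      obtain \<delta> where d: "0 < \<delta>" "?f \<delta> \<le> ennreal (r / 2)" using R r half_gt_zero by blast
      have mono: "?f y \<le> ?f \<delta>" if "y < \<delta>" for y
        using that by (intro SUP_subset_mono) auto
      have "?f y < ennreal r" if "y < \<delta>" for y
      proof -
        have "?f y \<le> ennreal (r / 2)" using mono[OF that] d(2) by (rule order_trans)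
        also have "\<dots> < ennreal r" using r by (intro ennreal_lessI) auto
        finally show ?thesis .
      qed
      then show "\<forall>\<^sub>F y in at_right 0. ?f y < ennreal r"
        unfolding eventually_at_right_field using d(1) by blast
    qed
  qed
  then show ?thesis unfolding equi_absolutely_continuous_norms_def using le by (simp cong: conj_cong)
qed

section \<open>Regular variation along a geometric sequence\<close>

lemma geometric_bracket:
  fixes b x :: real
  assumes "1 < b" "1 \<le> x"
  obtains k where "b ^ k \<le> x" "x < b ^ Suc k"
proof -
  obtain n where n: "x < b ^ n" using real_arch_pow[OF assms(1)] by blast
  define k where "k = (LEAST n. x < b ^ Suc n)"
  have "n \<noteq> 0" using n assms by (auto intro: ccontr)
  then have "x < b ^ Suc (n - 1)" using n by simp
  then have 1: "x < b ^ Suc k" unfolding k_def by (rule LeastI)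
  have "b ^ k \<le> x"
  proof (cases k)
    case 0 then show ?thesis using assms by simp
  next
    case (Suc j)
    then have "\<not> x < b ^ Suc j" using not_less_Least[of j "\<lambda>n. x < b ^ Suc n"] unfolding k_def by simp
    then show ?thesis using Suc by simp
  qed
  with 1 that show ?thesis by blast
qed

lemma suminf_single:
  fixes f :: "nat \<Rightarrow> 'a::{t2_space, comm_monoid_add}"
  assumes "\<And>j. j \<noteq> k \<Longrightarrow> f j = 0"
  shows "suminf f = f k"
  using suminf_finite[of "{k}" f] assms by auto

lemma emeasure_unit_interval_greaterThanAtMost:
  assumes "0 \<le> a" "a \<le> b" "b \<le> 1"
  shows "emeasure \<mu> {a<..b} = ennreal (b - a)"
  using assms by (subst emeasure_restrict_space) auto

locale rv_orlicz = orlicz +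
  fixes p :: real
  assumes p_gt_1: "1 < p" and p_lt_2: "p < 2" and rv: "regularly_varying M p"
begin

text \<open>The scale is chosen so that \<open>\<beta>^k\<close> corresponds to probability \<open>2^-k\<close>: dilating by \<open>\<beta>\<close>
  asymptotically doubles \<open>M\<close>.\<close>
definition \<beta> :: real where "\<beta> = 2 powr (1 / p)"

lemma beta_gt_1: "1 < \<beta>"
  unfolding \<beta>_def using p_gt_1 by simp

lemma beta_pow_powr: "(\<beta> ^ k) powr p = 2 ^ k"
proof -
  have "(\<beta> ^ k) powr p = (\<beta> powr p) ^ k" using beta_gt_1
    by (simp add: powr_power powr_realpow[symmetric] powr_powr mult.commute)
  then show ?thesis using p_gt_1 by (simp add: \<beta>_def powr_powr)
qed

lemma beta_powr: "\<beta> powr p = 2"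
  using beta_pow_powr[of 1] by simp

lemma powr_pow_beta: "(2 ^ k) powr (1 / p) = \<beta> ^ k"
  using beta_pow_powr[of k, symmetric] beta_gt_1 p_gt_1 by (simp add: powr_powr)

lemma beta_sq_gt_2: "2 < \<beta>\<^sup>2"
proof -
  have "2 powr 1 < 2 powr (2 / p)" using p_gt_1 p_lt_2 by (intro powr_less_mono) auto
  also have "2 powr (2 / p) = \<beta>\<^sup>2" unfolding \<beta>_def by (simp add: power2_eq_square powr_add[symmetric])
  finally show ?thesis by simp
qed

lemma M_ratio:
  assumes "0 < c" "a < c powr p" "c powr p < b"
  shows "\<forall>\<^sub>F t in at_top. a * M t \<le> M (c * t) \<and> M (c * t) \<le> b * M t"
proof -
  have lim: "((\<lambda>t. M (t * c) / M t) \<longlongrightarrow> c powr p) at_top"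
    using rv assms(1) unfolding regularly_varying_def by auto
  have "\<forall>\<^sub>F t in at_top. a < M (t * c) / M t" "\<forall>\<^sub>F t in at_top. M (t * c) / M t < b"
    using order_tendstoD[OF lim] assms by auto
  moreover have "\<forall>\<^sub>F t in at_top. 0 < M t"
    using M_at_top by (simp add: filterlim_at_top_dense)
  ultimately show ?thesis
    by eventually_elim (auto simp: field_simps)
qed

text \<open>The additive constant absorbs the arguments below 1, where \<open>M\<close> may vanish or decay fast and the
  quotient \<open>M(2u)/M(u)\<close> is not controlled.\<close>
lemma doubling:
  obtains K where "1 \<le> K" "\<And>u. 0 \<le> u \<Longrightarrow> M (2 * u) \<le> K * (M u + 1)"
proof -
  from rv obtain K0 where K0: "\<And>u. 1 \<le> u \<Longrightarrow> M (2 * u) / M u \<le> K0"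
    unfolding regularly_varying_def bdd_above_def by auto
  define K where "K = max 1 (max K0 (M 2))"
  have "M (2 * u) \<le> K * (M u + 1)" if "0 \<le> u" for u
  proof (cases "u \<le> 1")
    case True
    have "M (2 * u) \<le> M 2" using True that by (intro M_mono) auto
    also have "\<dots> \<le> K * 1" unfolding K_def by simp
    also have "\<dots> \<le> K * (M u + 1)" using that unfolding K_def by (intro mult_left_mono) auto
    finally show ?thesis .
  next
    case False
    then have pos: "0 < M u" using M_ge_self[of u] by simp
    then have "M (2 * u) \<le> K0 * M u" using K0[of u] False by (simp add: field_simps)
    also have "\<dots> \<le> K * (M u + 1)" using pos unfolding K_def by (intro mult_mono) auto
    finally show ?thesis .
  qed
  moreover have "1 \<le> K" unfolding K_def by simp
  ultimately show ?thesis using that by blast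
qed

lemma dilation_bound:
  assumes c: "0 \<le> c"
  obtains K where "1 \<le> K" "\<And>u. 0 \<le> u \<Longrightarrow> M (c * u) \<le> K * (M u + 1)"
proof -
  obtain D where D: "1 \<le> D" "\<And>u. 0 \<le> u \<Longrightarrow> M (2 * u) \<le> D * (M u + 1)" using doubling by blast
  have pow: "\<exists>K\<ge>1. \<forall>u\<ge>0. M (2 ^ n * u) \<le> K * (M u + 1)" for n
  proof (induction n)
    case 0
    then show ?case by (intro exI[of _ 1]) auto
  next
    case (Suc n)
    then obtain K where K: "1 \<le> K" "\<And>u. 0 \<le> u \<Longrightarrow> M (2 ^ n * u) \<le> K * (M u + 1)" by blast
    have "M (2 ^ Suc n * u) \<le> (D * (K + 1)) * (M u + 1)" if "0 \<le> u" for u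
    proof -
      have "M (2 ^ Suc n * u) \<le> D * (M (2 ^ n * u) + 1)" using D(2)[of "2 ^ n * u"] that by (simp add: ac_simps)
      also have "\<dots> \<le> D * (K * (M u + 1) + 1 * (M u + 1))" using K(2)[OF that] D(1) M_nonneg[OF that]
        by (intro mult_left_mono add_mono) auto
      finally show ?thesis by (simp add: algebra_simps)
    qed
    moreover have "1 \<le> D * (K + 1)" using D(1) K(1) mult_mono[of 1 D 1 "K+1"] by auto
    ultimately show ?case by blast
  qed
  obtain n where n: "c < 2 ^ n" using real_arch_pow[of 2 c] by auto
  obtain K where K: "1 \<le> K" "\<And>u. 0 \<le> u \<Longrightarrow> M (2 ^ n * u) \<le> K * (M u + 1)" using pow by blast
  have "M (c * u) \<le> K * (M u + 1)" if "0 \<le> u" for u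
    using K(2)[OF that] M_mono[of "c * u" "2 ^ n * u"] n c that mult_right_mono[of c "2 ^ n" u] by auto
  then show ?thesis using that[of K] K(1) by blast
qed

text \<open>Integrate over the intervals \<open>(2^-(k+1), 2^-k]\<close>, on which the function is between \<open>\<beta>^k\<close> and
  \<open>\<beta>^(k+1)\<close>. The scaling parameter in the definition of the space is removed by dilation bounds.\<close>
lemma power_mem_orlicz_space_iff:
  "(\<lambda>t. t powr (- 1 / p)) \<in> orlicz_space M \<longleftrightarrow> summable (\<lambda>k. M (\<beta> ^ k) / 2 ^ k)"
proof
  let ?h = "\<lambda>t::real. t powr (- 1 / p)"
  let ?A = "\<lambda>k::nat. {(1/2) ^ Suc k <.. (1/2::real) ^ k}"
  have measA: "emeasure \<mu> (?A k) = ennreal ((1/2) ^ Suc k)" for k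
    by (subst emeasure_unit_interval_greaterThanAtMost) (auto simp: power_le_one)
  have setA [measurable]: "?A k \<in> sets \<mu>" for k
    using power_le_one[of "1/2::real" k] by (auto simp: sets_restrict_space_iff)
  have A: "1 / t < 2 ^ Suc k \<and> 2 ^ k \<le> 1 / t \<longleftrightarrow> t \<in> ?A k" if "0 < t" for t k
    using that by (auto simp: field_simps)
  have hval: "\<beta> ^ k \<le> ?h t \<and> ?h t \<le> \<beta> ^ Suc k" if "t \<in> ?A k" for t k
  proof -
    have t: "0 < t" using that by (auto intro: less_trans[rotated])
    have eq: "?h t = (1 / t) powr (1 / p)" using t by (simp add: powr_minus_divide powr_divide)
    have "(2 ^ k) powr (1 / p) \<le> (1 / t) powr (1 / p)" "(1 / t) powr (1 / p) \<le> (2 ^ Suc k) powr (1 / p)"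
      using A[OF t, of k] that p_gt_1 by (auto intro!: powr_mono2)
    then show ?thesis unfolding eq powr_pow_beta by blast
  qed
  have disj: "t \<notin> ?A j" if "t \<in> ?A k" "j \<noteq> k" for t j k
  proof (cases "j < k")
    case True
    then have "(1/2::real) ^ k \<le> (1/2) ^ Suc j" by (intro power_decreasing) auto
    then show ?thesis using that by auto
  next
    case False
    then have "(1/2::real) ^ j \<le> (1/2) ^ Suc k" using that by (intro power_decreasing) auto
    then show ?thesis using that by auto
  qed
  have sum_at: "(\<Sum>j. ennreal (f j) * indicator (?A j) t) = ennreal (f k)" if "t \<in> ?A k" for f t k
    using that disj[OF that] by (subst suminf_single[of k]) auto
  have sum_int: "(\<integral>\<^sup>+ t. (\<Sum>k. ennreal (f k) * indicator (?A k) t) \<partial>\<mu>)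
      = (\<Sum>k. ennreal (f k) * ennreal ((1/2) ^ Suc k))" for f
    by (subst nn_integral_suminf) (auto simp: nn_integral_cmult_indicator measA simp del: power_Suc)
  have exA: "\<exists>k. t \<in> ?A k" if "0 < t" "t \<le> 1" for t
    using geometric_bracket[of 2 "1 / t"] A[OF that(1)] that by (metis le_divide_eq_1_pos one_less_numeral_iff semiring_norm(76))
  have h_meas: "?h \<in> borel_measurable \<mu>" by measurable
  {
    assume "?h \<in> orlicz_space M"
    then obtain r where r: "0 < r" "orlicz_modular M (\<lambda>t. ?h t / r) \<le> 1" unfolding orlicz_space_def by auto
    obtain K where K: "1 \<le> K" "\<And>u. 0 \<le> u \<Longrightarrow> M (r * u) \<le> K * (M u + 1)"
      using dilation_bound[of r] r(1) by (auto simp: less_imp_le)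
    have "(\<Sum>k. ennreal (M (\<beta> ^ k)) * ennreal ((1/2) ^ Suc k))
        = (\<integral>\<^sup>+ t. (\<Sum>k. ennreal (M (\<beta> ^ k)) * indicator (?A k) t) \<partial>\<mu>)"
      by (rule sum_int[symmetric])
    also have "\<dots> \<le> (\<integral>\<^sup>+ t. ennreal K * (ennreal (M \<bar>?h t / r\<bar>) + 1) \<partial>\<mu>)"
    proof (rule nn_integral_mono)
      fix t :: real assume "t \<in> space \<mu>"
      show "(\<Sum>k. ennreal (M (\<beta> ^ k)) * indicator (?A k) t) \<le> ennreal K * (ennreal (M \<bar>?h t / r\<bar>) + 1)"
      proof (cases "\<exists>k. t \<in> ?A k")
        case True
        then obtain k where k: "t \<in> ?A k" by blast
        have "M (\<beta> ^ k) \<le> M (?h t)" using hval[OF k] beta_gt_1 by (intro M_mono) auto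
        also have "M (?h t) \<le> K * (M \<bar>?h t / r\<bar> + 1)" using K(2)[of "\<bar>?h t / r\<bar>"] r by auto
        finally have "ennreal (M (\<beta> ^ k)) \<le> ennreal K * (ennreal (M \<bar>?h t / r\<bar>) + 1)"
          using K(1) by (subst ennreal_1[symmetric], subst ennreal_plus[symmetric], simp, simp, subst ennreal_mult[symmetric]) (auto intro: ennreal_leI)
        then show ?thesis using sum_at[OF k] by simp
      next
        case False
        then have "(\<Sum>k. ennreal (M (\<beta> ^ k)) * indicator (?A k) t) = (\<Sum>k::nat. 0)" by (intro suminf_cong) auto
        then show ?thesis by simp
      qed
    qed
    also have "\<dots> = ennreal K * (orlicz_modular M (\<lambda>t. ?h t / r) + 1)"
    proof -
      have "(\<lambda>t. ennreal (M \<bar>?h t / r\<bar>)) \<in> borel_measurable \<mu>" by measurable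
      then show ?thesis
        unfolding orlicz_modular_def by (simp only: nn_integral_cmult nn_integral_add
          borel_measurable_const borel_measurable_add nn_integral_const space_unit_interval
          emeasure_unit_interval mult_1)
    qed
    also have "\<dots> \<le> ennreal K * (1 + 1)" using r by (intro mult_left_mono add_mono) auto
    also have "\<dots> < top" by (simp add: ennreal_mult_less_top)
    finally have "(\<Sum>k. ennreal (M (\<beta> ^ k) * (1/2) ^ Suc k)) < top"
      using beta_gt_1 by (simp add: ennreal_mult[symmetric] del: power_Suc)
    then have "summable (\<lambda>k. M (\<beta> ^ k) * (1/2) ^ Suc k)"
      using beta_gt_1 by (intro summable_suminf_not_top) auto
    from summable_mult[OF this, of 2] show "summable (\<lambda>k. M (\<beta> ^ k) / 2 ^ k)"
      by (simp add: power_divide)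
  }
  {
    assume S: "summable (\<lambda>k. M (\<beta> ^ k) / 2 ^ k)"
    then have S1: "summable (\<lambda>k. M (\<beta> ^ Suc k) * (1/2) ^ Suc k)"
      by (subst (asm) summable_Suc_iff[symmetric]) (simp add: power_divide)
    have "orlicz_modular M ?h \<le> (\<integral>\<^sup>+ t. (\<Sum>k. ennreal (M (\<beta> ^ Suc k)) * indicator (?A k) t) \<partial>\<mu>)"
      unfolding orlicz_modular_def
    proof (rule nn_integral_mono)
      fix t :: real assume "t \<in> space \<mu>"
      then have t: "0 \<le> t" "t \<le> 1" by auto
      show "ennreal (M \<bar>?h t\<bar>) \<le> (\<Sum>k. ennreal (M (\<beta> ^ Suc k)) * indicator (?A k) t)"
      proof (cases "t = 0")
        case False
        then obtain k where k: "t \<in> ?A k" using exA[of t] t by auto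
        have "M (?h t) \<le> M (\<beta> ^ Suc k)" using hval[OF k] by (intro M_mono) auto
        then show ?thesis using sum_at[OF k, of "\<lambda>k. M (\<beta> ^ Suc k)"] by (auto intro: ennreal_leI)
      qed auto
    qed
    also have "\<dots> = (\<Sum>k. ennreal (M (\<beta> ^ Suc k) * (1/2) ^ Suc k))"
      using beta_gt_1 by (subst sum_int) (simp add: ennreal_mult[symmetric] del: power_Suc)
    also have "\<dots> = ennreal (\<Sum>k. M (\<beta> ^ Suc k) * (1/2) ^ Suc k)"
      using beta_gt_1 S1 by (intro suminf_ennreal2) auto
    also have "\<dots> \<le> ennreal (max 1 (\<Sum>k. M (\<beta> ^ Suc k) * (1/2) ^ Suc k))" by (intro ennreal_leI) auto
    finally show "?h \<in> orlicz_space M" by (rule orlicz_space_of_modular(1)[OF h_meas max.cobounded1])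
  }
qed

text \<open>Let \<open>m\<close> be the first index with \<open>\<beta>^m > u\<close>. Below \<open>m\<close> the terms are at most \<open>M(\<beta>^k)\<close>, which grows at
  least like \<open>\<beta>^k\<close> by convexity. Above \<open>m\<close> they are \<open>M(\<beta>^k) u\<^sup>2/\<beta>^(2k)\<close>, where \<open>M(\<beta>^k)\<close> grows
  roughly like \<open>2^k\<close> and \<open>\<beta>\<^sup>2 > 2\<close> because \<open>p < 2\<close>. So the sum is a two-sided geometric series around \<open>m\<close>
  and is comparable with its largest term \<open>M(\<beta>^m)\<close>, that is, with \<open>M(u)\<close>.\<close>
lemma weighted_truncation_bound:
  obtains C where "0 < C"
    "\<And>u n. 0 \<le> u \<Longrightarrow> (\<Sum>k<n. M (\<beta> ^ k) * min 1 (u\<^sup>2 / (\<beta> ^ k)\<^sup>2)) \<le> C * (M u + 1)"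
proof -
  \<comment> \<open>Any number strictly between 2 and \<open>\<beta>\<^sup>2\<close> would do: it bounds the growth of \<open>M(\<beta>^k)\<close> from above.\<close>
  define \<rho> where "\<rho> = (2 + \<beta>\<^sup>2) / 2"
  have rho: "2 < \<rho>" "\<rho> < \<beta>\<^sup>2" unfolding \<rho>_def using beta_sq_gt_2 by auto
  obtain T0 where T0: "\<And>t. T0 \<le> t \<Longrightarrow> M (\<beta> * t) \<le> \<rho> * M t"
    using M_ratio[of \<beta> 1 \<rho>] beta_gt_1 rho unfolding beta_powr eventually_at_top_linorder by auto
  define T where "T = max 1 T0"
  have T: "1 \<le> T" "\<And>t. T \<le> t \<Longrightarrow> M (\<beta> * t) \<le> \<rho> * M t" using T0 unfolding T_def by auto
  define \<theta> where "\<theta> = \<rho> / \<beta>\<^sup>2"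
  have theta: "0 < \<theta>" "\<theta> < 1" unfolding \<theta>_def using rho beta_gt_1 by (auto simp: field_simps)
  define D where "D = 1 / (1 - 1 / \<beta>) + 1 / (1 - \<theta>)"
  have D: "0 < D" unfolding D_def using theta beta_gt_1 by (auto intro!: add_pos_pos)
  have main: "(\<Sum>k<n. M (\<beta> ^ k) * min 1 (u\<^sup>2 / (\<beta> ^ k)\<^sup>2)) \<le> D * \<rho> * (M u + M T)" if u: "0 \<le> u" for u n
  proof -
    \<comment> \<open>The growth bound holds only beyond \<open>T\<close>, so smaller \<open>u\<close> are treated like \<open>T\<close>.\<close>
    define x where "x = max u T"
    have x: "1 \<le> x" "u \<le> x" "T \<le> x" unfolding x_def using T by auto
    obtain m0 where m0: "\<beta> ^ m0 \<le> x" "x < \<beta> ^ Suc m0" using geometric_bracket[OF beta_gt_1 x(1)] by blast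
    define m where "m = Suc m0"
    have m: "x \<le> \<beta> ^ m" "\<beta> ^ m \<le> \<beta> * x" using m0 beta_gt_1 unfolding m_def by auto
    have "M (\<beta> ^ m) \<le> M (\<beta> * x)" using m beta_gt_1 by (intro M_mono) auto
    also have "\<dots> \<le> \<rho> * M x" using T(2) x by blast
    also have "\<dots> \<le> \<rho> * (M u + M T)" using rho T u by (intro mult_left_mono) (auto simp: x_def max_def)
    finally have Mm: "M (\<beta> ^ m) \<le> \<rho> * (M u + M T)" .
    let ?h = "\<lambda>k. M (\<beta> ^ k) * min 1 (u\<^sup>2 / (\<beta> ^ k)\<^sup>2)"
    have h0: "0 \<le> ?h k" for k using beta_gt_1 by auto
    have low: "?h (m - j) \<le> M (\<beta> ^ m) * (1 / \<beta>) ^ j" if "j \<le> m" for j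
    proof -
      have "?h (m - j) \<le> M (\<beta> ^ (m - j)) * 1" using beta_gt_1 by (intro mult_left_mono) auto
      also have "\<dots> = M ((1 / \<beta>) ^ j * \<beta> ^ m)" using that beta_gt_1
        by (simp add: power_diff power_divide)
      also have "\<dots> \<le> (1 / \<beta>) ^ j * M (\<beta> ^ m)" using beta_gt_1 by (intro M_contract) (auto simp: power_le_one)
      finally show ?thesis by (simp add: ac_simps)
    qed
    have Mhigh: "M (\<beta> ^ (m + j)) \<le> M (\<beta> ^ m) * \<rho> ^ j" for j
    proof (induction j)
      case (Suc j)
      have "\<beta> ^ m * 1 \<le> \<beta> ^ m * \<beta> ^ j" using beta_gt_1 by (intro mult_left_mono) auto
      then have "T \<le> \<beta> ^ (m + j)" using x(3) m(1) unfolding power_add by linarith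
      then have "M (\<beta> ^ (m + Suc j)) \<le> \<rho> * M (\<beta> ^ (m + j))" using T(2)[of "\<beta> ^ (m + j)"] by (simp add: ac_simps)
      also have "\<dots> \<le> \<rho> * (M (\<beta> ^ m) * \<rho> ^ j)" using Suc rho by (intro mult_left_mono) auto
      finally show ?case by (simp add: ac_simps)
    qed auto
    have high: "?h (m + j) \<le> M (\<beta> ^ m) * \<theta> ^ j" for j
    proof -
      have "u\<^sup>2 / (\<beta> ^ (m + j))\<^sup>2 \<le> (\<beta> ^ m)\<^sup>2 / (\<beta> ^ (m + j))\<^sup>2"
        using u x m by (intro divide_right_mono power_mono) auto
      also have "\<dots> = 1 / (\<beta>\<^sup>2) ^ j" using beta_gt_1
        by (simp add: power_add power_mult_distrib power_mult[symmetric] mult.commute)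
      finally have "?h (m + j) \<le> (M (\<beta> ^ m) * \<rho> ^ j) * (1 / (\<beta>\<^sup>2) ^ j)"
        using Mhigh[of j] beta_gt_1 rho by (intro mult_mono min.coboundedI2) auto
      then show ?thesis by (simp add: \<theta>_def power_divide)
    qed
    have geo: "(\<Sum>j<n. q ^ j) \<le> 1 / (1 - q)" if "0 \<le> q" "q < 1" for q :: real and n
      using that by (simp add: sum_gp_strict divide_right_mono)
    have "(\<Sum>k<n. ?h k) \<le> (\<Sum>k<m + n. ?h k)" using h0 by (intro sum_mono2) auto
    also have "\<dots> = (\<Sum>k<m. ?h k) + (\<Sum>j<n. ?h (m + j))" 
      using sum.atLeastLessThan_concat[of 0 m "m + n" ?h] sum.shift_bounds_nat_ivl[of ?h 0 m n]
      by (simp add: atLeast0LessThan ac_simps)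
    also have "(\<Sum>k<m. ?h k) = (\<Sum>j<m. ?h (m - Suc j))" by (rule sum.nat_diff_reindex[symmetric])
    also have "\<dots> \<le> (\<Sum>j<m. M (\<beta> ^ m) * (1 / \<beta>) ^ j)"
    proof (rule sum_mono)
      fix j assume j: "j \<in> {..<m}"
      have "?h (m - Suc j) \<le> M (\<beta> ^ m) * (1 / \<beta>) ^ Suc j" using j by (intro low) auto
      also have "\<dots> \<le> M (\<beta> ^ m) * (1 / \<beta>) ^ j"
        using beta_gt_1 by (intro mult_left_mono power_decreasing) auto
      finally show "?h (m - Suc j) \<le> M (\<beta> ^ m) * (1 / \<beta>) ^ j" .
    qed
    also have "\<dots> \<le> M (\<beta> ^ m) * (1 / (1 - 1 / \<beta>))"
      unfolding sum_distrib_left[symmetric] using beta_gt_1 by (intro mult_left_mono geo) auto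
    also have "(\<Sum>j<n. ?h (m + j)) \<le> (\<Sum>j<n. M (\<beta> ^ m) * \<theta> ^ j)" by (intro sum_mono high)
    also have "\<dots> \<le> M (\<beta> ^ m) * (1 / (1 - \<theta>))"
      unfolding sum_distrib_left[symmetric] using beta_gt_1 theta by (intro mult_left_mono geo) auto
    finally have "(\<Sum>k<n. ?h k) \<le> D * M (\<beta> ^ m)" by (simp add: D_def algebra_simps)
    also have "\<dots> \<le> D * (\<rho> * (M u + M T))" using Mm D by (intro mult_left_mono) auto
    finally show ?thesis by simp
  qed
  have "(\<Sum>k<n. M (\<beta> ^ k) * min 1 (u\<^sup>2 / (\<beta> ^ k)\<^sup>2)) \<le> D * \<rho> * (1 + M T) * (M u + 1)" if "0 \<le> u" for u n
  proof -
    have "M u + M T \<le> (1 + M T) * (M u + 1)" using that T by (simp add: algebra_simps)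
    then have "D * \<rho> * (M u + M T) \<le> D * \<rho> * ((1 + M T) * (M u + 1))" using D rho by (intro mult_left_mono) auto
    then show ?thesis using main[OF that, of n] by (simp add: ac_simps)
  qed
  moreover have "0 < D * \<rho> * (1 + M T)" using D rho T by (intro mult_pos_pos) (auto intro!: add_pos_nonneg)
  ultimately show ?thesis using that by blast
qed

end


section \<open>Random signs\<close>

definition signs :: "'i set \<Rightarrow> ('i \<Rightarrow> real) set" where
  "signs I = (\<Pi>\<^sub>E i\<in>I. {-1, 1})"

lemma finite_signs: "finite I \<Longrightarrow> finite (signs I)"
  unfolding signs_def by (rule finite_PiE) auto

lemma signs_nonempty: "signs I \<noteq> {}"
  unfolding signs_def by (simp add: PiE_eq_empty_iff)

lemma sign_cases: "\<epsilon> \<in> signs I \<Longrightarrow> i \<in> I \<Longrightarrow> \<epsilon> i = -1 \<or> \<epsilon> i = 1"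
  unfolding signs_def by (drule (1) PiE_mem) simp

lemma sum_signs_flip:
  assumes "i \<in> I"
  shows "(\<Sum>\<epsilon>\<in>signs I. F (\<epsilon>(i := - \<epsilon> i))) = (\<Sum>\<epsilon>\<in>signs I. F \<epsilon>)"
proof -
  have m: "\<epsilon>(i := - \<epsilon> i) \<in> signs I" if "\<epsilon> \<in> signs I" for \<epsilon>
    using that assms sign_cases[OF that assms] unfolding signs_def by (auto simp: PiE_iff extensional_def)
  show ?thesis
    by (rule sum.reindex_bij_witness[of _ "\<lambda>\<epsilon>. \<epsilon>(i := - \<epsilon> i)" "\<lambda>\<epsilon>. \<epsilon>(i := - \<epsilon> i)"])
      (auto simp: m)
qed

lemma sum_signs_square:
  fixes a :: "'i \<Rightarrow> real"
  assumes I: "finite I"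
  shows "(\<Sum>\<epsilon>\<in>signs I. (\<Sum>i\<in>I. \<epsilon> i * a i)\<^sup>2) = card (signs I) * (\<Sum>i\<in>I. (a i)\<^sup>2)"
proof -
  have cross: "(\<Sum>\<epsilon>\<in>signs I. \<epsilon> i * \<epsilon> j) = (if i = j then card (signs I) else 0)"
    if "i \<in> I" "j \<in> I" for i j
  proof (cases "i = j")
    case True
    have "\<epsilon> i * \<epsilon> i = 1" if "\<epsilon> \<in> signs I" for \<epsilon>
      using sign_cases[OF that \<open>i \<in> I\<close>] by auto
    with True show ?thesis by simp
  next
    case False
    have "(\<Sum>\<epsilon>\<in>signs I. \<epsilon> i * \<epsilon> j) = (\<Sum>\<epsilon>\<in>signs I. - (\<epsilon> i * \<epsilon> j))"
      using sum_signs_flip[OF that(1), of "\<lambda>\<epsilon>. \<epsilon> i * \<epsilon> j"] False by simp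
    with False show ?thesis by (simp add: sum_negf)
  qed
  have "(\<Sum>\<epsilon>\<in>signs I. (\<Sum>i\<in>I. \<epsilon> i * a i)\<^sup>2)
      = (\<Sum>\<epsilon>\<in>signs I. \<Sum>i\<in>I. \<Sum>j\<in>I. (\<epsilon> i * \<epsilon> j) * (a i * a j))"
    by (simp add: power2_eq_square sum_product ac_simps)
  also have "\<dots> = (\<Sum>i\<in>I. \<Sum>j\<in>I. (\<Sum>\<epsilon>\<in>signs I. \<epsilon> i * \<epsilon> j) * (a i * a j))"
    unfolding sum_distrib_right by (subst sum.swap, rule sum.cong[OF refl], rule sum.swap)
  also have "\<dots> = (\<Sum>i\<in>I. \<Sum>j\<in>I. if i = j then card (signs I) * (a i)\<^sup>2 else 0)"
    by (intro sum.cong refl) (simp add: cross power2_eq_square)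
  also have "\<dots> = card (signs I) * (\<Sum>i\<in>I. (a i)\<^sup>2)"
    using I by (simp add: sum.delta sum_distrib_left)
  finally show ?thesis .
qed

lemma of_bool_le_square_ratio:
  fixes y s :: real
  assumes "0 < s"
  shows "of_bool (s \<le> \<bar>y\<bar>) \<le> y\<^sup>2 / s\<^sup>2"
proof (cases "s \<le> \<bar>y\<bar>")
  case True
  then have "s\<^sup>2 \<le> y\<^sup>2" using assms by (intro abs_le_square_iff[THEN iffD1]) auto
  then show ?thesis using assms by simp
qed auto

text \<open>Either some \<open>\<bar>a_i\<bar>\<close> exceeds \<open>x\<close> and the right-hand side is at least the number of sign choices, or
  all minima are \<open>a_i\<^sup>2/x\<^sup>2\<close> and this is the inequality of Chebyshev for orthogonal signs.\<close>
lemma sum_signs_tail: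
  fixes a :: "'i \<Rightarrow> real"
  assumes I: "finite I" and x: "0 < x"
  shows "(\<Sum>\<epsilon>\<in>signs I. of_bool (x < \<bar>\<Sum>i\<in>I. \<epsilon> i * a i\<bar>))
     \<le> card (signs I) * (\<Sum>i\<in>I. min 1 ((a i)\<^sup>2 / x\<^sup>2))"
proof (cases "\<exists>i\<in>I. x < \<bar>a i\<bar>")
  case True
  then obtain i where i: "i \<in> I" "x < \<bar>a i\<bar>" by blast
  then have "x\<^sup>2 \<le> (a i)\<^sup>2" using x by (metis abs_le_square_iff abs_of_pos less_imp_le)
  then have "1 = min 1 ((a i)\<^sup>2 / x\<^sup>2)" using x by simp
  also have "\<dots> \<le> (\<Sum>i\<in>I. min 1 ((a i)\<^sup>2 / x\<^sup>2))" using i I by (intro member_le_sum) auto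
  finally have 1: "1 \<le> (\<Sum>i\<in>I. min 1 ((a i)\<^sup>2 / x\<^sup>2))" .
  have "(\<Sum>\<epsilon>\<in>signs I. of_bool (x < \<bar>\<Sum>i\<in>I. \<epsilon> i * a i\<bar>)) \<le> (\<Sum>\<epsilon>\<in>signs I. 1 :: real)"
    by (intro sum_mono) auto
  also have "\<dots> \<le> card (signs I) * (\<Sum>i\<in>I. min 1 ((a i)\<^sup>2 / x\<^sup>2))"
    using mult_left_mono[OF 1, of "real (card (signs I))"] by simp
  finally show ?thesis .
next
  case False
  have "(a i)\<^sup>2 \<le> x\<^sup>2" if "i \<in> I" for i
    using False that x by (intro abs_le_square_iff[THEN iffD1]) auto
  then have eq: "min 1 ((a i)\<^sup>2 / x\<^sup>2) = (a i)\<^sup>2 / x\<^sup>2" if "i \<in> I" for i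
    using that x by (simp add: min_absorb2)
  have "of_bool (x < \<bar>s\<bar>) \<le> s\<^sup>2 / x\<^sup>2" for s :: real
    using of_bool_le_square_ratio[OF x, of s] by (cases "x < \<bar>s\<bar>") auto
  then have "(\<Sum>\<epsilon>\<in>signs I. of_bool (x < \<bar>\<Sum>i\<in>I. \<epsilon> i * a i\<bar>))
      \<le> (\<Sum>\<epsilon>\<in>signs I. (\<Sum>i\<in>I. \<epsilon> i * a i)\<^sup>2 / x\<^sup>2)" by (intro sum_mono) auto
  also have "\<dots> = card (signs I) * (\<Sum>i\<in>I. (a i)\<^sup>2) / x\<^sup>2"
    unfolding sum_divide_distrib[symmetric] sum_signs_square[OF I] ..
  also have "\<dots> = card (signs I) * (\<Sum>i\<in>I. min 1 ((a i)\<^sup>2 / x\<^sup>2))"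
    by (simp add: eq sum_divide_distrib[symmetric])
  finally show ?thesis .
qed

text \<open>Flipping the sign of the \<open>i\<close>-th summand changes the sum by \<open>2 \<bar>a_i\<bar>\<close>, so one of the two sums is at
  least \<open>\<bar>a_i\<bar>\<close> in absolute value. The truncation by \<open>\<bar>a_i\<bar>\<close> makes the summands bounded by their
  target, which is what lets a single choice of signs satisfy two averaged estimates.\<close>
lemma sum_signs_ge_max:
  fixes a :: "'i \<Rightarrow> real" and G :: "real \<Rightarrow> real"
  assumes I: "finite I" "i \<in> I" and G: "\<And>u v. 0 \<le> u \<Longrightarrow> u \<le> v \<Longrightarrow> G u \<le> G v" "0 \<le> G 0"
  shows "card (signs I) * G \<bar>a i\<bar> / 2 \<le> (\<Sum>\<epsilon>\<in>signs I. G (min \<bar>\<Sum>j\<in>I. \<epsilon> j * a j\<bar> \<bar>a i\<bar>))"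
proof -
  let ?S = "\<lambda>\<epsilon>. \<Sum>j\<in>I. \<epsilon> j * a j"
  have G0: "0 \<le> G u" if "0 \<le> u" for u using G(1)[of 0 u] G(2) that by simp
  have pair: "G \<bar>a i\<bar> \<le> G (min \<bar>?S \<epsilon>\<bar> \<bar>a i\<bar>) + G (min \<bar>?S (\<epsilon>(i := - \<epsilon> i))\<bar> \<bar>a i\<bar>)" if e: "\<epsilon> \<in> signs I" for \<epsilon>
  proof -
    have "?S \<epsilon> = \<epsilon> i * a i + (\<Sum>j\<in>I - {i}. \<epsilon> j * a j)" using I by (rule sum.remove)
    moreover have "?S (\<epsilon>(i := - \<epsilon> i)) = - (\<epsilon> i * a i) + (\<Sum>j\<in>I - {i}. \<epsilon> j * a j)"
      using I by (subst sum.remove[of _ i]) auto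
    moreover have "\<bar>\<epsilon> i * a i\<bar> = \<bar>a i\<bar>" using sign_cases[OF e I(2)] by auto
    ultimately have "\<bar>a i\<bar> \<le> \<bar>?S \<epsilon>\<bar> \<or> \<bar>a i\<bar> \<le> \<bar>?S (\<epsilon>(i := - \<epsilon> i))\<bar>" by linarith
    then have "min \<bar>?S \<epsilon>\<bar> \<bar>a i\<bar> = \<bar>a i\<bar> \<or> min \<bar>?S (\<epsilon>(i := - \<epsilon> i))\<bar> \<bar>a i\<bar> = \<bar>a i\<bar>" by auto
    moreover have "0 \<le> G (min \<bar>?S \<epsilon>\<bar> \<bar>a i\<bar>)" "0 \<le> G (min \<bar>?S (\<epsilon>(i := - \<epsilon> i))\<bar> \<bar>a i\<bar>)"
      by (intro G0; simp)+
    ultimately show ?thesis by auto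
  qed
  have "card (signs I) * G \<bar>a i\<bar> = (\<Sum>\<epsilon>\<in>signs I. G \<bar>a i\<bar>)" by simp
  also have "\<dots> \<le> (\<Sum>\<epsilon>\<in>signs I. G (min \<bar>?S \<epsilon>\<bar> \<bar>a i\<bar>) + G (min \<bar>?S (\<epsilon>(i := - \<epsilon> i))\<bar> \<bar>a i\<bar>))"
    by (intro sum_mono pair)
  also have "\<dots> = 2 * (\<Sum>\<epsilon>\<in>signs I. G (min \<bar>?S \<epsilon>\<bar> \<bar>a i\<bar>))"
    by (simp only: sum.distrib sum_signs_flip[OF I(2), of "\<lambda>\<epsilon>. G (min \<bar>?S \<epsilon>\<bar> \<bar>a i\<bar>)"] mult_2)
  finally show ?thesis by simp
qed

text \<open>The average of \<open>P - z/(4d) Q\<close> is at least \<open>z/4\<close>; take a point where this value is attained.\<close>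
lemma average_choice:
  fixes P Q :: "'a \<Rightarrow> real" and z d :: real
  assumes A: "finite A" "A \<noteq> {}" and P: "card A * z / 2 \<le> sum P A" and Q: "sum Q A \<le> card A * d"
    and z: "0 < z" "\<And>a. a \<in> A \<Longrightarrow> P a \<le> z" and d: "0 < d" "\<And>a. a \<in> A \<Longrightarrow> 0 \<le> Q a"
  obtains a where "a \<in> A" "z / 4 \<le> P a" "Q a \<le> 4 * d"
proof -
  have "\<exists>a\<in>A. z / 4 \<le> P a - z / (4 * d) * Q a"
  proof (rule ccontr)
    assume "\<not> ?thesis"
    then have "(\<Sum>a\<in>A. P a - z / (4 * d) * Q a) < (\<Sum>a\<in>A. z / 4)"
      using A by (intro sum_strict_mono) auto
    then have "sum P A - z / (4 * d) * sum Q A < card A * z / 4"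
      by (simp add: sum_subtractf sum_distrib_left)
    moreover have "z / (4 * d) * sum Q A \<le> z / (4 * d) * (card A * d)"
      using Q z d by (intro mult_left_mono) auto
    moreover have "z / (4 * d) * (card A * d) = card A * z / 4" using d by simp
    ultimately show False using P by simp
  qed
  then obtain a where a: "a \<in> A" "z / 4 \<le> P a - z / (4 * d) * Q a" by blast
  have 0: "0 \<le> z / (4 * d) * Q a" using z d a by simp
  have "z / (4 * d) * Q a \<le> z" using a z(2)[OF a(1)] z(1) by linarith
  then have "z * Q a \<le> z * (4 * d)" using d(1) by (simp add: divide_le_eq)
  then have "Q a \<le> 4 * d" using z(1) by (rule mult_left_le_imp_le)
  moreover have "z / 4 \<le> P a" using a 0 by linarith
  ultimately show ?thesis using that a by blast
qed

section \<open>Divergent series\<close>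

lemma finite_subset_eventually:
  fixes J :: "nat set"
  assumes "infinite J" "\<And>i. \<forall>\<^sub>F j in sequentially. Q i j"
  shows "\<exists>I\<subseteq>J. finite I \<and> card I = n \<and> (\<forall>i\<in>I. \<forall>j\<in>I. i < j \<longrightarrow> Q i j)"
proof (induction n)
  case 0
  then show ?case by (intro exI[of _ "{}"]) auto
next
  case (Suc n)
  then obtain I where I: "I \<subseteq> J" "finite I" "card I = n" "\<forall>i\<in>I. \<forall>j\<in>I. i < j \<longrightarrow> Q i j" by blast
  have "\<forall>\<^sub>F j in sequentially. \<forall>i\<in>I. i < j \<and> Q i j"
    using I(2) assms(2) by (intro eventually_ball_finite ballI eventually_conj eventually_gt_at_top) auto
  then obtain N where N: "\<And>j i. N \<le> j \<Longrightarrow> i \<in> I \<Longrightarrow> i < j \<and> Q i j"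
    unfolding eventually_sequentially by blast
  obtain j where j: "j \<in> J" "N \<le> j" using assms(1) unfolding infinite_nat_iff_unbounded_le by blast
  have "j \<notin> I" using N[OF j(2)] by blast
  then show ?case using I j N[OF j(2)]
    by (intro exI[of _ "insert j I"]) (auto dest: order.asym)
qed

text \<open>Split \<open>f\<close> at a level \<open>n\<close>: the part above \<open>n\<close> has small integral, and the part below contributes at
  most \<open>n\<close> times the measure of the set.\<close>
lemma integral_small_sets_tendsto_zero:
  fixes f :: "real \<Rightarrow> real"
  assumes f: "integrable \<mu> f" "\<And>t. 0 \<le> f t"
    and E: "\<And>j. E j \<in> sets \<mu>" "(\<lambda>j. measure \<mu> (E j)) \<longlonglongrightarrow> 0"
  shows "(\<lambda>j. \<integral>t. f t * indicator (E j) t \<partial>\<mu>) \<longlonglongrightarrow> 0"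
proof (rule LIMSEQ_I)
  fix r :: real assume r: "0 < r"
  note [measurable] = E(1) borel_measurable_integrable[OF f(1)]
  have "(\<lambda>n::nat. \<integral>t. f t * indicator {s. real n < f s} t \<partial>\<mu>) \<longlonglongrightarrow> (\<integral>t. 0 \<partial>\<mu>)"
  proof (rule integral_dominated_convergence[where w = f])
    show "AE t in unit_interval. (\<lambda>n. f t * indicator {s. real n < f s} t) \<longlonglongrightarrow> 0"
    proof (rule AE_I2)
      fix t
      obtain N where N: "f t \<le> real N" using real_arch_simple by blast
      have "\<forall>\<^sub>F n in sequentially. f t * indicator {s. real n < f s} t = 0"
        using eventually_ge_at_top[of N] by eventually_elim (use N in \<open>auto simp: indicator_def\<close>)
      then show "(\<lambda>n. f t * indicator {s. real n < f s} t) \<longlonglongrightarrow> 0"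
        by (rule tendsto_eventually)
    qed
  qed (use f in \<open>auto simp: indicator_def\<close>)
  then obtain n :: nat where n: "\<bar>\<integral>t. f t * indicator {s. real n < f s} t \<partial>\<mu>\<bar> < r / 2"
    using r LIMSEQ_D[of "\<lambda>n::nat. \<integral>t. f t * indicator {s. real n < f s} t \<partial>\<mu>" 0 "r/2"]
    by fastforce
  obtain N where N: "\<And>j. N \<le> j \<Longrightarrow> measure \<mu> (E j) < r / (2 * (real n + 1))"
    using LIMSEQ_D[OF E(2), of "r / (2 * (real n + 1))"] r by auto
  have "norm ((\<integral>t. f t * indicator (E j) t \<partial>\<mu>) - 0) < r" if "N \<le> j" for j
  proof -
    have i1: "integrable \<mu> (\<lambda>t. f t * indicator {s. real n < f s} t)"
      by (rule Bochner_Integration.integrable_bound[OF f(1)]) (use f(2) in \<open>auto simp: indicator_def\<close>)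
    have i3: "integrable \<mu> (\<lambda>t. f t * indicator (E j) t)"
      by (rule Bochner_Integration.integrable_bound[OF f(1)]) (use f(2) in \<open>auto simp: indicator_def\<close>)
    have i2: "integrable \<mu> (\<lambda>t. real n * indicator (E j) t)"
      using E(1)[of j] by (intro integrable_mult_right integrable_real_indicator) (auto simp: unit_interval.emeasure_eq_measure)
    have "(\<integral>t. f t * indicator (E j) t \<partial>\<mu>)
       \<le> (\<integral>t. f t * indicator {s. real n < f s} t + real n * indicator (E j) t \<partial>\<mu>)"
      using f(2) i1 i2 i3 by (intro integral_mono) (auto simp: indicator_def)
    also have "\<dots> = (\<integral>t. f t * indicator {s. real n < f s} t \<partial>\<mu>)
        + real n * measure \<mu> (E j)"
      using i1 i2 E(1)[of j] sets.sets_into_space[OF E(1)[of j]]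
      by (subst Bochner_Integration.integral_add) (auto simp: Int_absorb2)
    also have "\<dots> < r / 2 + r / 2"
    proof (rule add_less_le_mono)
      have "real n * measure \<mu> (E j) \<le> (real n + 1) * (r / (2 * (real n + 1)))"
        using N[OF that] by (intro mult_mono) auto
      also have "\<dots> = r / 2" by (simp add: divide_simps)
      finally show "real n * measure \<mu> (E j) \<le> r / 2" .
    qed (use n in auto)
    finally show ?thesis using f(2) by (simp add: integral_nonneg_AE)
  qed
  then show "\<exists>no. \<forall>j\<ge>no. norm ((\<integral>t. f t * indicator (E j) t \<partial>\<mu>) - 0) < r" by blast
qed


lemma (in orlicz) integrable_M_Max:
  fixes a :: "'i \<Rightarrow> real \<Rightarrow> real"
  assumes I: "finite I" "I \<noteq> {}"
    and [measurable]: "\<And>i. a i \<in> borel_measurable \<mu>"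
    and int: "\<And>i. integrable \<mu> (\<lambda>t. M \<bar>a i t\<bar>)"
  shows "integrable \<mu> (\<lambda>t. M (Max ((\<lambda>i. \<bar>a i t\<bar>) ` I)))"
proof (rule Bochner_Integration.integrable_bound)
  let ?V = "\<lambda>t. Max ((\<lambda>i. \<bar>a i t\<bar>) ` I)"
  have V: "?V t \<in> (\<lambda>i. \<bar>a i t\<bar>) ` I" for t using I by (intro Max_in) auto
  show "integrable \<mu> (\<lambda>t. \<Sum>i\<in>I. M \<bar>a i t\<bar>)" using int by auto
  show "AE t in unit_interval. norm (M (?V t)) \<le> norm (\<Sum>i\<in>I. M \<bar>a i t\<bar>)"
  proof (rule AE_I2)
    fix t
    obtain i where i: "i \<in> I" "?V t = \<bar>a i t\<bar>" using V[of t] by auto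
    have "M \<bar>a i t\<bar> \<le> (\<Sum>i\<in>I. M \<bar>a i t\<bar>)" using i I by (intro member_le_sum) auto
    then show "norm (M (?V t)) \<le> norm (\<Sum>i\<in>I. M \<bar>a i t\<bar>)" unfolding i(2) by simp
  qed
  have "?V \<in> borel_measurable \<mu>" by (rule borel_measurable_Max[OF I(1)]) measurable
  then have "(\<lambda>t. M \<bar>?V t\<bar>) \<in> borel_measurable \<mu>" by measurable
  moreover have "\<bar>?V t\<bar> = ?V t" for t using V[of t] by auto
  ultimately show "(\<lambda>t. M (?V t)) \<in> borel_measurable \<mu>" by simp
qed

text \<open>Both conclusions hold on average over the signs: the second by \<open>sum_signs_tail\<close>, the first by
  \<open>sum_signs_ge_max\<close> applied at each point to the largest \<open>\<bar>a_i(t)\<bar>\<close>.\<close>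
lemma (in orlicz) random_signs:
  fixes a :: "nat \<Rightarrow> real \<Rightarrow> real"
  assumes I: "finite I" "I \<noteq> {}"
    and meas: "\<And>i. a i \<in> borel_measurable \<mu>"
    and int: "\<And>i. integrable \<mu> (\<lambda>t. M \<bar>a i t\<bar>)"
    and x: "0 < x" and d: "0 < d" "(\<Sum>i\<in>I. \<integral>t. min 1 ((a i t)\<^sup>2 / x\<^sup>2) \<partial>\<mu>) \<le> d"
    and c: "0 < c" "c \<le> (\<integral>t. M (Max ((\<lambda>i. \<bar>a i t\<bar>) ` I)) \<partial>\<mu>)"
  obtains \<epsilon> where "\<epsilon> \<in> signs I"
    "ennreal (c / 4) \<le> orlicz_modular M (\<lambda>t. \<Sum>i\<in>I. \<epsilon> i * a i t)"
    "measure \<mu> {t \<in> {0..1}. x < \<bar>\<Sum>i\<in>I. \<epsilon> i * a i t\<bar>} \<le> 4 * d"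
proof -
  note [measurable] = meas
  define V where "V t = Max ((\<lambda>i. \<bar>a i t\<bar>) ` I)" for t
  have V_mem: "\<exists>i\<in>I. V t = \<bar>a i t\<bar>" for t
  proof -
    have "V t \<in> (\<lambda>i. \<bar>a i t\<bar>) ` I" unfolding V_def using I by (intro Max_in) auto
    then show ?thesis by auto
  qed
  have V0: "0 \<le> V t" for t using V_mem[of t] by auto
  have V_meas [measurable]: "V \<in> borel_measurable \<mu>"
    unfolding V_def[abs_def] by (rule borel_measurable_Max[OF I(1)]) measurable
  define S where "S \<epsilon> t = (\<Sum>i\<in>I. \<epsilon> i * a i t)" for \<epsilon> t
  have S_meas [measurable]: "S \<epsilon> \<in> borel_measurable \<mu>" for \<epsilon>
    unfolding S_def[abs_def] by measurable
  have intV: "integrable \<mu> (\<lambda>t. M \<bar>V t\<bar>)"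
    using integrable_M_Max[of I a, OF I meas int] V0 unfolding V_def[symmetric] by simp
  have intP: "integrable \<mu> (\<lambda>t. M \<bar>min \<bar>S \<epsilon> t\<bar> (V t)\<bar>)" for \<epsilon>
  proof (rule Bochner_Integration.integrable_bound[OF intV])
    show "(\<lambda>t. M \<bar>min \<bar>S \<epsilon> t\<bar> (V t)\<bar>) \<in> borel_measurable \<mu>" by measurable
  qed (use V0 in \<open>auto intro!: M_mono\<close>)
  have setA: "{t \<in> {0..1}. x < \<bar>S \<epsilon> t\<bar>} \<in> sets \<mu>" for \<epsilon>
  proof -
    have "{t \<in> space unit_interval. x < \<bar>S \<epsilon> t\<bar>} \<in> sets \<mu>" by measurable
    then show ?thesis by simp
  qed
  have intA: "integrable \<mu> (indicat_real {t \<in> {0..1}. x < \<bar>S \<epsilon> t\<bar>})" for \<epsilon>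
    using setA by (intro integrable_real_indicator) (auto simp: unit_interval.emeasure_eq_measure)
  have intmin: "integrable \<mu> (\<lambda>t. min 1 ((a i t)\<^sup>2 / x\<^sup>2))" for i
    by (rule unit_interval.integrable_const_bound[of _ 1]) auto
  let ?z = "\<integral>t. M \<bar>V t\<bar> \<partial>\<mu>"
  have cz: "c \<le> ?z" using c(2) V0 unfolding V_def[symmetric] by simp
  obtain \<epsilon> where e: "\<epsilon> \<in> signs I" "?z / 4 \<le> (\<integral>t. M \<bar>min \<bar>S \<epsilon> t\<bar> (V t)\<bar> \<partial>\<mu>)"
    "measure \<mu> {t \<in> {0..1}. x < \<bar>S \<epsilon> t\<bar>} \<le> 4 * d"
  proof (rule average_choice[of "signs I" ?z "\<lambda>\<epsilon>. \<integral>t. M \<bar>min \<bar>S \<epsilon> t\<bar> (V t)\<bar> \<partial>\<mu>"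
        "\<lambda>\<epsilon>. measure \<mu> {t \<in> {0..1}. x < \<bar>S \<epsilon> t\<bar>}" d])
    show "card (signs I) * ?z / 2 \<le> (\<Sum>\<epsilon>\<in>signs I. \<integral>t. M \<bar>min \<bar>S \<epsilon> t\<bar> (V t)\<bar> \<partial>\<mu>)"
    proof -
      have "card (signs I) * ?z / 2 = (\<integral>t. card (signs I) * M \<bar>V t\<bar> / 2 \<partial>\<mu>)" by simp
      also have "\<dots> \<le> (\<integral>t. (\<Sum>\<epsilon>\<in>signs I. M \<bar>min \<bar>S \<epsilon> t\<bar> (V t)\<bar>) \<partial>\<mu>)"
      proof (rule integral_mono)
        fix t
        obtain i where i: "i \<in> I" "V t = \<bar>a i t\<bar>" using V_mem by blast
        have "card (signs I) * M \<bar>\<bar>a i t\<bar>\<bar> / 2 \<le> (\<Sum>\<epsilon>\<in>signs I. M \<bar>min \<bar>S \<epsilon> t\<bar> \<bar>a i t\<bar>\<bar>)"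
          unfolding S_def using I(1) i(1)
          by (rule sum_signs_ge_max[of I i "\<lambda>u. M \<bar>u\<bar>" "\<lambda>i. a i t"]) (auto intro: M_mono)
        then show "card (signs I) * M \<bar>V t\<bar> / 2 \<le> (\<Sum>\<epsilon>\<in>signs I. M \<bar>min \<bar>S \<epsilon> t\<bar> (V t)\<bar>)"
          unfolding i(2) .
      qed (use intV intP in auto)
      also have "\<dots> = (\<Sum>\<epsilon>\<in>signs I. \<integral>t. M \<bar>min \<bar>S \<epsilon> t\<bar> (V t)\<bar> \<partial>\<mu>)"
        using intP by simp
      finally show ?thesis .
    qed
    show "(\<Sum>\<epsilon>\<in>signs I. measure \<mu> {t \<in> {0..1}. x < \<bar>S \<epsilon> t\<bar>}) \<le> card (signs I) * d"
    proof -
      have "(\<Sum>\<epsilon>\<in>signs I. measure \<mu> {t \<in> {0..1}. x < \<bar>S \<epsilon> t\<bar>})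
         = (\<integral>t. (\<Sum>\<epsilon>\<in>signs I. indicat_real {t \<in> {0..1}. x < \<bar>S \<epsilon> t\<bar>} t) \<partial>\<mu>)"
      proof -
        have "measure \<mu> {t \<in> {0..1}. x < \<bar>S \<epsilon> t\<bar>}
            = (\<integral>t. indicat_real {t \<in> {0..1}. x < \<bar>S \<epsilon> t\<bar>} t \<partial>\<mu>)" for \<epsilon>
          by (subst Bochner_Integration.integral_indicator) (auto intro!: arg_cong[where f = "measure \<mu>"])
        then show ?thesis using intA by (subst Bochner_Integration.integral_sum) auto
      qed
      also have "\<dots> \<le> (\<integral>t. card (signs I) * (\<Sum>i\<in>I. min 1 ((a i t)\<^sup>2 / x\<^sup>2)) \<partial>\<mu>)"
      proof (rule integral_mono)
        fix t assume "t \<in> space \<mu>"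
        then have "(\<Sum>\<epsilon>\<in>signs I. indicat_real {t \<in> {0..1}. x < \<bar>S \<epsilon> t\<bar>} t)
            = (\<Sum>\<epsilon>\<in>signs I. of_bool (x < \<bar>S \<epsilon> t\<bar>))" by (simp add: indicator_def)
        then show "(\<Sum>\<epsilon>\<in>signs I. indicat_real {t \<in> {0..1}. x < \<bar>S \<epsilon> t\<bar>} t)
            \<le> card (signs I) * (\<Sum>i\<in>I. min 1 ((a i t)\<^sup>2 / x\<^sup>2))"
          using sum_signs_tail[OF I(1) x, of "\<lambda>i. a i t"] unfolding S_def by simp
      qed (use intA intmin in auto)
      also have "\<dots> = card (signs I) * (\<Sum>i\<in>I. \<integral>t. min 1 ((a i t)\<^sup>2 / x\<^sup>2) \<partial>\<mu>)"
        using intmin by simp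
      also have "\<dots> \<le> card (signs I) * d" using d(2) by (intro mult_left_mono) auto
      finally show ?thesis .
    qed
    show "(\<integral>t. M \<bar>min \<bar>S \<epsilon> t\<bar> (V t)\<bar> \<partial>\<mu>) \<le> ?z" for \<epsilon>
      using V0 by (intro integral_mono intP intV M_mono) auto
  qed (use I c cz d finite_signs signs_nonempty in auto)
  have "ennreal (c / 4) \<le> ennreal (\<integral>t. M \<bar>min \<bar>S \<epsilon> t\<bar> (V t)\<bar> \<partial>\<mu>)"
    using e(2) cz by (intro ennreal_leI) auto
  also have "\<dots> = (\<integral>\<^sup>+t. M \<bar>min \<bar>S \<epsilon> t\<bar> (V t)\<bar> \<partial>\<mu>)"
    using intP by (intro nn_integral_eq_integral[symmetric]) auto
  also have "\<dots> \<le> orlicz_modular M (S \<epsilon>)"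
    unfolding orlicz_modular_def using V0 by (intro nn_integral_mono ennreal_leI M_mono) auto
  finally show ?thesis using that[of \<epsilon>] e unfolding S_def by blast
qed

text \<open>This replaces a disjointification of the sets \<open>E_i\<close>: if \<open>k\<close> is the last index with \<open>t\<close> in \<open>E_k\<close>, then
  the summand for \<open>k\<close> is \<open>b_k\<close>, and for every other index the subtracted sum makes the summand
  nonpositive.\<close>
lemma last_set_lower_bound:
  fixes I :: "nat set" and b :: "nat \<Rightarrow> real"
  assumes I: "finite I" "I \<noteq> {}" and b: "\<And>i. i \<in> I \<Longrightarrow> 0 \<le> b i" "\<And>i. i \<in> I \<Longrightarrow> b i \<le> m" 
  shows "(\<Sum>i\<in>I. b i * indicator (E i) t - (\<Sum>j\<in>{j\<in>I. i < j}. b i * indicator (E j) t)) \<le> m"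
proof (cases "\<exists>i\<in>I. t \<in> E i")
  case False
  then have "(\<Sum>i\<in>I. b i * indicator (E i) t - (\<Sum>j\<in>{j\<in>I. i < j}. b i * indicator (E j) t)) = (\<Sum>i\<in>I. 0)"
    by (intro sum.cong) (auto simp: indicator_def)
  moreover have "0 \<le> m" using I b by (meson all_not_in_conv order_trans)
  ultimately show ?thesis by simp
next
  case True
  define k where "k = Max {i \<in> I. t \<in> E i}"
  have k: "k \<in> I" "t \<in> E k" "\<And>j. j \<in> I \<Longrightarrow> t \<in> E j \<Longrightarrow> j \<le> k"
    using Max_in[of "{i \<in> I. t \<in> E i}"] Max_ge[of "{i \<in> I. t \<in> E i}"] True I unfolding k_def by auto
  have nn: "0 \<le> (\<Sum>j\<in>{j\<in>I. i < j}. b i * indicator (E j) t)" if "i \<in> I" for i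
    using b(1)[OF that] by (intro sum_nonneg) auto
  have "(\<Sum>i\<in>I. b i * indicator (E i) t - (\<Sum>j\<in>{j\<in>I. i < j}. b i * indicator (E j) t))
      \<le> (\<Sum>i\<in>I. if i = k then b k else 0)"
  proof (rule sum_mono)
    fix i assume i: "i \<in> I"
    consider "i = k" | "i < k" | "k < i" by linarith
    then show "b i * indicator (E i) t - (\<Sum>j\<in>{j\<in>I. i < j}. b i * indicator (E j) t) \<le> (if i = k then b k else 0)"
    proof cases
      case 1
      then show ?thesis using k nn[OF i] by (simp add: indicator_def)
    next
      case 2
      have "b i * indicator (E k) t \<le> (\<Sum>j\<in>{j\<in>I. i < j}. b i * indicator (E j) t)"
        using 2 k I b(1)[OF i] by (intro member_le_sum[of k "{j\<in>I. i < j}"]) auto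
      moreover have "b i * indicator (E i) t \<le> b i * indicator (E k) t"
        using k b(1)[OF i] by (auto simp: indicator_def)
      ultimately show ?thesis using 2 by simp
    next
      case 3
      then have "t \<notin> E i" using k(3)[OF i] by auto
      then show ?thesis using 3 nn[OF i] by simp
    qed
  qed
  also have "\<dots> = b k" using k I by simp
  finally show ?thesis using b(2)[OF k(1)] by simp
qed

context rv_orlicz
begin

text \<open>The core of the divergent case. With \<open>N = 2^k\<close> indices and \<open>s = \<beta>^k\<close> the combination is
  \<open>(\<Sum>i. \<epsilon>_i z_i) / s\<close>. The exponent \<open>k\<close> is chosen first, from the divergence of the series. The
  indices are then taken so far out that \<open>E_i\<close> is negligible compared with all constants depending
  on \<open>k\<close> and that \<open>E_j\<close> carries almost nothing of \<open>z_i\<close> for \<open>i < j\<close>.\<close>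
lemma combination_small_in_measure:
  fixes z :: "nat \<Rightarrow> real \<Rightarrow> real"
  assumes meas: "\<And>i. z i \<in> borel_measurable \<mu>"
    and mod: "\<And>i. orlicz_modular M (z i) \<le> 1"
    and E: "\<And>i. E i \<in> sets \<mu>" "(\<lambda>i. measure \<mu> (E i)) \<longlonglongrightarrow> 0"
    and c: "0 < c" "\<And>i. c \<le> (\<integral>t. M \<bar>z i t\<bar> * indicator (E i) t \<partial>\<mu>)"
    and W: "\<not> summable (\<lambda>k. M (\<beta> ^ k) / 2 ^ k)"
    and d: "0 < d"
  obtains I w where "finite I"
    "ennreal (c / 32) \<le> orlicz_modular M (\<lambda>t. \<Sum>i\<in>I. w i * z i t)"
    "measure \<mu> {t \<in> {0..1}. d < \<bar>\<Sum>i\<in>I. w i * z i t\<bar>} \<le> d"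
proof -
  note [measurable] = meas E(1)
  have intz: "integrable \<mu> (\<lambda>t. M \<bar>z i t\<bar>)" for i
    by (rule integrable_of_modular_le_1[OF meas mod])
  have intz1: "(\<integral>t. M \<bar>z i t\<bar> \<partial>\<mu>) \<le> 1" for i
    using mod[of i] nn_integral_eq_integral[OF intz[of i]] unfolding orlicz_modular_def by simp
  have intmin: "integrable \<mu> (\<lambda>t. min 1 ((z i t)\<^sup>2 / x\<^sup>2))" for i and x :: real
    by (rule unit_interval.integrable_const_bound[of _ 1]) auto
  define R where "R k i = 2 ^ k * (\<integral>t. min 1 ((z i t)\<^sup>2 / (\<beta> ^ k)\<^sup>2) \<partial>\<mu>)" for k i
  have R0: "0 \<le> R k i" for k i unfolding R_def by (auto intro!: integral_nonneg_AE)
  obtain C where C: "0 < C"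
    "\<And>u n. 0 \<le> u \<Longrightarrow> (\<Sum>k<n. M (\<beta> ^ k) * min 1 (u\<^sup>2 / (\<beta> ^ k)\<^sup>2)) \<le> C * (M u + 1)"
    using weighted_truncation_bound by blast
  have RW: "(\<Sum>k<n. M (\<beta> ^ k) / 2 ^ k * R k i) \<le> C * 2" for n i
  proof -
    have "(\<Sum>k<n. M (\<beta> ^ k) / 2 ^ k * R k i)
       = (\<Sum>k<n. (\<integral>t. M (\<beta> ^ k) * min 1 ((z i t)\<^sup>2 / (\<beta> ^ k)\<^sup>2) \<partial>\<mu>))"
      unfolding R_def by (intro sum.cong) auto
    also have "\<dots> = (\<integral>t. (\<Sum>k<n. M (\<beta> ^ k) * min 1 ((z i t)\<^sup>2 / (\<beta> ^ k)\<^sup>2)) \<partial>\<mu>)"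
      using intmin by (subst Bochner_Integration.integral_sum) auto
    also have "\<dots> \<le> (\<integral>t. C * (M \<bar>z i t\<bar> + 1) \<partial>\<mu>)"
      using C(2)[of "\<bar>z i t\<bar>" n for t] intmin intz by (intro integral_mono) auto
    also have "\<dots> = C * ((\<integral>t. M \<bar>z i t\<bar> \<partial>\<mu>) + 1)"
      using intz by (subst integral_mult_right_zero, subst Bochner_Integration.integral_add) auto
    also have "\<dots> \<le> C * 2" using intz1[of i] C(1) by (intro mult_left_mono) auto
    finally show ?thesis .
  qed
  define x where "x = min d 1"
  have x: "0 < x" "x \<le> 1" "x \<le> d" using d unfolding x_def by auto
  \<comment> \<open>The threshold \<open>x\<close> costs a factor \<open>1/x\<^sup>2\<close> in the tail estimate and the choice of signs a factor 4.\<close>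
  define \<delta> where "\<delta> = x ^ 3 / 4"
  have delta: "0 < \<delta>" using x unfolding \<delta>_def by auto
  \<comment> \<open>If every \<open>R k i\<close> with \<open>i\<close> large exceeded \<open>\<delta>\<close>, then the bound on \<open>\<Sum>k. M(\<beta>^k)/2^k R k i\<close>, which is
      uniform in \<open>i\<close>, would bound the partial sums of the divergent series.\<close>
  obtain k where k: "infinite {i. R k i \<le> \<delta>}"
  proof (rule ccontr)
    assume "\<not> thesis"
    then have fin: "finite {i. R k i \<le> \<delta>}" for k using that by blast
    have ev: "\<forall>\<^sub>F i in sequentially. \<delta> < R k i" for k
      using fin[of k] unfolding cofinite_eq_sequentially[symmetric] eventually_cofinite by (simp add: not_less)
    have "(\<Sum>k<n. M (\<beta> ^ k) / 2 ^ k) \<le> C * 2 / \<delta>" for n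
    proof -
      have "\<forall>\<^sub>F i in sequentially. \<forall>k\<in>{..<n}. \<delta> < R k i"
        using ev by (intro eventually_ball_finite) auto
      then obtain i where i: "\<And>k. k < n \<Longrightarrow> \<delta> < R k i" by (auto simp: eventually_sequentially)
      have "(\<Sum>k<n. M (\<beta> ^ k) / 2 ^ k * \<delta>) \<le> (\<Sum>k<n. M (\<beta> ^ k) / 2 ^ k * R k i)"
        using i beta_gt_1 by (intro sum_mono mult_left_mono) (auto intro: less_imp_le)
      also have "\<dots> \<le> C * 2" by (rule RW)
      finally show ?thesis unfolding sum_distrib_right[symmetric] using delta by (simp add: pos_le_divide_eq)
    qed
    then have "summable (\<lambda>k. M (\<beta> ^ k) / 2 ^ k)"
      using beta_gt_1 by (intro summableI_nonneg_bounded) auto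
    with W show False by blast
  qed
  define s where "s = \<beta> ^ k"
  have s: "1 \<le> s" unfolding s_def using beta_gt_1 by simp
  define N :: real where "N = 2 ^ k"
  have N: "1 \<le> N" unfolding N_def by simp
  have sN: "(1 / s) powr p = 1 / N" unfolding s_def N_def using beta_pow_powr[of k] beta_gt_1
    by (simp add: powr_divide)
  have "1 / (2 * N) < 1 / N" "1 / N < 2" using N by (simp_all add: field_simps)
  then have "\<forall>\<^sub>F u in at_top. 1 / (2 * N) * M u \<le> M (1 / s * u) \<and> M (1 / s * u) \<le> 2 * M u"
    unfolding sN[symmetric] using s by (intro M_ratio) auto
  then obtain U0 where U0: "\<And>u. U0 \<le> u \<Longrightarrow> 1 / (2 * N) * M u \<le> M (1 / s * u)"
    unfolding eventually_at_top_linorder by blast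
  define U where "U = max 0 U0"
  have U: "0 \<le> U" "(M u - M U) / (2 * N) \<le> M (u / s)" if "0 \<le> u" for u
  proof -
    show "0 \<le> U" unfolding U_def by simp
    show "(M u - M U) / (2 * N) \<le> M (u / s)"
    proof (cases "U \<le> u")
      case True
      have "M u / (2 * N) \<le> M (u / s)" using U0[of u] True unfolding U_def by simp
      moreover have "(M u - M U) / (2 * N) \<le> M u / (2 * N)" using N M_nonneg[of U] unfolding U_def
        by (intro divide_right_mono) auto
      ultimately show ?thesis by linarith
    next
      case False
      then have "M u \<le> M U" using that by (intro M_mono) auto
      then have "(M u - M U) / (2 * N) \<le> 0" using N by (intro divide_nonpos_pos) auto
      also have "0 \<le> M (u / s)" using that s by simp
      finally show ?thesis .
    qed
  qed
  have U0': "0 \<le> U" unfolding U_def by simp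
  \<comment> \<open>At most \<open>N\<^sup>2\<close> overlaps are subtracted from \<open>c/4\<close>; this leaves at least \<open>c/8\<close>.\<close>
  define \<eta> where "\<eta> = c / (8 * N\<^sup>2)"
  have eta: "0 < \<eta>" using c(1) N unfolding \<eta>_def by auto
  have "(\<lambda>i. M U * measure \<mu> (E i)) \<longlonglongrightarrow> M U * 0" by (intro tendsto_mult_left E(2))
  then have "\<forall>\<^sub>F i in sequentially. M U * measure \<mu> (E i) < c / 2"
    using c(1) by (intro order_tendstoD) auto
  then obtain n0 where n0: "\<And>i. n0 \<le> i \<Longrightarrow> M U * measure \<mu> (E i) < c / 2"
    unfolding eventually_sequentially by blast
  have "\<forall>\<^sub>F j in sequentially. (\<integral>t. M \<bar>z i t\<bar> * indicator (E j) t \<partial>\<mu>) < \<eta>" for i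
    using integral_small_sets_tendsto_zero[OF intz[of i] _ E] eta by (intro order_tendstoD) auto
  moreover have "infinite ({i. R k i \<le> \<delta>} \<inter> {n0..})"
    using k by (metis Int_Diff_disjoint Int_Un_eq(2) Diff_infinite_finite finite_lessThan Int_commute
        Diff_eq Compl_lessThan)
  ultimately obtain I where I: "I \<subseteq> {i. R k i \<le> \<delta>} \<inter> {n0..}" "finite I" "card I = 2 ^ k"
    "\<forall>i\<in>I. \<forall>j\<in>I. i < j \<longrightarrow> (\<integral>t. M \<bar>z i t\<bar> * indicator (E j) t \<partial>\<mu>) < \<eta>"
    using finite_subset_eventually[of "{i. R k i \<le> \<delta>} \<inter> {n0..}"
        "\<lambda>i j. (\<integral>t. M \<bar>z i t\<bar> * indicator (E j) t \<partial>\<mu>) < \<eta>" "2 ^ k"] by blast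
  have I_ne: "I \<noteq> {}" using I(3) by auto
  have cardN: "real (card I) = N" using I(3) unfolding N_def by simp
  define a where "a i t = z i t / s" for i t
  have a_meas [measurable]: "a i \<in> borel_measurable \<mu>" for i
    unfolding a_def[abs_def] by measurable
  have aM: "M \<bar>a i t\<bar> \<le> M \<bar>z i t\<bar>" for i t
  proof -
    have "\<bar>a i t\<bar> \<le> \<bar>z i t\<bar> / 1" unfolding a_def abs_divide using s by (intro divide_left_mono) auto
    then show ?thesis by (intro M_mono) auto
  qed
  have inta: "integrable \<mu> (\<lambda>t. M \<bar>a i t\<bar>)" for i
    by (rule Bochner_Integration.integrable_bound[OF intz[of i]]) (use aM[of i] in auto)
  have integrable_ind: "integrable \<mu> (\<lambda>t. f t * indicator (E j) t)"
    if "integrable \<mu> f" for f :: "real \<Rightarrow> real" and j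
    by (rule Bochner_Integration.integrable_bound[OF that])
      (use borel_measurable_integrable[OF that] in \<open>auto simp: indicator_def\<close>)
  have main_i: "c / (4 * N) \<le> (\<integral>t. M \<bar>a i t\<bar> * indicator (E i) t \<partial>\<mu>)" if i: "i \<in> I" for i
  proof -
    have "c / (4 * N) = (c - c / 2) / (2 * N)" by (simp add: field_simps)
    also have "\<dots> \<le> ((\<integral>t. M \<bar>z i t\<bar> * indicator (E i) t \<partial>\<mu>) - M U * measure \<mu> (E i)) / (2 * N)"
      using c(2)[of i] n0[of i] I(1) i N by (intro divide_right_mono diff_mono) (auto intro: less_imp_le)
    also have "\<dots> = (\<integral>t. (M \<bar>z i t\<bar> * indicator (E i) t - M U * indicator (E i) t) / (2 * N) \<partial>\<mu>)"
    proof -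
      have "E i \<inter> {0..1} = E i" using sets.sets_into_space[OF E(1)[of i]] by auto
      moreover have "integrable \<mu> (\<lambda>t. M U * indicat_real (E i) t)"
        by (intro integrable_ind) simp
      ultimately show ?thesis using integrable_ind[OF intz[of i], of i]
        by (simp add: Bochner_Integration.integral_diff)
    qed
    also have "\<dots> \<le> (\<integral>t. M \<bar>a i t\<bar> * indicator (E i) t \<partial>\<mu>)"
    proof (rule integral_mono)
      fix t
      have "(M \<bar>z i t\<bar> - M U) / (2 * N) \<le> M \<bar>a i t\<bar>" using U(2)[of "\<bar>z i t\<bar>"] s unfolding a_def by (simp add: abs_divide)
      then show "(M \<bar>z i t\<bar> * indicator (E i) t - M U * indicator (E i) t) / (2 * N) \<le> M \<bar>a i t\<bar> * indicator (E i) t"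
        by (auto simp: indicator_def)
    qed (use integrable_ind[OF intz] integrable_ind[OF inta] integrable_ind[of "\<lambda>t. M U"] in auto)
    finally show ?thesis .
  qed
  have Max_bound: "c / 8 \<le> (\<integral>t. M (Max ((\<lambda>i. \<bar>a i t\<bar>) ` I)) \<partial>\<mu>)"
  proof -
    let ?V = "\<lambda>t. Max ((\<lambda>i. \<bar>a i t\<bar>) ` I)"
    have V_ge: "\<bar>a i t\<bar> \<le> ?V t" if "i \<in> I" for i t using that I(2) by (intro Max_ge) auto
    have V0: "0 \<le> ?V t" for t using I_ne V_ge[of _ t] by (meson abs_ge_zero all_not_in_conv order_trans)
    have intV: "integrable \<mu> (\<lambda>t. M (?V t))"
      by (rule integrable_M_Max[OF I(2) I_ne a_meas inta])
    have "c / 8 \<le> N * (c / (4 * N)) - N * (N * \<eta>)" using N c(1) unfolding \<eta>_def by (simp add: field_simps power2_eq_square)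
    also have "\<dots> \<le> (\<Sum>i\<in>I. c / (4 * N)) - (\<Sum>i\<in>I. (\<Sum>j\<in>{j\<in>I. i < j}. \<eta>))"
    proof -
      have "(\<Sum>j\<in>{j\<in>I. i < j}. \<eta>) \<le> N * \<eta>" for i
      proof -
        have "card {j\<in>I. i < j} \<le> card I" using I(2) by (intro card_mono) auto
        then show ?thesis using eta cardN by (simp add: mult_right_mono)
      qed
      then have "(\<Sum>i\<in>I. (\<Sum>j\<in>{j\<in>I. i < j}. \<eta>)) \<le> (\<Sum>i\<in>I. N * \<eta>)" by (rule sum_mono)
      then show ?thesis using cardN by simp
    qed
    also have "\<dots> = (\<Sum>i\<in>I. c / (4 * N) - (\<Sum>j\<in>{j\<in>I. i < j}. \<eta>))" by (simp only: sum_subtractf)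
    also have "\<dots> \<le> (\<Sum>i\<in>I. (\<integral>t. M \<bar>a i t\<bar> * indicator (E i) t \<partial>\<mu>)
         - (\<Sum>j\<in>{j\<in>I. i < j}. (\<integral>t. M \<bar>a i t\<bar> * indicator (E j) t \<partial>\<mu>)))"
    proof (intro sum_mono diff_mono main_i)
      fix i j assume ij: "i \<in> I" "j \<in> {j\<in>I. i < j}"
      have "(\<integral>t. M \<bar>a i t\<bar> * indicator (E j) t \<partial>\<mu>) \<le> (\<integral>t. M \<bar>z i t\<bar> * indicator (E j) t \<partial>\<mu>)"
        using aM[of i] by (intro integral_mono integrable_ind inta intz mult_right_mono) auto
      also have "\<dots> \<le> \<eta>" using I(4) ij by (auto intro: less_imp_le)
      finally show "(\<integral>t. M \<bar>a i t\<bar> * indicator (E j) t \<partial>\<mu>) \<le> \<eta>" .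
    qed
    also have "\<dots> = (\<integral>t. (\<Sum>i\<in>I. M \<bar>a i t\<bar> * indicator (E i) t
         - (\<Sum>j\<in>{j\<in>I. i < j}. M \<bar>a i t\<bar> * indicator (E j) t)) \<partial>\<mu>)"
      using integrable_ind[OF inta] by (simp add: Bochner_Integration.integral_diff)
    also have "\<dots> \<le> (\<integral>t. M (?V t) \<partial>\<mu>)"
      by (rule integral_mono, intro Bochner_Integration.integrable_sum Bochner_Integration.integrable_diff
            integrable_ind inta, rule intV, rule last_set_lower_bound[OF I(2) I_ne])
         (auto intro!: M_mono V_ge)
    finally show ?thesis .
  qed
  have tail: "(\<Sum>i\<in>I. \<integral>t. min 1 ((a i t)\<^sup>2 / x\<^sup>2) \<partial>\<mu>) \<le> x / 4"
  proof -
    have "(\<integral>t. min 1 ((a i t)\<^sup>2 / x\<^sup>2) \<partial>\<mu>) \<le> x / 4 / N" if i: "i \<in> I" for i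
    proof -
      have "(\<integral>t. min 1 ((a i t)\<^sup>2 / x\<^sup>2) \<partial>\<mu>) \<le> (\<integral>t. 1 / x\<^sup>2 * min 1 ((z i t)\<^sup>2 / s\<^sup>2) \<partial>\<mu>)"
      proof (rule integral_mono)
        fix t
        have "x\<^sup>2 \<le> 1" using x by (simp add: power_le_one)
        then have "1 \<le> 1 / x\<^sup>2" using x by simp
        moreover have "(a i t)\<^sup>2 / x\<^sup>2 = 1 / x\<^sup>2 * ((z i t)\<^sup>2 / s\<^sup>2)" unfolding a_def by (simp add: power_divide)
        moreover have "min 1 (r * b) \<le> r * min 1 b" if "1 \<le> r" for r b :: real
          using that mult_mono[of 1 r 1 b] by (auto simp: min_def)
        ultimately show "min 1 ((a i t)\<^sup>2 / x\<^sup>2) \<le> 1 / x\<^sup>2 * min 1 ((z i t)\<^sup>2 / s\<^sup>2)"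
          by presburger
      next
        show "integrable \<mu> (\<lambda>t. min 1 ((a i t)\<^sup>2 / x\<^sup>2))"
          by (rule unit_interval.integrable_const_bound[of _ 1]) auto
      qed (use intmin in auto)
      also have "\<dots> = 1 / x\<^sup>2 * (R k i / N)" unfolding R_def N_def s_def by simp
      also have "\<dots> \<le> 1 / x\<^sup>2 * (\<delta> / N)" using I(1) i N by (intro mult_left_mono divide_right_mono) auto
      also have "\<dots> = x / 4 / N" unfolding \<delta>_def using x by (simp add: power2_eq_square power3_eq_cube)
      finally show ?thesis .
    qed
    then have "(\<Sum>i\<in>I. \<integral>t. min 1 ((a i t)\<^sup>2 / x\<^sup>2) \<partial>\<mu>) \<le> (\<Sum>i\<in>I. x / 4 / N)" by (rule sum_mono)
    also have "\<dots> = x / 4" using cardN N by simp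
    finally show ?thesis .
  qed
  obtain \<epsilon> where e: "ennreal (c / 8 / 4) \<le> orlicz_modular M (\<lambda>t. \<Sum>i\<in>I. \<epsilon> i * a i t)"
    "measure \<mu> {t \<in> {0..1}. x < \<bar>\<Sum>i\<in>I. \<epsilon> i * a i t\<bar>} \<le> 4 * (x / 4)"
    using random_signs[OF I(2) I_ne a_meas inta x(1) _ tail _ Max_bound] x c(1) by auto
  have eq: "(\<Sum>i\<in>I. \<epsilon> i * a i t) = (\<Sum>i\<in>I. (\<epsilon> i / s) * z i t)" for t unfolding a_def by simp
  show ?thesis
  proof (rule that[OF I(2)])
    show "ennreal (c / 32) \<le> orlicz_modular M (\<lambda>t. \<Sum>i\<in>I. (\<epsilon> i / s) * z i t)" using e(1) unfolding eq by simp
    let ?y = "\<lambda>t. \<Sum>i\<in>I. (\<epsilon> i / s) * z i t"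
    have "{t \<in> space unit_interval. x < \<bar>?y t\<bar>} \<in> sets \<mu>" by measurable
    then have "measure \<mu> {t \<in> {0..1}. d < \<bar>?y t\<bar>} \<le> measure \<mu> {t \<in> {0..1}. x < \<bar>?y t\<bar>}"
      using x by (intro unit_interval.finite_measure_mono) auto
    then show "measure \<mu> {t \<in> {0..1}. d < \<bar>?y t\<bar>} \<le> d" using e(2) x unfolding eq by simp
  qed
qed

text \<open>If the ball were bad, the combinations constructed above would tend to 0 in measure, hence in norm,
  while their modulars stay bounded away from 0.\<close>
lemma strongly_embedded_imp_equi_absolutely_continuous:
  assumes W: "\<not> summable (\<lambda>k. M (\<beta> ^ k) / 2 ^ k)" and H: "strongly_embedded M H"
  shows "equi_absolutely_continuous_norms M (orlicz_unit_ball M H)"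
proof (rule ccontr)
  assume "\<not> ?thesis"
  then obtain b where b: "0 < b" and bad: "\<And>\<delta>. 0 < \<delta> \<Longrightarrow> \<exists>E\<in>sets unit_interval. measure \<mu> E < \<delta> \<and>
      (\<exists>x\<in>orlicz_unit_ball M H. b < orlicz_norm M (\<lambda>t. x t * indicator E t))"
    unfolding equi_absolutely_continuous_norms_iff by (auto simp: not_le)
  have sub: "H \<subseteq> orlicz_space M" and zero: "(\<lambda>t. 0) \<in> H"
    and add: "\<And>f g. f \<in> H \<Longrightarrow> g \<in> H \<Longrightarrow> (\<lambda>t. f t + g t) \<in> H"
    and scale: "\<And>c f. f \<in> H \<Longrightarrow> (\<lambda>t. c * f t) \<in> H"
    using H unfolding strongly_embedded_def closed_subspace_def by auto
  obtain K where K: "1 \<le> K" "\<And>u. 0 \<le> u \<Longrightarrow> M (2 / b * u) \<le> K * (M u + 1)"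
  proof -
    have "0 \<le> 2 / b" using b by simp
    then show ?thesis using dilation_bound that by blast
  qed
  have "\<forall>n. \<exists>E z. E \<in> sets \<mu> \<and> measure \<mu> E < 1 / (2 * K * (real n + 1)) \<and> z \<in> H \<and>
      orlicz_modular M z \<le> 1 \<and> 1 / (2 * K) \<le> (\<integral>t. M \<bar>z t\<bar> * indicator E t \<partial>\<mu>)"
  proof
    fix n :: nat
    have "0 < 1 / (2 * K * (real n + 1))" using K(1) by simp
    then obtain E x where E: "E \<in> sets \<mu>" "measure \<mu> E < 1 / (2 * K * (real n + 1))"
      and x: "x \<in> orlicz_unit_ball M H" "b < orlicz_norm M (\<lambda>t. x t * indicator E t)"
      using bad by blast
    have xH: "x \<in> H" "orlicz_norm M x \<le> 1" using x(1) unfolding orlicz_unit_ball_def by auto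
    \<comment> \<open>The halved element has norm below 1, hence modular at most 1.\<close>
    define z where "z t = 1 / 2 * x t" for t
    have zH: "z \<in> H" unfolding z_def[abs_def] by (rule scale[OF xH(1)])
    then have z_meas [measurable]: "z \<in> borel_measurable \<mu>" using sub orlicz_space_measurable by blast
    note [measurable] = E(1)
    have mz: "orlicz_modular M z \<le> 1"
      using modular_le_1[of x 2] xH sub unfolding z_def[abs_def] by auto
    have intz: "integrable \<mu> (\<lambda>t. M \<bar>z t\<bar>)"
      by (rule integrable_of_modular_le_1[OF z_meas mz])
    have intzE: "integrable \<mu> (\<lambda>t. M \<bar>z t\<bar> * indicator E t)"
      by (rule Bochner_Integration.integrable_bound[OF intz]) (auto simp: indicator_def)
    have intE: "integrable \<mu> (indicat_real E)"
      using E by (intro integrable_real_indicator) (auto simp: unit_interval.emeasure_eq_measure)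
    have "1 < orlicz_modular M (\<lambda>t. x t * indicator E t / b)"
      using norm_le[OF b, of "\<lambda>t. x t * indicator E t"] x(2) by (meson linorder_not_le)
    also have "\<dots> \<le> (\<integral>\<^sup>+ t. ennreal (K * (M \<bar>z t\<bar> * indicator E t + indicator E t)) \<partial>\<mu>)"
      unfolding orlicz_modular_def
    proof (intro nn_integral_mono ennreal_leI)
      fix t
      show "M \<bar>x t * indicator E t / b\<bar> \<le> K * (M \<bar>z t\<bar> * indicator E t + indicator E t)"
        using K(2)[of "\<bar>z t\<bar>"] b by (cases "t \<in> E") (simp_all add: z_def abs_mult abs_divide)
    qed
    also have "\<dots> = ennreal (\<integral>t. K * (M \<bar>z t\<bar> * indicator E t + indicator E t) \<partial>\<mu>)"
      using intzE intE K(1) by (intro nn_integral_eq_integral) auto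
    also have "(\<integral>t. K * (M \<bar>z t\<bar> * indicator E t + indicator E t) \<partial>\<mu>)
        = K * ((\<integral>t. M \<bar>z t\<bar> * indicator E t \<partial>\<mu>) + measure \<mu> E)"
      using intzE intE sets.sets_into_space[OF E(1)]
      by (subst integral_mult_right_zero, subst Bochner_Integration.integral_add) (auto simp: Int_absorb2)
    finally have "1 < K * ((\<integral>t. M \<bar>z t\<bar> * indicator E t \<partial>\<mu>) + measure \<mu> E)"
      by (metis ennreal_1 ennreal_less_iff zero_le_one)
    moreover have "K * measure \<mu> E \<le> 1 / 2"
    proof -
      have "1 / (2 * K * (real n + 1)) \<le> 1 / (2 * K * 1)" using K(1) by (intro divide_left_mono mult_left_mono) auto
      then have "K * measure \<mu> E \<le> K * (1 / (2 * K * 1))" using E(2) K(1) by (intro mult_left_mono) auto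
      then show ?thesis using K(1) by simp
    qed
    ultimately have "1 / 2 \<le> K * (\<integral>t. M \<bar>z t\<bar> * indicator E t \<partial>\<mu>)" by (simp add: distrib_left)
    then have "1 / (2 * K) \<le> (\<integral>t. M \<bar>z t\<bar> * indicator E t \<partial>\<mu>)" using K(1) by (simp add: field_simps)
    then show "\<exists>E z. E \<in> sets \<mu> \<and> measure \<mu> E < 1 / (2 * K * (real n + 1)) \<and> z \<in> H \<and>
      orlicz_modular M z \<le> 1 \<and> 1 / (2 * K) \<le> (\<integral>t. M \<bar>z t\<bar> * indicator E t \<partial>\<mu>)"
      using E zH mz by blast
  qed
  then obtain E z where Ez: "\<And>n. E n \<in> sets \<mu> \<and> measure \<mu> (E n) < 1 / (2 * K * (real n + 1)) \<and> z n \<in> H \<and>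
      orlicz_modular M (z n) \<le> 1 \<and> 1 / (2 * K) \<le> (\<integral>t. M \<bar>z n t\<bar> * indicator (E n) t \<partial>\<mu>)"
    unfolding choice_iff by blast
  have E: "E n \<in> sets \<mu>" "measure \<mu> (E n) < 1 / (2 * K * (real n + 1))"
    and z: "z n \<in> H" "orlicz_modular M (z n) \<le> 1"
      "1 / (2 * K) \<le> (\<integral>t. M \<bar>z n t\<bar> * indicator (E n) t \<partial>\<mu>)" for n
    using Ez[of n] by blast+
  have E0: "(\<lambda>n. measure \<mu> (E n)) \<longlonglongrightarrow> 0"
  proof (rule tendsto_sandwich[OF _ _ tendsto_const LIMSEQ_inverse_real_of_nat])
    show "\<forall>\<^sub>F n in sequentially. measure \<mu> (E n) \<le> inverse (real (Suc n))"
    proof (rule always_eventually, rule allI)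
      fix n
      have "1 / (2 * K * (real n + 1)) \<le> 1 / (1 * (real n + 1))"
        using K(1) by (intro divide_left_mono mult_right_mono) auto
      then show "measure \<mu> (E n) \<le> inverse (real (Suc n))" using E(2)[of n] by (simp add: inverse_eq_divide add.commute)
    qed
  qed auto
  define c where "c = 1 / (2 * K)"
  have c: "0 < c" using K(1) unfolding c_def by simp
  have "\<forall>n. \<exists>y. y \<in> H \<and> ennreal (c / 32) \<le> orlicz_modular M y \<and>
      measure \<mu> {t \<in> {0..1}. 1 / (real n + 1) < \<bar>y t\<bar>} \<le> 1 / (real n + 1)"
  proof
    fix n :: nat
    have z_meas: "z i \<in> borel_measurable \<mu>" for i
      using z(1) sub orlicz_space_measurable by blast
    have "0 < 1 / (real n + 1)" by simp
    from combination_small_in_measure[OF z_meas z(2) E(1) E0 c z(3)[folded c_def] W this]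
    obtain I w where I: "finite I" "ennreal (c / 32) \<le> orlicz_modular M (\<lambda>t. \<Sum>i\<in>I. w i * z i t)"
      "measure \<mu> {t \<in> {0..1}. 1 / (real n + 1) < \<bar>\<Sum>i\<in>I. w i * z i t\<bar>} \<le> 1 / (real n + 1)"
      by blast
    have "(\<lambda>t. \<Sum>i\<in>I. w i * z i t) \<in> H" using I(1)
      by (induction I rule: finite_induct) (use zero in \<open>auto intro!: add[OF scale[OF z(1)]]\<close>)
    then show "\<exists>y. y \<in> H \<and> ennreal (c / 32) \<le> orlicz_modular M y \<and>
      measure \<mu> {t \<in> {0..1}. 1 / (real n + 1) < \<bar>y t\<bar>} \<le> 1 / (real n + 1)" using I by blast
  qed
  then obtain y where "\<And>n. y n \<in> H \<and> ennreal (c / 32) \<le> orlicz_modular M (y n) \<and>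
      measure \<mu> {t \<in> {0..1}. 1 / (real n + 1) < \<bar>y n t\<bar>} \<le> 1 / (real n + 1)"
    unfolding choice_iff by blast
  then have y: "y n \<in> H" "ennreal (c / 32) \<le> orlicz_modular M (y n)"
    "measure \<mu> {t \<in> {0..1}. 1 / (real n + 1) < \<bar>y n t\<bar>} \<le> 1 / (real n + 1)" for n
    by blast+
  have inv0: "(\<lambda>n. 1 / (real n + 1)) \<longlonglongrightarrow> 0"
    using LIMSEQ_inverse_real_of_nat by (simp add: inverse_eq_divide add.commute)
  have "converges_in_measure y (\<lambda>t. 0)"
    unfolding converges_in_measure_def
  proof (intro allI impI)
    fix e :: real assume e: "0 < e"
    have "\<forall>\<^sub>F n in sequentially. 1 / (real n + 1) < e" using inv0 e by (intro order_tendstoD) auto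
    then have "\<forall>\<^sub>F n in sequentially. measure \<mu> {t \<in> {0..1}. e < \<bar>y n t - 0\<bar>} \<le> 1 / (real n + 1)"
    proof eventually_elim
      case (elim n)
      have [measurable]: "y n \<in> borel_measurable \<mu>" using y(1) sub orlicz_space_measurable by blast
      have "{t \<in> space unit_interval. 1 / (real n + 1) < \<bar>y n t\<bar>} \<in> sets \<mu>" by measurable
      then have "measure \<mu> {t \<in> {0..1}. e < \<bar>y n t - 0\<bar>}
          \<le> measure \<mu> {t \<in> {0..1}. 1 / (real n + 1) < \<bar>y n t\<bar>}"
        using elim by (intro unit_interval.finite_measure_mono) auto
      then show ?case using y(3)[of n] by linarith
    qed
    then show "(\<lambda>n. measure \<mu> {t \<in> {0..1}. e < \<bar>y n t - 0\<bar>}) \<longlonglongrightarrow> 0"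
      by (intro tendsto_sandwich[OF _ _ tendsto_const inv0]) auto
  qed
  then have "norm_converges M y (\<lambda>t. 0)"
    using H y(1) zero unfolding strongly_embedded_def by blast
  then have "(\<lambda>n. orlicz_norm M (y n)) \<longlonglongrightarrow> 0" unfolding norm_converges_def by simp
  then have "\<forall>\<^sub>F n in sequentially. orlicz_norm M (y n) < min 1 (c / 64)"
    using c by (intro order_tendstoD) auto
  then obtain n where n: "orlicz_norm M (y n) < min 1 (c / 64)"
    unfolding eventually_sequentially by blast
  define r where "r = min 1 (c / 64)"
  have r: "0 < r" "r \<le> 1" "r \<le> c / 64" unfolding r_def using c by auto
  have yn: "y n \<in> orlicz_space M" using y(1) sub by blast
  have "orlicz_modular M (\<lambda>t. r * (y n t / r)) \<le> ennreal r * orlicz_modular M (\<lambda>t. y n t / r)"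
    using orlicz_space_measurable[OF yn] r by (intro modular_contract) auto
  also have "\<dots> \<le> ennreal r * 1" using modular_le_1[OF yn] n unfolding r_def by (intro mult_left_mono) auto
  finally have "orlicz_modular M (y n) \<le> ennreal r" using r by simp
  then have "ennreal (c / 32) \<le> ennreal r" using y(2)[of n] by (rule order_trans[rotated])
  then show False using r c by simp
qed

end


section \<open>Binary digits as independent coin tosses\<close>

definition digit :: "nat \<Rightarrow> real \<Rightarrow> bool" where
  "digit m t \<longleftrightarrow> odd \<lfloor>2 ^ Suc m * t\<rfloor>"

text \<open>Reverses the digit with index \<open>m\<close> and keeps all others. It is defined on the whole line, where it
  is a piecewise translation, so that its invariance under Lebesgue measure follows from translation
  invariance alone.\<close>
definition flip :: "nat \<Rightarrow> real \<Rightarrow> real" where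
  "flip m t = (if digit m t then t - 1 / 2 ^ Suc m else t + 1 / 2 ^ Suc m)"

lemma digit_measurable [measurable]: "Measurable.pred borel (digit m)"
  unfolding digit_def[abs_def] by measurable

lemma flip_measurable [measurable]: "flip m \<in> borel_measurable borel"
  unfolding flip_def[abs_def] by measurable

lemma floor_scaled_flip:
  "\<lfloor>2 ^ Suc m * flip m t\<rfloor> = (if digit m t then \<lfloor>2 ^ Suc m * t\<rfloor> - 1 else \<lfloor>2 ^ Suc m * t\<rfloor> + 1)"
proof -
  have "2 ^ Suc m * flip m t = (if digit m t then 2 ^ Suc m * t - 1 else 2 ^ Suc m * t + 1)"
    unfolding flip_def by (simp add: distrib_left right_diff_distrib del: power_Suc)
  then show ?thesis by simp
qed

lemma floor_flip:
  assumes "j \<le> m"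
  shows "\<lfloor>2 ^ j * flip m t\<rfloor> = \<lfloor>2 ^ j * t\<rfloor>"
proof -
  define k where "k = m - j"
  have m: "Suc m = j + Suc k" using assms unfolding k_def by simp
  have fl: "\<lfloor>2 ^ j * u\<rfloor> = \<lfloor>2 ^ Suc m * u\<rfloor> div 2 div 2 ^ k" for u :: real
  proof -
    have "2 ^ j * u = 2 ^ Suc m * u / real_of_int (2 ^ Suc k)" unfolding m by (simp add: power_add)
    then have "\<lfloor>2 ^ j * u\<rfloor> = \<lfloor>2 ^ Suc m * u\<rfloor> div 2 ^ Suc k"
      using floor_divide_real_eq_div[of "2 ^ Suc k" "2 ^ Suc m * u"] by (simp del: power_Suc)
    then show ?thesis by (simp add: zdiv_zmult2_eq)
  qed
  have "\<lfloor>2 ^ Suc m * flip m t\<rfloor> div 2 = \<lfloor>2 ^ Suc m * t\<rfloor> div 2"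
    unfolding floor_scaled_flip digit_def by (cases "odd \<lfloor>2 ^ Suc m * t\<rfloor>") (auto elim!: oddE evenE simp del: power_Suc)
  then show ?thesis unfolding fl by simp
qed

lemma digit_flip: "digit j (flip m t) = (if j = m then \<not> digit m t else digit j t)"
proof -
  consider "j < m" | "j = m" | "m < j" by linarith
  then show ?thesis
  proof cases
    case 1
    then show ?thesis unfolding digit_def using floor_flip[of "Suc j" m t] by (simp del: power_Suc)
  next
    case 2
    then show ?thesis using floor_scaled_flip[of m t] unfolding digit_def by (simp del: power_Suc)
  next
    case 3
    define k where "k = j - Suc m"
    have j: "Suc j = Suc m + Suc k" using 3 unfolding k_def by simp
    have "2 ^ Suc j * flip m t = 2 ^ Suc j * t + real_of_int (if digit m t then - (2 ^ Suc k) else 2 ^ Suc k)"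
      unfolding flip_def j power_add by (simp add: distrib_left right_diff_distrib del: power_Suc)
    then have "\<lfloor>2 ^ Suc j * flip m t\<rfloor> = \<lfloor>2 ^ Suc j * t\<rfloor> + (if digit m t then - (2 ^ Suc k) else 2 ^ Suc k)"
      by (simp only: floor_add_int)
    then have "digit j (flip m t) = digit j t" unfolding digit_def[of j] by simp
    then show ?thesis using 3 by simp
  qed
qed

lemma flip_mem: "flip m t \<in> {0..<1} \<longleftrightarrow> t \<in> {0..<1}"
proof -
  have "u \<in> {0..<1} \<longleftrightarrow> \<lfloor>2 ^ 0 * u\<rfloor> = 0" for u :: real
    by (auto simp: floor_eq_iff)
  then show ?thesis using floor_flip[of 0 m t] by simp
qed

lemma nn_integral_unit_interval_borel:
  assumes [measurable]: "F \<in> borel_measurable borel"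
  shows "(\<integral>\<^sup>+ t. F t \<partial>\<mu>) = (\<integral>\<^sup>+ t. F t * indicator {0..<1} t \<partial>lborel)"
proof -
  have "(\<integral>\<^sup>+ t. F t \<partial>\<mu>) = (\<integral>\<^sup>+ t. F t * indicator {0..1} t \<partial>lebesgue)"
    by (rule nn_integral_restrict_space) simp
  also have "\<dots> = (\<integral>\<^sup>+ t. F t * indicator {0..1} t \<partial>lborel)"
    by (rule nn_integral_completion)
  also have "\<dots> = (\<integral>\<^sup>+ t. F t * indicator {0..<1} t \<partial>lborel)"
  proof (rule nn_integral_cong_AE)
    have "AE t in lborel. t \<noteq> (1::real)" by (rule AE_lborel_singleton)
    then show "AE t in lborel. F t * indicator {0..1} t = F t * indicator {0..<1} t"
      by eventually_elim (auto simp: indicator_def)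
  qed
  finally show ?thesis .
qed

text \<open>Where the digit is 1 the map is a translation to the left, where it is 0 a translation to the right
  by the same amount, and these translations exchange the two sets.\<close>
lemma nn_integral_flip:
  assumes [measurable]: "F \<in> borel_measurable borel"
  shows "(\<integral>\<^sup>+ t. F (flip m t) \<partial>\<mu>) = (\<integral>\<^sup>+ t. F t \<partial>\<mu>)"
proof -
  define G where "G t = F t * indicator {0..<1} t" for t
  have [measurable]: "G \<in> borel_measurable borel" unfolding G_def[abs_def] by measurable
  define h :: real where "h = 1 / 2 ^ Suc m"
  have dig: "digit m (h + t) \<longleftrightarrow> \<not> digit m t" "digit m (- h + t) \<longleftrightarrow> \<not> digit m t" for t
  proof -
    have "2 ^ Suc m * (h + t) = 2 ^ Suc m * t + of_int 1" "2 ^ Suc m * (- h + t) = 2 ^ Suc m * t + of_int (- 1)"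
      unfolding h_def by (simp_all add: distrib_left right_diff_distrib del: power_Suc)
    then show "digit m (h + t) \<longleftrightarrow> \<not> digit m t" "digit m (- h + t) \<longleftrightarrow> \<not> digit m t"
      unfolding digit_def by (simp_all only: floor_add_int) simp_all
  qed
  have "(\<integral>\<^sup>+ t. F (flip m t) \<partial>\<mu>) = (\<integral>\<^sup>+ t. F (flip m t) * indicator {0..<1} t \<partial>lborel)"
    by (rule nn_integral_unit_interval_borel) measurable
  also have "\<dots> = (\<integral>\<^sup>+ t. G (flip m t) \<partial>lborel)"
    unfolding G_def using flip_mem by (intro nn_integral_cong) (simp add: indicator_def)
  also have "\<dots> = (\<integral>\<^sup>+ t. G (t - h) * indicator {t. digit m t} t + G (t + h) * indicator {t. \<not> digit m t} t \<partial>lborel)"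
    by (intro nn_integral_cong) (auto simp: flip_def h_def)
  also have "\<dots> = (\<integral>\<^sup>+ t. G (t - h) * indicator {t. digit m t} t \<partial>lborel)
      + (\<integral>\<^sup>+ t. G (t + h) * indicator {t. \<not> digit m t} t \<partial>lborel)"
    by (rule nn_integral_add) measurable
  also have "(\<integral>\<^sup>+ t. G (t - h) * indicator {t. digit m t} t \<partial>lborel)
      = (\<integral>\<^sup>+ t. G t * indicator {t. \<not> digit m t} t \<partial>lborel)"
    using dig by (subst nn_integral_real_affine[where c = 1 and t = h]) (auto simp: indicator_def intro!: nn_integral_cong)
  also have "(\<integral>\<^sup>+ t. G (t + h) * indicator {t. \<not> digit m t} t \<partial>lborel)
      = (\<integral>\<^sup>+ t. G t * indicator {t. digit m t} t \<partial>lborel)"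
    using dig by (subst nn_integral_real_affine[where c = 1 and t = "- h"]) (auto simp: indicator_def intro!: nn_integral_cong)
  also have "(\<integral>\<^sup>+ t. G t * indicator {t. \<not> digit m t} t \<partial>lborel) + (\<integral>\<^sup>+ t. G t * indicator {t. digit m t} t \<partial>lborel)
     = (\<integral>\<^sup>+ t. G t * indicator {t. \<not> digit m t} t + G t * indicator {t. digit m t} t \<partial>lborel)"
    by (rule nn_integral_add[symmetric]) measurable
  also have "\<dots> = (\<integral>\<^sup>+ t. G t \<partial>lborel)" by (intro nn_integral_cong) (simp add: indicator_def)
  also have "\<dots> = (\<integral>\<^sup>+ t. F t \<partial>\<mu>)"
    unfolding G_def by (rule nn_integral_unit_interval_borel[symmetric]) measurable
  finally show ?thesis .
qed

lemma distr_flip: "distr \<mu> borel (flip m) = distr \<mu> borel (\<lambda>t. t)"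
proof (rule measure_eqI)
  fix A assume "A \<in> sets (distr \<mu> borel (flip m))"
  then have A [measurable]: "A \<in> sets borel" by simp
  have "emeasure (distr \<mu> borel (flip m)) A = (\<integral>\<^sup>+ t. indicator A t \<partial>distr \<mu> borel (flip m))"
    by simp
  also have "\<dots> = (\<integral>\<^sup>+ t. indicator A (flip m t) \<partial>\<mu>)"
    by (rule nn_integral_distr) measurable
  also have "\<dots> = (\<integral>\<^sup>+ t. indicator A t \<partial>\<mu>)"
    by (rule nn_integral_flip) measurable
  also have "\<dots> = (\<integral>\<^sup>+ t. indicator A t \<partial>distr \<mu> borel (\<lambda>t. t))"
    by (rule nn_integral_distr[symmetric]) measurable
  also have "\<dots> = emeasure (distr \<mu> borel (\<lambda>t. t)) A" by simp
  finally show "emeasure (distr \<mu> borel (flip m)) A = emeasure (distr \<mu> borel (\<lambda>t. t)) A" .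
qed simp

lemma integral_flip:
  fixes F :: "real \<Rightarrow> real"
  assumes [measurable]: "F \<in> borel_measurable borel"
  shows "(\<integral>t. F (flip m t) \<partial>\<mu>) = (\<integral>t. F t \<partial>\<mu>)"
proof -
  have "(\<integral>t. F (flip m t) \<partial>\<mu>) = (\<integral>t. F t \<partial>distr \<mu> borel (flip m))"
    by (rule integral_distr[symmetric]) measurable
  also have "\<dots> = (\<integral>t. F t \<partial>\<mu>)"
    unfolding distr_flip by (rule integral_distr) measurable
  finally show ?thesis .
qed

lemma of_bool_measurable [measurable (raw)]:
  "Measurable.pred N Q \<Longrightarrow> (\<lambda>t. of_bool (Q t) :: real) \<in> borel_measurable N"
  unfolding of_bool_def by measurable

lemma integrable_unit_interval_bounded:
  fixes F :: "real \<Rightarrow> real"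
  assumes "F \<in> borel_measurable borel" "\<And>t. \<bar>F t\<bar> \<le> B"
  shows "integrable \<mu> F"
  using assms by (intro unit_interval.integrable_const_bound[of _ B]) auto

lemma integrable_of_bool:
  "Measurable.pred borel Q \<Longrightarrow> integrable \<mu> (\<lambda>t. of_bool (Q t) :: real)"
  by (rule integrable_unit_interval_bounded[of _ 1]) auto

lemma integral_of_bool:
  assumes "Measurable.pred borel Q"
  shows "(\<integral>t. of_bool (Q t) \<partial>\<mu>) = measure \<mu> {t \<in> {0..1}. Q t}"
proof -
  have "(\<integral>t. of_bool (Q t) \<partial>\<mu>) = (\<integral>t. indicat_real {t \<in> {0..1}. Q t} t \<partial>\<mu>)"
    by (intro Bochner_Integration.integral_cong) (auto simp: indicator_def)
  also have "\<dots> = measure \<mu> ({t \<in> {0..1}. Q t} \<inter> space \<mu>)"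
    by (rule Bochner_Integration.integral_indicator)
  also have "{t \<in> {0..1}. Q t} \<inter> space \<mu> = {t \<in> {0..1}. Q t}" by auto
  finally show ?thesis .
qed

text \<open>Induction on the set of digits: flipping one more digit preserves the measure and the event
  prescribing the others, so both values of that digit are equally likely.\<close>
lemma digit_pattern_probability:
  assumes "finite D"
  shows "(\<integral>t. of_bool (\<forall>m\<in>D. digit m t = v m) \<partial>\<mu>) = (1 / 2 :: real) ^ card D"
  using assms
proof (induction D)
  case empty
  then show ?case by simp
next
  case (insert m D)
  note [measurable] = pred_intros_finite(1)[OF insert(1)]
  let ?P = "\<lambda>t. \<forall>j\<in>D. digit j t = v j"
  have P [measurable]: "Measurable.pred borel ?P" by measurable
  have inv: "?P (flip m t) \<longleftrightarrow> ?P t" for t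
    using insert(2) by (intro ball_cong refl) (auto simp: digit_flip)
  have "(\<integral>t. of_bool (digit m t = v m \<and> ?P t) \<partial>\<mu>)
      = (\<integral>t. of_bool (digit m (flip m t) = v m \<and> ?P (flip m t)) \<partial>\<mu> :: real)"
    by (rule integral_flip[symmetric, where F = "\<lambda>t. of_bool (digit m t = v m \<and> ?P t)"]) measurable
  also have "\<dots> = (\<integral>t. of_bool (digit m t \<noteq> v m \<and> ?P t) \<partial>\<mu>)"
    unfolding inv by (intro Bochner_Integration.integral_cong) (auto simp: digit_flip)
  finally have eq: "(\<integral>t. of_bool (digit m t = v m \<and> ?P t) \<partial>\<mu>)
      = (\<integral>t. of_bool (digit m t \<noteq> v m \<and> ?P t) \<partial>\<mu> :: real)" .
  have "(1 / 2 :: real) ^ card D = (\<integral>t. of_bool (?P t) \<partial>\<mu>)" using insert by simp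
  also have "\<dots> = (\<integral>t. of_bool (digit m t = v m \<and> ?P t) + of_bool (digit m t \<noteq> v m \<and> ?P t) \<partial>\<mu>)"
    by (intro Bochner_Integration.integral_cong) auto
  also have "\<dots> = (\<integral>t. of_bool (digit m t = v m \<and> ?P t) \<partial>\<mu>)
      + (\<integral>t. of_bool (digit m t \<noteq> v m \<and> ?P t) \<partial>\<mu>)"
    by (intro Bochner_Integration.integral_add integrable_of_bool) measurable
  finally show ?case using insert(1,2) eq by simp
qed

text \<open>The digits are arranged in an infinite matrix by the pairing function: row \<open>i\<close> supplies a sign, its
  entry 0, and a waiting time, the number of zeros among the following entries before the first one.\<close>
definition rad :: "nat \<Rightarrow> real \<Rightarrow> real" where
  "rad i t = (if digit (prod_encode (i, 0)) t then - 1 else 1)"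

definition run :: "nat \<Rightarrow> nat \<Rightarrow> real \<Rightarrow> bool" where
  "run i k t \<longleftrightarrow> (\<forall>j<k. \<not> digit (prod_encode (i, Suc j)) t) \<and> digit (prod_encode (i, Suc k)) t"

abbreviation sign_flip :: "nat \<Rightarrow> real \<Rightarrow> real" where
  "sign_flip i \<equiv> flip (prod_encode (i, 0))"

lemma rad_measurable [measurable]: "rad i \<in> borel_measurable borel"
  unfolding rad_def[abs_def] by measurable

lemma run_measurable [measurable]: "Measurable.pred borel (run i k)"
  unfolding run_def[abs_def] by measurable

lemma rad_square: "rad i t * rad i t = 1" and abs_rad [simp]: "\<bar>rad i t\<bar> = 1"
  unfolding rad_def by auto

lemma rad_sign_flip: "rad i (sign_flip l t) = (if i = l then - rad i t else rad i t)"
  unfolding rad_def by (auto simp: digit_flip)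

lemma run_sign_flip [simp]: "run i k (sign_flip l t) = run i k t"
  unfolding run_def by (simp add: digit_flip)

lemma run_unique: "run i k t \<Longrightarrow> run i l t \<Longrightarrow> k = l"
  unfolding run_def by (metis linorder_neqE_nat)

lemma prefix_probability:
  "(\<integral>t. of_bool (\<forall>j<k. \<not> digit (prod_encode (i, Suc j)) t) \<partial>\<mu>) = (1 / 2 :: real) ^ k"
proof -
  let ?D = "(\<lambda>j. prod_encode (i, Suc j)) ` {..<k}"
  have "card ?D = k" by (subst card_image) (auto simp: inj_on_def)
  moreover have "(\<forall>j<k. \<not> digit (prod_encode (i, Suc j)) t) \<longleftrightarrow> (\<forall>m\<in>?D. digit m t = False)" for t
    by auto
  ultimately show ?thesis using digit_pattern_probability[of ?D "\<lambda>_. False"] by simp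
qed

lemma run_iff_pattern:
  "run i k t \<longleftrightarrow> (\<forall>m\<in>(\<lambda>j. prod_encode (i, Suc j)) ` {..k}. digit m t = (m = prod_encode (i, Suc k)))"
  unfolding run_def by (auto simp: le_less)

lemma run_probability: "(\<integral>t. of_bool (run i k t) \<partial>\<mu>) = (1 / 2 :: real) ^ Suc k"
proof -
  have "card ((\<lambda>j. prod_encode (i, Suc j)) ` {..k}) = Suc k"
    by (subst card_image) (auto simp: inj_on_def)
  then show ?thesis unfolding run_iff_pattern by (subst digit_pattern_probability) auto
qed

lemma run_pair_probability:
  assumes "i \<noteq> j"
  shows "(\<integral>t. of_bool (run i k t \<and> run j l t) \<partial>\<mu>) = (1 / 2 :: real) ^ Suc k * (1 / 2) ^ Suc l"
proof -
  let ?D = "\<lambda>i k. (\<lambda>j. prod_encode (i, Suc j)) ` {..k}"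
  have card: "card (?D i k) = Suc k" for i k
    by (subst card_image) (auto simp: inj_on_def)
  have "?D i k \<inter> ?D j l = {}" using assms by auto
  then have "card (?D i k \<union> ?D j l) = Suc k + Suc l" by (subst card_Un_disjoint) (auto simp: card)
  moreover have "run i k t \<and> run j l t \<longleftrightarrow> (\<forall>m\<in>?D i k \<union> ?D j l.
      digit m t = (m = prod_encode (i, Suc k) \<or> m = prod_encode (j, Suc l)))" for t
    unfolding run_iff_pattern ball_Un using assms by (intro conj_cong ball_cong refl) auto
  ultimately show ?thesis by (simp only: digit_pattern_probability finite_UnI finite_imageI finite_atMost power_add)
qed

section \<open>Sums with random signs read off the digits\<close>

text \<open>Truncate the coefficients at \<open>s\<close>. Invariance of \<open>h\<close> under the sign flips makes the truncated
  summands orthogonal, so the inequality of Chebyshev applies to their sum, and the event that some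
  truncation takes effect has probability at most the remaining part of the minima.\<close>
lemma rademacher_tail:
  fixes h :: "nat \<Rightarrow> real \<Rightarrow> real"
  assumes I: "finite I" and meas [measurable]: "\<And>i. h i \<in> borel_measurable borel"
    and inv: "\<And>i l t. h i (sign_flip l t) = h i t" and s: "0 < s"
  shows "(\<integral>t. of_bool (s \<le> \<bar>\<Sum>i\<in>I. rad i t * h i t\<bar>) \<partial>\<mu>)
    \<le> (\<Sum>i\<in>I. \<integral>t. min 1 ((h i t)\<^sup>2 / s\<^sup>2) \<partial>\<mu>)"
proof -
  define u where "u i t = (if \<bar>h i t\<bar> < s then h i t else 0)" for i t
  have [measurable]: "u i \<in> borel_measurable borel" for i unfolding u_def[abs_def] by measurable
  have u_inv: "u i (sign_flip l t) = u i t" for i l t unfolding u_def inv ..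
  have u_le: "\<bar>u i t\<bar> \<le> s" for i t unfolding u_def using s by auto
  have prod_le: "\<bar>rad i t * u i t * (rad j t * u j t)\<bar> \<le> s * s" for i j t
    using u_le[of i t] u_le[of j t] s by (simp add: abs_mult mult_mono)
  have int: "integrable \<mu> (\<lambda>t. rad i t * u i t * (rad j t * u j t))" for i j
    by (rule integrable_unit_interval_bounded[OF _ prod_le]) measurable
  have cross: "(\<integral>t. rad i t * u i t * (rad j t * u j t) \<partial>\<mu>) = (if i = j then (\<integral>t. (u i t)\<^sup>2 \<partial>\<mu>) else 0)" for i j
  proof (cases "i = j")
    case True
    have "rad i t * u i t * (rad i t * u i t) = (rad i t * rad i t) * (u i t)\<^sup>2" for t
      by (simp add: power2_eq_square)
    with True show ?thesis by (simp add: rad_square)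
  next
    case False
    have "(\<integral>t. rad i t * u i t * (rad j t * u j t) \<partial>\<mu>)
       = (\<integral>t. rad i (sign_flip i t) * u i (sign_flip i t) * (rad j (sign_flip i t) * u j (sign_flip i t)) \<partial>\<mu>)"
      by (rule integral_flip[symmetric]) measurable
    also have "\<dots> = - (\<integral>t. rad i t * u i t * (rad j t * u j t) \<partial>\<mu>)"
      using False by (simp add: rad_sign_flip u_inv)
    finally show ?thesis using False by simp
  qed
  have sq_int: "integrable \<mu> (\<lambda>t. (u i t)\<^sup>2)" for i
    using u_le s by (intro integrable_unit_interval_bounded[of _ "s\<^sup>2"]) (auto simp: abs_le_square_iff[symmetric])
  have min_int: "integrable \<mu> (\<lambda>t. min 1 ((h i t)\<^sup>2 / s\<^sup>2))" for i
    by (rule integrable_unit_interval_bounded[of _ 1]) auto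
  have min_eq: "of_bool (s \<le> \<bar>h i t\<bar>) + (u i t)\<^sup>2 / s\<^sup>2 = min 1 ((h i t)\<^sup>2 / s\<^sup>2)" for i t
  proof (cases "s \<le> \<bar>h i t\<bar>")
    case True
    then have "s\<^sup>2 \<le> (h i t)\<^sup>2" using s by (intro abs_le_square_iff[THEN iffD1]) auto
    with True s show ?thesis by (simp add: u_def)
  next
    case False
    then have "(h i t)\<^sup>2 \<le> s\<^sup>2" using s by (intro abs_le_square_iff[THEN iffD1]) auto
    with False s show ?thesis by (simp add: u_def min_absorb2)
  qed
  have point: "of_bool (s \<le> \<bar>\<Sum>i\<in>I. rad i t * h i t\<bar>)
     \<le> (\<Sum>i\<in>I. of_bool (s \<le> \<bar>h i t\<bar>)) + (\<Sum>i\<in>I. rad i t * u i t)\<^sup>2 / s\<^sup>2" for t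
  proof (cases "\<exists>i\<in>I. s \<le> \<bar>h i t\<bar>")
    case True
    then obtain i where i: "i \<in> I" "s \<le> \<bar>h i t\<bar>" by blast
    have "(1::real) = of_bool (s \<le> \<bar>h i t\<bar>)" using i by simp
    also have "\<dots> \<le> (\<Sum>i\<in>I. of_bool (s \<le> \<bar>h i t\<bar>))" using i I by (intro member_le_sum) auto
    finally have "(1::real) \<le> (\<Sum>i\<in>I. of_bool (s \<le> \<bar>h i t\<bar>)) + (\<Sum>i\<in>I. rad i t * u i t)\<^sup>2 / s\<^sup>2"
      by (rule order_trans) simp
    then show ?thesis by (rule order_trans[rotated]) simp
  next
    case False
    then have "(\<Sum>i\<in>I. rad i t * u i t) = (\<Sum>i\<in>I. rad i t * h i t)"
      by (intro sum.cong) (auto simp: u_def)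
    moreover note of_bool_le_square_ratio[OF s, of "\<Sum>i\<in>I. rad i t * h i t"]
    ultimately show ?thesis by (simp add: add_increasing sum_nonneg)
  qed
  have sq: "(\<Sum>i\<in>I. rad i t * u i t)\<^sup>2 = (\<Sum>i\<in>I. \<Sum>j\<in>I. rad i t * u i t * (rad j t * u j t))" for t
    by (simp add: power2_eq_square sum_product)
  have "(\<integral>t. of_bool (s \<le> \<bar>\<Sum>i\<in>I. rad i t * h i t\<bar>) \<partial>\<mu>)
     \<le> (\<integral>t. (\<Sum>i\<in>I. of_bool (s \<le> \<bar>h i t\<bar>)) + (\<Sum>i\<in>I. \<Sum>j\<in>I. rad i t * u i t * (rad j t * u j t)) / s\<^sup>2 \<partial>\<mu>)"
  proof (rule integral_mono)
    show "integrable \<mu> (\<lambda>t. of_bool (s \<le> \<bar>\<Sum>i\<in>I. rad i t * h i t\<bar>) :: real)"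
      by (rule integrable_of_bool) measurable
    have "integrable \<mu> (\<lambda>t. of_bool (s \<le> \<bar>h i t\<bar>) :: real)" for i
      by (rule integrable_of_bool) measurable
    then show "integrable \<mu> (\<lambda>t. (\<Sum>i\<in>I. of_bool (s \<le> \<bar>h i t\<bar>)) + (\<Sum>i\<in>I. \<Sum>j\<in>I. rad i t * u i t * (rad j t * u j t)) / s\<^sup>2)"
      using int by (intro Bochner_Integration.integrable_add Bochner_Integration.integrable_sum integrable_divide)
  qed (use point sq in auto)
  also have "\<dots> = (\<Sum>i\<in>I. \<integral>t. of_bool (s \<le> \<bar>h i t\<bar>) \<partial>\<mu>)
      + (\<Sum>i\<in>I. \<Sum>j\<in>I. \<integral>t. rad i t * u i t * (rad j t * u j t) \<partial>\<mu>) / s\<^sup>2"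
  proof -
    have "integrable \<mu> (\<lambda>t. of_bool (s \<le> \<bar>h i t\<bar>) :: real)" for i
      by (rule integrable_of_bool) measurable
    then show ?thesis using int
      by (subst Bochner_Integration.integral_add) (auto simp: Bochner_Integration.integral_sum)
  qed
  also have "\<dots> = (\<Sum>i\<in>I. (\<integral>t. of_bool (s \<le> \<bar>h i t\<bar>) \<partial>\<mu>) + (\<integral>t. (u i t)\<^sup>2 \<partial>\<mu>) / s\<^sup>2)"
    using I by (simp add: cross sum.delta sum.distrib sum_divide_distrib)
  also have "\<dots> = (\<Sum>i\<in>I. \<integral>t. min 1 ((h i t)\<^sup>2 / s\<^sup>2) \<partial>\<mu>)"
  proof (rule sum.cong[OF refl])
    fix i
    have "integrable \<mu> (\<lambda>t. of_bool (s \<le> \<bar>h i t\<bar>) :: real)" by (rule integrable_of_bool) measurable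
    then have "(\<integral>t. of_bool (s \<le> \<bar>h i t\<bar>) \<partial>\<mu>) + (\<integral>t. (u i t)\<^sup>2 \<partial>\<mu>) / s\<^sup>2
       = (\<integral>t. of_bool (s \<le> \<bar>h i t\<bar>) + (u i t)\<^sup>2 / s\<^sup>2 \<partial>\<mu>)"
      using sq_int by (subst Bochner_Integration.integral_add) auto
    then show "(\<integral>t. of_bool (s \<le> \<bar>h i t\<bar>) \<partial>\<mu>) + (\<integral>t. (u i t)\<^sup>2 \<partial>\<mu>) / s\<^sup>2
       = (\<integral>t. min 1 ((h i t)\<^sup>2 / s\<^sup>2) \<partial>\<mu>)" unfolding min_eq .
  qed
  finally show ?thesis .
qed

text \<open>By symmetry, given that \<open>\<bar>h_i\<bar> \<ge> 1\<close> on the event \<open>A_i\<close> that row \<open>i\<close> has waiting time \<open>k_i\<close>, the sum is at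
  least 1 in absolute value on at least half of \<open>A_i\<close>. The events \<open>A_i\<close> are pairwise independent, and
  a Bonferroni inequality with \<open>q\<close> the sum of their probabilities yields \<open>q/2 - q\<^sup>2/2\<close>.\<close>
lemma rademacher_lower_bound:
  fixes h :: "nat \<Rightarrow> real \<Rightarrow> real" and q :: real
  assumes I: "finite I" and meas [measurable]: "\<And>i. h i \<in> borel_measurable borel"
    and inv: "\<And>i l t. h i (sign_flip l t) = h i t"
    and large: "\<And>i t. i \<in> J \<Longrightarrow> run i (k i) t \<Longrightarrow> 1 \<le> \<bar>h i t\<bar>" and J: "J \<subseteq> I"
    and q: "q = (\<Sum>i\<in>J. (1 / 2) ^ Suc (k i))"
  shows "q * (1 - q) / 2 \<le> (\<integral>t. of_bool (1 \<le> \<bar>\<Sum>i\<in>I. rad i t * h i t\<bar>) \<partial>\<mu>)"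
proof -
  let ?B = "\<lambda>t. 1 \<le> \<bar>\<Sum>i\<in>I. rad i t * h i t\<bar>"
  let ?A = "\<lambda>i t. run i (k i) t"
  have finJ: "finite J" using J I by (rule finite_subset)
  have [measurable]: "Measurable.pred borel ?B" by measurable
  have half: "(1 / 2 :: real) ^ Suc (k i) / 2 \<le> (\<integral>t. of_bool (?A i t \<and> ?B t) \<partial>\<mu>)" if i: "i \<in> J" for i
  proof -
    have iI: "i \<in> I" using i J by blast
    have pt: "of_bool (?A i t) \<le> (of_bool (?A i t \<and> ?B t) + of_bool (?A i (sign_flip i t) \<and> ?B (sign_flip i t)) :: real)" for t
    proof (cases "?A i t")
      case True
      let ?S = "\<lambda>t. \<Sum>i\<in>I. rad i t * h i t"
      have "?S t = rad i t * h i t + (\<Sum>j\<in>I - {i}. rad j t * h j t)" using I iI by (rule sum.remove)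
      moreover have "?S (sign_flip i t) = - (rad i t * h i t) + (\<Sum>j\<in>I - {i}. rad j t * h j t)"
        using I iI by (subst sum.remove[of _ i]) (auto simp: rad_sign_flip inv)
      moreover have "1 \<le> \<bar>rad i t * h i t\<bar>" using large[OF i True] by (simp add: abs_mult)
      ultimately have "?B t \<or> ?B (sign_flip i t)" by linarith
      with True show ?thesis by auto
    qed auto
    have "(1 / 2 :: real) ^ Suc (k i) = (\<integral>t. of_bool (?A i t) \<partial>\<mu>)" by (rule run_probability[symmetric])
    also have "\<dots> \<le> (\<integral>t. of_bool (?A i t \<and> ?B t) + of_bool (?A i (sign_flip i t) \<and> ?B (sign_flip i t)) \<partial>\<mu>)"
    proof (rule integral_mono[OF _ _ pt])
      show "integrable \<mu> (\<lambda>t. of_bool (?A i t) :: real)"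
        by (rule integrable_of_bool) measurable
      show "integrable \<mu> (\<lambda>t. of_bool (?A i t \<and> ?B t) + of_bool (?A i (sign_flip i t) \<and> ?B (sign_flip i t)) :: real)"
        by (intro Bochner_Integration.integrable_add integrable_of_bool) measurable
    qed
    also have "\<dots> = (\<integral>t. of_bool (?A i t \<and> ?B t) \<partial>\<mu>)
        + (\<integral>t. of_bool (?A i (sign_flip i t) \<and> ?B (sign_flip i t)) \<partial>\<mu>)"
      by (intro Bochner_Integration.integral_add integrable_of_bool) measurable
    also have "(\<integral>t. of_bool (?A i (sign_flip i t) \<and> ?B (sign_flip i t)) \<partial>\<mu>)
        = (\<integral>t. of_bool (?A i t \<and> ?B t) \<partial>\<mu> :: real)"
      by (rule integral_flip[where F = "\<lambda>t. of_bool (?A i t \<and> ?B t)"]) measurable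
    finally show ?thesis by simp
  qed
  \<comment> \<open>If \<open>N\<close> of the events occur, this reads \<open>N - N (N - 1) / 2 \<le> 1\<close>, that is, \<open>0 \<le> (N - 1) (N - 2)\<close>.\<close>
  have bonf: "(\<Sum>i\<in>J. of_bool (?A i t \<and> ?B t)) - (\<Sum>i\<in>J. \<Sum>j\<in>J - {i}. of_bool (?A i t \<and> ?A j t)) / 2
      \<le> (of_bool (?B t) :: real)" for t
  proof -
    define N where "N = card {i\<in>J. ?A i t}"
    have 1: "(\<Sum>i\<in>J. of_bool (?A i t) :: real) = real N"
      unfolding N_def using finJ by (simp add: sum.If_cases of_bool_def Int_def)
    have 2: "(\<Sum>i\<in>J. \<Sum>j\<in>J - {i}. of_bool (?A i t \<and> ?A j t) :: real) = real N * real N - real N"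
    proof -
      have "(\<Sum>j\<in>J - {i}. of_bool (?A i t \<and> ?A j t) :: real) = of_bool (?A i t) * real N - of_bool (?A i t)" if "i \<in> J" for i
      proof -
        have "(\<Sum>j\<in>J - {i}. of_bool (?A i t \<and> ?A j t) :: real)
            = (\<Sum>j\<in>J. of_bool (?A i t) * of_bool (?A j t)) - of_bool (?A i t) * of_bool (?A i t)"
          unfolding of_bool_conj using finJ that by (subst sum_diff1) auto
        then show ?thesis unfolding sum_distrib_left[symmetric] 1 by simp
      qed
      then have "(\<Sum>i\<in>J. \<Sum>j\<in>J - {i}. of_bool (?A i t \<and> ?A j t) :: real) = (\<Sum>i\<in>J. of_bool (?A i t) * real N - of_bool (?A i t))"
        by (rule sum.cong[OF refl])
      then show ?thesis by (simp only: sum_subtractf sum_distrib_right[symmetric] 1)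
    qed
    have "real N \<le> real N * real N" by (cases N) auto
    moreover have "real N - (real N * real N - real N) / 2 \<le> 1"
    proof -
      have "0 \<le> (real N - 1) * (real N - 2)"
      proof -
        consider "N = 0" | "N = 1" | "2 \<le> N" by linarith
        then show ?thesis by cases simp_all
      qed
      then show ?thesis by (simp add: field_simps)
    qed
    ultimately show ?thesis unfolding 2 using 1 by (cases "?B t") (auto simp: of_bool_conj)
  qed
  have pair: "(\<Sum>i\<in>J. \<Sum>j\<in>J - {i}. \<integral>t. of_bool (?A i t \<and> ?A j t) \<partial>\<mu>) \<le> q * q"
  proof -
    have "(\<Sum>i\<in>J. \<Sum>j\<in>J - {i}. \<integral>t. of_bool (?A i t \<and> ?A j t) \<partial>\<mu>)
        = (\<Sum>i\<in>J. \<Sum>j\<in>J - {i}. (1 / 2 :: real) ^ Suc (k i) * (1 / 2) ^ Suc (k j))"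
      by (intro sum.cong refl run_pair_probability) auto
    also have "\<dots> \<le> (\<Sum>i\<in>J. \<Sum>j\<in>J. (1 / 2) ^ Suc (k i) * (1 / 2) ^ Suc (k j))"
      using finJ by (intro sum_mono sum_mono2) auto
    also have "\<dots> = q * q" unfolding q by (simp add: sum_product)
    finally show ?thesis .
  qed
  have "q / 2 = (\<Sum>i\<in>J. (1 / 2) ^ Suc (k i) / 2)" unfolding q by (rule sum_divide_distrib)
  also have "\<dots> \<le> (\<Sum>i\<in>J. \<integral>t. of_bool (?A i t \<and> ?B t) \<partial>\<mu>)" by (intro sum_mono half)
  finally have "q * (1 - q) / 2 \<le> (\<Sum>i\<in>J. \<integral>t. of_bool (?A i t \<and> ?B t) \<partial>\<mu>)
     - (\<Sum>i\<in>J. \<Sum>j\<in>J - {i}. \<integral>t. of_bool (?A i t \<and> ?A j t) \<partial>\<mu>) / 2"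
    using pair unfolding right_diff_distrib diff_divide_distrib mult_1_right by linarith
  also have "\<dots> = (\<integral>t. (\<Sum>i\<in>J. of_bool (?A i t \<and> ?B t)) - (\<Sum>i\<in>J. \<Sum>j\<in>J - {i}. of_bool (?A i t \<and> ?A j t)) / 2 \<partial>\<mu>)"
  proof -
    have 1: "integrable \<mu> (\<lambda>t. of_bool (?A i t \<and> ?B t) :: real)" for i
      by (rule integrable_of_bool) measurable
    have 2: "integrable \<mu> (\<lambda>t. of_bool (?A i t \<and> ?A j t) :: real)" for i j
      by (rule integrable_of_bool) measurable
    show ?thesis using 1 2 by (subst Bochner_Integration.integral_diff)
       (simp_all only: Bochner_Integration.integral_sum Bochner_Integration.integrable_sum integrable_divide integral_divide_zero)
  qed
  also have "\<dots> \<le> (\<integral>t. of_bool (?B t) \<partial>\<mu>)"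
  proof (rule integral_mono[OF _ _ bonf])
    show "integrable \<mu> (\<lambda>t. (\<Sum>i\<in>J. of_bool (?A i t \<and> ?B t)) - (\<Sum>i\<in>J. \<Sum>j\<in>J - {i}. of_bool (?A i t \<and> ?A j t)) / 2 :: real)"
      by (intro Bochner_Integration.integrable_diff Bochner_Integration.integrable_sum integrable_divide integrable_of_bool) measurable
  qed (rule integrable_of_bool, measurable)
  finally show ?thesis .
qed


section \<open>Heavy-tailed variables\<close>

context rv_orlicz
begin

text \<open>At most one term is nonzero: the value is \<open>\<beta>^k\<close> if row \<open>i\<close> has waiting time \<open>k\<close>, and 0 on the null set
  where no entry after the sign is 1. Thus \<open>heavy\<close> exceeds \<open>x\<close> with probability of order \<open>x powr -p\<close>
  for \<open>x \<ge> 1\<close>.\<close>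
definition heavy :: "nat \<Rightarrow> real \<Rightarrow> real" where
  "heavy i t = (\<Sum>k. \<beta> ^ k * of_bool (run i k t))"

lemma heavy_measurable [measurable]: "heavy i \<in> borel_measurable borel"
  unfolding heavy_def[abs_def] by measurable

lemma heavy_run: "run i k t \<Longrightarrow> heavy i t = \<beta> ^ k"
  unfolding heavy_def by (subst suminf_single[of k]) (auto dest: run_unique)

lemma heavy_no_run: "(\<And>k. \<not> run i k t) \<Longrightarrow> heavy i t = 0"
  unfolding heavy_def by simp

lemma heavy_nonneg: "0 \<le> heavy i t"
  using heavy_run[of i _ t] heavy_no_run[of i t] beta_gt_1
  by (metis less_eq_real_def less_trans zero_less_one zero_less_power)

lemma heavy_sign_flip [simp]: "heavy i (sign_flip l t) = heavy i t"
  unfolding heavy_def by simp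

lemma beta_pow_power_p:
  assumes "0 < x"
  shows "x < \<beta> ^ k \<Longrightarrow> x powr p \<le> 2 ^ k" "\<beta> ^ k \<le> x \<Longrightarrow> 2 ^ k \<le> x powr p"
  using assms p_gt_1 beta_gt_1 powr_mono2[of p x "\<beta> ^ k"] powr_mono2[of p "\<beta> ^ k" x]
  by (auto simp: beta_pow_powr)

text \<open>For \<open>m\<close> with \<open>\<beta>^(m-1) \<le> 1/a < \<beta>^m\<close> the number \<open>2^-m\<close> is comparable with \<open>a powr p\<close>: this is the
  probability that a heavy variable reaches the size \<open>1/a\<close>.\<close>
lemma bracket_reciprocal:
  assumes "0 < a" "a \<le> 1"
  obtains m where "1 < a * \<beta> ^ m" "a * \<beta> ^ m \<le> \<beta>" "a powr p / 2 \<le> (1 / 2) ^ m" "(1 / 2) ^ m \<le> a powr p"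
proof -
  obtain k where k: "\<beta> ^ k \<le> 1 / a" "1 / a < \<beta> ^ Suc k"
    using geometric_bracket[OF beta_gt_1, of "1 / a"] assms by auto
  have "2 ^ k \<le> (1 / a) powr p" "(1 / a) powr p \<le> 2 ^ Suc k"
    using beta_pow_power_p[of "1 / a"] assms k by (auto simp del: power_Suc)
  then have "2 ^ k * a powr p \<le> 1" "1 \<le> 2 ^ Suc k * a powr p"
    using assms by (simp_all add: powr_divide pos_le_divide_eq pos_divide_le_eq mult.commute del: power_Suc)
  then have "a powr p / 2 \<le> (1 / 2) ^ Suc k" "(1 / 2) ^ Suc k \<le> a powr p"
    by (simp_all add: power_divide field_simps)
  moreover have "1 < a * \<beta> ^ Suc k" using k(2) assms by (simp add: pos_divide_less_eq mult.commute del: power_Suc)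
  moreover have "a * \<beta> ^ Suc k \<le> \<beta>"
  proof -
    have "a * \<beta> ^ k \<le> 1" using k(1) assms by (simp add: pos_le_divide_eq mult.commute)
    then have "(a * \<beta> ^ k) * \<beta> \<le> 1 * \<beta>" using beta_gt_1 by (intro mult_right_mono) auto
    then show ?thesis by (simp add: ac_simps)
  qed
  ultimately show ?thesis using that by blast
qed

text \<open>With \<open>m\<close> as in \<open>bracket_reciprocal\<close>, the values below \<open>\<beta>^m\<close> contribute a geometric sum of ratio
  \<open>\<beta>\<^sup>2/2 > 1\<close>, dominated by its last term, and the others have total probability \<open>2^-m\<close>.\<close>
lemma heavy_truncated_moment:
  obtains C where "0 < C"
    "\<And>c i. 0 \<le> c \<Longrightarrow> (\<integral>t. min 1 ((c * heavy i t)\<^sup>2) \<partial>\<mu>) \<le> C * c powr p"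
proof -
  define D where "D = 1 / (\<beta>\<^sup>2 / 2 - 1)"
  have D: "0 < D" unfolding D_def using beta_sq_gt_2 by simp
  have "(\<integral>t. min 1 ((c * heavy i t)\<^sup>2) \<partial>\<mu>) \<le> (1 + \<beta>\<^sup>2 * D) * c powr p" if c: "0 \<le> c" for c i
  proof -
    have int: "integrable \<mu> (\<lambda>t. min 1 ((c * heavy i t)\<^sup>2))"
      by (rule integrable_unit_interval_bounded[of _ 1]) auto
    consider "c = 0" | "1 < c" | "0 < c" "c \<le> 1" using c by linarith
    then show ?thesis
    proof cases
      case 1
      then show ?thesis by simp
    next
      case 2
      have "(\<integral>t. min 1 ((c * heavy i t)\<^sup>2) \<partial>\<mu>) \<le> (\<integral>t. 1 \<partial>\<mu>)"
        by (intro integral_mono int) auto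
      also have "\<dots> = 1 * 1" by simp
      also have "\<dots> \<le> (1 + \<beta>\<^sup>2 * D) * c powr p" using 2 p_gt_1 D by (intro mult_mono) (auto simp: ge_one_powr_ge_zero)
      finally show ?thesis .
    next
      case 3
      obtain m where m: "1 < c * \<beta> ^ m" "c * \<beta> ^ m \<le> \<beta>" "(1 / 2) ^ m \<le> c powr p"
        using bracket_reciprocal[OF 3] by blast
      let ?pre = "\<lambda>t. \<forall>j<m. \<not> digit (prod_encode (i, Suc j)) t"
      have [measurable]: "Measurable.pred borel ?pre" by measurable
      have pt: "min 1 ((c * heavy i t)\<^sup>2) \<le> (\<Sum>k<m. (c * \<beta> ^ k)\<^sup>2 * of_bool (run i k t)) + of_bool (?pre t)" for t
      proof (cases "\<exists>k. run i k t")
        case True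
        then obtain k where k: "run i k t" by blast
        show ?thesis
        proof (cases "k < m")
          case True
          have "(c * \<beta> ^ k)\<^sup>2 * of_bool (run i k t) \<le> (\<Sum>k<m. (c * \<beta> ^ k)\<^sup>2 * of_bool (run i k t))"
            using True by (intro member_le_sum) auto
          then have "(c * heavy i t)\<^sup>2 \<le> (\<Sum>k<m. (c * \<beta> ^ k)\<^sup>2 * of_bool (run i k t))"
            using k by (simp add: heavy_run)
          then show ?thesis by (auto intro: min.coboundedI2 add_increasing2)
        next
          case False
          then have "?pre t" using k unfolding run_def by auto
          then show ?thesis by (auto intro!: min.coboundedI1 add_increasing sum_nonneg)
        qed
      next
        case False
        then have "heavy i t = 0" using heavy_no_run by blast
        then show ?thesis by (auto intro!: add_nonneg_nonneg sum_nonneg)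
      qed
      have int1: "integrable \<mu> (\<lambda>t. of_bool (run i k t) :: real)" for k
        by (rule integrable_of_bool) measurable
      have int2: "integrable \<mu> (\<lambda>t. of_bool (?pre t) :: real)"
        by (rule integrable_of_bool) measurable
      have "(\<integral>t. min 1 ((c * heavy i t)\<^sup>2) \<partial>\<mu>)
        \<le> (\<integral>t. (\<Sum>k<m. (c * \<beta> ^ k)\<^sup>2 * of_bool (run i k t)) + of_bool (?pre t) \<partial>\<mu>)"
      proof (rule integral_mono[OF int _ pt])
        show "integrable \<mu> (\<lambda>t. (\<Sum>k<m. (c * \<beta> ^ k)\<^sup>2 * of_bool (run i k t)) + of_bool (?pre t))"
          by (intro Bochner_Integration.integrable_add Bochner_Integration.integrable_sum integrable_mult_right int1 int2)
      qed
      also have "\<dots> = (\<Sum>k<m. (c * \<beta> ^ k)\<^sup>2 * (1 / 2) ^ Suc k) + (1 / 2) ^ m"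
      proof -
        have "(\<integral>t. (\<Sum>k<m. (c * \<beta> ^ k)\<^sup>2 * of_bool (run i k t)) \<partial>\<mu>)
            = (\<Sum>k<m. \<integral>t. (c * \<beta> ^ k)\<^sup>2 * of_bool (run i k t) \<partial>\<mu>)"
          by (intro Bochner_Integration.integral_sum integrable_mult_right int1)
        moreover have I1: "integrable \<mu> (\<lambda>t. \<Sum>k<m. (c * \<beta> ^ k)\<^sup>2 * of_bool (run i k t))"
          by (intro Bochner_Integration.integrable_sum integrable_mult_right int1)
        ultimately show ?thesis
          by (simp only: Bochner_Integration.integral_add[OF I1 int2] integral_mult_right_zero
              run_probability prefix_probability)
      qed
      also have "(\<Sum>k<m. (c * \<beta> ^ k)\<^sup>2 * (1 / 2) ^ Suc k) = c\<^sup>2 / 2 * (\<Sum>k<m. (\<beta>\<^sup>2 / 2) ^ k)"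
        by (simp add: sum_distrib_left power_mult_distrib power_divide power_mult[symmetric] mult.commute)
      also have "(\<Sum>k<m. (\<beta>\<^sup>2 / 2) ^ k) = ((\<beta>\<^sup>2 / 2) ^ m - 1) / (\<beta>\<^sup>2 / 2 - 1)"
        using beta_sq_gt_2 by (intro geometric_sum) auto
      also have "\<dots> \<le> (\<beta>\<^sup>2 / 2) ^ m * D" unfolding D_def using beta_sq_gt_2 by (simp add: divide_right_mono)
      also have "c\<^sup>2 / 2 * ((\<beta>\<^sup>2 / 2) ^ m * D) = (c * \<beta> ^ m)\<^sup>2 * (1 / 2) ^ m * (D / 2)"
        by (simp add: power_mult_distrib power_divide power_mult[symmetric] mult.commute)
      also have "\<dots> \<le> \<beta>\<^sup>2 * c powr p * (D / 2)"
        using m beta_gt_1 3 D by (intro mult_right_mono mult_mono power_mono) auto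
      finally have "(\<integral>t. min 1 ((c * heavy i t)\<^sup>2) \<partial>\<mu>) \<le> \<beta>\<^sup>2 * c powr p * (D / 2) + c powr p"
        using m(3) by (simp add: mult_left_mono)
      also have "\<dots> \<le> (1 + \<beta>\<^sup>2 * D) * c powr p" using D by (simp add: algebra_simps)
      finally show ?thesis .
    qed
  qed
  moreover have "0 < 1 + \<beta>\<^sup>2 * D" using D by (intro add_pos_nonneg) auto
  ultimately show ?thesis using that by blast
qed

text \<open>The tail of the sum at \<open>\<beta>^k\<close> is at most \<open>C/2^k\<close>, uniformly in the coefficients. Summing \<open>M\<close> over the
  layers between \<open>\<beta>^k\<close> and \<open>\<beta>^(k+1)\<close> therefore gives a bound by the convergent series.\<close>
lemma heavy_sum_modular_bound:
  assumes W: "summable (\<lambda>k. M (\<beta> ^ k) / 2 ^ k)"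
  obtains Q where "1 \<le> Q"
    "\<And>(n::nat) a. (\<Sum>i<n. \<bar>a i\<bar> powr p) \<le> 1 \<Longrightarrow>
      orlicz_modular M (\<lambda>t. \<Sum>i<n. a i * (rad (Suc i) t * heavy (Suc i) t)) \<le> ennreal Q"
proof -
  obtain C where C: "0 < C"
    "\<And>c i. 0 \<le> c \<Longrightarrow> (\<integral>t. min 1 ((c * heavy i t)\<^sup>2) \<partial>\<mu>) \<le> C * c powr p"
    using heavy_truncated_moment by blast
  have S: "summable (\<lambda>k. M (\<beta> ^ Suc k) * (C / 2 ^ k))"
  proof -
    have "summable (\<lambda>k. 2 * C * (M (\<beta> ^ Suc k) / 2 ^ Suc k))"
      using W by (intro summable_mult) (subst summable_Suc_iff)
    then show ?thesis by (simp add: field_simps)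
  qed
  define Q where "Q = 1 + (\<Sum>k. M (\<beta> ^ Suc k) * (C / 2 ^ k))"
  have Q1: "1 \<le> Q" unfolding Q_def using S C beta_gt_1 by (simp add: suminf_nonneg)
  have "orlicz_modular M (\<lambda>t. \<Sum>i<n. a i * (rad (Suc i) t * heavy (Suc i) t)) \<le> ennreal Q"
    if a: "(\<Sum>i<n. \<bar>a i\<bar> powr p) \<le> 1" for n :: nat and a
  proof -
    \<comment> \<open>Row 0 is reserved for the spikes, so the coefficient \<open>a i\<close> sits in row \<open>Suc i\<close>.\<close>
    define h where "h i t = (if i = 0 then 0 else a (i - 1) * heavy i t)" for i t
    have [measurable]: "h i \<in> borel_measurable borel" for i unfolding h_def[abs_def] by measurable
    have h_inv: "h i (sign_flip l t) = h i t" for i l t unfolding h_def by simp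
    define S where "S t = (\<Sum>i\<in>Suc ` {..<n}. rad i t * h i t)" for t
    have S_eq: "(\<Sum>i<n. a i * (rad (Suc i) t * heavy (Suc i) t)) = S t" for t
      unfolding S_def by (subst sum.reindex) (auto simp: h_def ac_simps)
    have S_meas [measurable]: "S \<in> borel_measurable borel" unfolding S_def[abs_def] by measurable
    have tail: "(\<integral>t. of_bool (\<beta> ^ k \<le> \<bar>S t\<bar>) \<partial>\<mu>) \<le> C / 2 ^ k" for k
    proof -
      have "(\<integral>t. of_bool (\<beta> ^ k \<le> \<bar>S t\<bar>) \<partial>\<mu>)
          \<le> (\<Sum>i\<in>Suc ` {..<n}. \<integral>t. min 1 ((h i t)\<^sup>2 / (\<beta> ^ k)\<^sup>2) \<partial>\<mu>)"
        unfolding S_def using beta_gt_1 by (intro rademacher_tail h_inv) auto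
      also have "\<dots> = (\<Sum>i<n. \<integral>t. min 1 ((\<bar>a i\<bar> / \<beta> ^ k * heavy (Suc i) t)\<^sup>2) \<partial>\<mu>)"
        by (subst sum.reindex) (auto simp: h_def power_mult_distrib power_divide)
      also have "\<dots> \<le> (\<Sum>i<n. C * (\<bar>a i\<bar> / \<beta> ^ k) powr p)"
        using beta_gt_1 by (intro sum_mono C) auto
      also have "\<dots> = C / 2 ^ k * (\<Sum>i<n. \<bar>a i\<bar> powr p)"
        using beta_gt_1 by (simp add: powr_divide beta_pow_powr sum_distrib_left)
      also have "\<dots> \<le> C / 2 ^ k * 1" using a C(1) by (intro mult_left_mono) auto
      finally show ?thesis by simp
    qed
    have tail': "(\<integral>\<^sup>+ t. ennreal (of_bool (\<beta> ^ k \<le> \<bar>S t\<bar>)) \<partial>\<mu>) \<le> ennreal (C / 2 ^ k)" for k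
    proof -
      have "integrable \<mu> (\<lambda>t. of_bool (\<beta> ^ k \<le> \<bar>S t\<bar>) :: real)"
        by (rule integrable_of_bool) measurable
      then show ?thesis using tail[of k] by (subst nn_integral_eq_integral) (auto intro: ennreal_leI)
    qed
    have pt: "ennreal (M \<bar>u\<bar>) \<le> 1 + (\<Sum>k. ennreal (M (\<beta> ^ Suc k)) * ennreal (of_bool (\<beta> ^ k \<le> \<bar>u\<bar>)))" for u
    proof (cases "\<bar>u\<bar> \<le> 1")
      case True
      then have "M \<bar>u\<bar> \<le> 1" using M_mono[of "\<bar>u\<bar>" 1] by simp
      then have "ennreal (M \<bar>u\<bar>) \<le> 1" by (metis ennreal_1 ennreal_leI)
      then show ?thesis by (rule order_trans) simp
    next
      case False
      then obtain k where k: "\<beta> ^ k \<le> \<bar>u\<bar>" "\<bar>u\<bar> < \<beta> ^ Suc k" using geometric_bracket[OF beta_gt_1, of "\<bar>u\<bar>"] by auto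
      have "ennreal (M \<bar>u\<bar>) \<le> ennreal (M (\<beta> ^ Suc k)) * ennreal (of_bool (\<beta> ^ k \<le> \<bar>u\<bar>))"
        using k by (auto intro!: ennreal_leI M_mono)
      also have "\<dots> \<le> (\<Sum>k. ennreal (M (\<beta> ^ Suc k)) * ennreal (of_bool (\<beta> ^ k \<le> \<bar>u\<bar>)))"
        using sum_le_suminf[of "\<lambda>k. ennreal (M (\<beta> ^ Suc k)) * ennreal (of_bool (\<beta> ^ k \<le> \<bar>u\<bar>))" "{k}"] by simp
      finally show ?thesis by (rule order_trans) simp
    qed
    have "orlicz_modular M S \<le> (\<integral>\<^sup>+ t. 1 + (\<Sum>k. ennreal (M (\<beta> ^ Suc k)) * ennreal (of_bool (\<beta> ^ k \<le> \<bar>S t\<bar>))) \<partial>\<mu>)"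
      unfolding orlicz_modular_def by (intro nn_integral_mono pt)
    also have "\<dots> = 1 + (\<Sum>k. ennreal (M (\<beta> ^ Suc k)) * (\<integral>\<^sup>+ t. ennreal (of_bool (\<beta> ^ k \<le> \<bar>S t\<bar>)) \<partial>\<mu>))"
    proof -
      define G where "G k t = ennreal (of_bool (\<beta> ^ k \<le> \<bar>S t\<bar>))" for k t
      have G: "G k \<in> borel_measurable \<mu>" for k unfolding G_def[abs_def] by measurable
      have "(\<integral>\<^sup>+ t. 1 + (\<Sum>k. ennreal (M (\<beta> ^ Suc k)) * G k t) \<partial>\<mu>)
          = (\<integral>\<^sup>+ t. 1 \<partial>\<mu>) + (\<integral>\<^sup>+ t. (\<Sum>k. ennreal (M (\<beta> ^ Suc k)) * G k t) \<partial>\<mu>)"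
        using G by (intro nn_integral_add) auto
      also have "(\<integral>\<^sup>+ t. (\<Sum>k. ennreal (M (\<beta> ^ Suc k)) * G k t) \<partial>\<mu>)
          = (\<Sum>k. \<integral>\<^sup>+ t. ennreal (M (\<beta> ^ Suc k)) * G k t \<partial>\<mu>)"
        using G by (intro nn_integral_suminf) auto
      also have "\<dots> = (\<Sum>k. ennreal (M (\<beta> ^ Suc k)) * (\<integral>\<^sup>+ t. G k t \<partial>\<mu>))"
        using G by (intro suminf_cong nn_integral_cmult)
      finally show ?thesis unfolding G_def by simp
    qed
    also have "\<dots> \<le> 1 + (\<Sum>k. ennreal (M (\<beta> ^ Suc k)) * ennreal (C / 2 ^ k))"
      by (intro add_left_mono suminf_le mult_left_mono tail') auto
    also have "\<dots> = 1 + (\<Sum>k. ennreal (M (\<beta> ^ Suc k) * (C / 2 ^ k)))"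
      using beta_gt_1 C(1) by (subst ennreal_mult) auto
    also have "\<dots> = 1 + ennreal (\<Sum>k. M (\<beta> ^ Suc k) * (C / 2 ^ k))"
      using beta_gt_1 C(1) \<open>summable (\<lambda>k. M (\<beta> ^ Suc k) * (C / 2 ^ k))\<close> by (subst suminf_ennreal2) auto
    also have "\<dots> = ennreal Q"
      unfolding Q_def using beta_gt_1 C(1) \<open>summable (\<lambda>k. M (\<beta> ^ Suc k) * (C / 2 ^ k))\<close>
      by (subst ennreal_plus) (auto intro!: suminf_nonneg)
    finally show ?thesis unfolding S_eq .
  qed
  then show ?thesis using that Q1 by blast
qed

section \<open>Spikes\<close>

text \<open>Regular variation is a pointwise limit in \<open>a\<close>. Monotonicity of \<open>M\<close> reduces uniformity to the finitely
  many dilations \<open>\<beta>^-k\<close>, at the cost of the factor 2, and for very small \<open>a\<close> convexity gives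
  \<open>M(a b) \<le> a M(b)\<close>.\<close>
lemma M_dilation_uniform:
  assumes d: "0 < d"
  obtains B where "\<And>a b. B \<le> b \<Longrightarrow> 0 \<le> a \<Longrightarrow> a \<le> 1 \<Longrightarrow> M (a * b) \<le> M b * (2 * a powr p + d)"
proof -
  have binv: "1 / \<beta> < 1" using beta_gt_1 by simp
  obtain K where K: "(1 / \<beta>) ^ K < d" using real_arch_pow_inv[OF d binv] by blast
  have "\<forall>\<^sub>F b in at_top. \<forall>k\<in>{..<K}. M ((1 / \<beta>) ^ k * b) \<le> M b * ((1 / 2) ^ k + d)"
  proof (intro eventually_ball_finite ballI)
    fix k
    have pw: "((1 / \<beta>) ^ k) powr p = (1 / 2) ^ k" using beta_gt_1 beta_pow_powr[of k]
      by (simp add: power_divide powr_divide)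
    have "\<forall>\<^sub>F t in at_top. ((1 / 2) ^ k - 1) * M t \<le> M ((1 / \<beta>) ^ k * t) \<and> M ((1 / \<beta>) ^ k * t) \<le> ((1 / 2) ^ k + d) * M t"
      using beta_gt_1 d pw by (intro M_ratio) auto
    then show "\<forall>\<^sub>F b in at_top. M ((1 / \<beta>) ^ k * b) \<le> M b * ((1 / 2) ^ k + d)"
      by eventually_elim (simp add: mult.commute)
  qed auto
  then obtain B0 where B0: "\<And>b k. B0 \<le> b \<Longrightarrow> k < K \<Longrightarrow> M ((1 / \<beta>) ^ k * b) \<le> M b * ((1 / 2) ^ k + d)"
    unfolding eventually_at_top_linorder by blast
  define B where "B = max 0 B0"
  have "M (a * b) \<le> M b * (2 * a powr p + d)" if b: "B \<le> b" and a: "0 \<le> a" "a \<le> 1" for a b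
  proof (cases "a = 0")
    case True
    then show ?thesis using d b by (simp add: B_def)
  next
    case False
    have b0: "0 \<le> b" "B0 \<le> b" using b unfolding B_def by auto
    have ap: "0 < a" using False a by simp
    obtain k where k: "\<beta> ^ k \<le> 1 / a" "1 / a < \<beta> ^ Suc k"
      using geometric_bracket[OF beta_gt_1, of "1 / a"] a ap by auto
    have "(1 / a) powr p \<le> 2 ^ Suc k" using beta_pow_power_p(1)[OF _ k(2)] ap by simp
    then have k2: "(1 / 2) ^ k \<le> 2 * a powr p" using ap by (simp add: powr_divide power_divide field_simps)
    have ak: "a \<le> (1 / \<beta>) ^ k" using k(1) ap beta_gt_1 by (simp add: power_divide field_simps)
    show ?thesis
    proof (cases "k < K")
      case True
      have "M (a * b) \<le> M ((1 / \<beta>) ^ k * b)" using ak a b0 by (intro M_mono mult_right_mono) auto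
      also have "\<dots> \<le> M b * ((1 / 2) ^ k + d)" using B0 b0 True by blast
      also have "\<dots> \<le> M b * (2 * a powr p + d)" using k2 b0 by (intro mult_left_mono) auto
      finally show ?thesis .
    next
      case False
      have "(1 / \<beta>) ^ k \<le> (1 / \<beta>) ^ K" using False beta_gt_1 by (intro power_decreasing) auto
      then have ad: "a \<le> 2 * a powr p + d" using ak K by (smt (verit) powr_ge_zero)
      have "M (a * b) \<le> a * M b" using a b0 by (intro M_contract) auto
      also have "\<dots> \<le> (2 * a powr p + d) * M b" using ad b0 by (intro mult_right_mono) auto
      finally show ?thesis by (simp add: mult.commute)
    qed
  qed
  then show ?thesis using that by blast
qed

lemma M_surj:
  assumes "0 \<le> y"
  obtains x where "0 \<le> x" "M x = y"
proof -
  obtain z where z: "0 \<le> z" "y \<le> M z"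
  proof -
    have "\<forall>\<^sub>F z in at_top. y \<le> M z \<and> 0 \<le> z"
      using M_at_top eventually_ge_at_top[of 0] by (auto simp: filterlim_at_top eventually_conj_iff)
    then show ?thesis using that unfolding eventually_at_top_linorder by blast
  qed
  have "continuous_on {0..z} M" using orlicz unfolding orlicz_function_def by (auto intro: continuous_on_subset)
  then obtain x where "0 \<le> x" "M x = y" using IVT'[of M 0 y z] z assms by auto
  then show ?thesis using that by blast
qed

text \<open>The spike \<open>i\<close> will have height \<open>b i\<close> and live on the event that row 0 has waiting time \<open>n i\<close>, whose
  probability is \<open>2^-(n i + 1) = 1 / M(b i)\<close>. The last property is an upper \<open>p\<close>-estimate with summable
  errors; it forces \<open>b i\<close> to grow fast.\<close>
lemma spike_parameters:
  obtains n :: "nat \<Rightarrow> nat" and b :: "nat \<Rightarrow> real" where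
    "strict_mono n" "\<And>i. 0 < b i" "\<And>i. M (b i) = 2 ^ Suc (n i)"
    "\<And>i a. 0 \<le> a \<Longrightarrow> a \<le> 1 \<Longrightarrow> M (a * b i) \<le> M (b i) * (2 * a powr p + (1 / 2) ^ i)"
proof -
  have "\<exists>B. \<forall>b\<ge>B. \<forall>a. 0 \<le> a \<and> a \<le> 1 \<longrightarrow> M (a * b) \<le> M b * (2 * a powr p + (1 / 2) ^ i)" for i :: nat
    using M_dilation_uniform[of "(1 / 2) ^ i"] by (metis half_gt_zero_iff zero_less_one zero_less_power)
  then obtain B where B: "\<And>i b a. B i \<le> b \<Longrightarrow> 0 \<le> a \<Longrightarrow> a \<le> 1 \<Longrightarrow>
      M (a * b) \<le> M b * (2 * a powr p + (1 / 2) ^ i)" for i :: nat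
    by metis
  have "\<exists>N. M (max 0 (B i)) < 2 ^ N" for i using real_arch_pow[of 2] by simp
  then obtain N where N: "\<And>i. M (max 0 (B i)) < 2 ^ N i" by metis
  define n where "n i = (\<Sum>j\<le>i. Suc (N j))" for i
  have n_mono: "strict_mono n" unfolding n_def by (rule strict_monoI_Suc) simp
  have Nn: "N i \<le> Suc (n i)" for i
    using member_le_sum[of i "{..i}" "\<lambda>j. Suc (N j)"] unfolding n_def by simp
  have "\<exists>x. 0 \<le> x \<and> M x = 2 ^ Suc (n i)" for i using M_surj[of "2 ^ Suc (n i)"] by (metis zero_le_numeral zero_le_power)
  then obtain b where b: "\<And>i. 0 \<le> b i" "\<And>i. M (b i) = 2 ^ Suc (n i)" by metis
  have bB: "B i \<le> b i" for i
  proof (rule ccontr)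
    assume "\<not> B i \<le> b i"
    then have "M (b i) \<le> M (max 0 (B i))" using b(1)[of i] by (intro M_mono) auto
    also have "\<dots> < 2 ^ N i" by (rule N)
    also have "\<dots> \<le> 2 ^ Suc (n i)" using Nn[of i] by (intro power_increasing) auto
    finally show False using b(2)[of i] by simp
  qed
  have "0 < b i" for i using b(1)[of i] b(2)[of i] by (cases "b i = 0") auto
  then show ?thesis using that[OF n_mono _ b(2)] B bB by blast
qed

lemma coefficient_le_1:
  fixes a :: "nat \<Rightarrow> real"
  assumes "(\<Sum>i<N. \<bar>a i\<bar> powr p) \<le> 1" "i < N"
  shows "\<bar>a i\<bar> \<le> 1"
proof -
  have "\<bar>a i\<bar> powr p \<le> (\<Sum>i<N. \<bar>a i\<bar> powr p)" using assms(2) by (intro member_le_sum) auto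
  then have "\<bar>a i\<bar> powr p \<le> 1" using assms(1) by simp
  then show ?thesis using gr_one_powr[of "\<bar>a i\<bar>" p] p_gt_1 by linarith
qed

text \<open>The spikes are disjoint, so the modular is at most the sum of \<open>M(\<bar>a_i\<bar> b_i) / M(b_i)\<close>, which is at
  most \<open>2 \<bar>a_i\<bar>^p + 2^-i\<close>.\<close>
lemma spike_sum_modular_bound:
  assumes n: "strict_mono n" and b: "\<And>i. 0 < b i" "\<And>i. M (b i) = 2 ^ Suc (n i)"
    and dil: "\<And>i a. 0 \<le> a \<Longrightarrow> a \<le> 1 \<Longrightarrow> M (a * b i) \<le> M (b i) * (2 * a powr p + (1 / 2) ^ i)"
    and a: "(\<Sum>i<N. \<bar>a i\<bar> powr p) \<le> 1"
  shows "orlicz_modular M (\<lambda>t. \<Sum>i<N. a i * (rad (Suc i) t * (b i * of_bool (run 0 (n i) t)))) \<le> ennreal 4"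
proof -
  note a1 = coefficient_le_1[OF a]
  have pt: "ennreal (M \<bar>\<Sum>i<N. a i * (rad (Suc i) t * (b i * of_bool (run 0 (n i) t)))\<bar>)
      \<le> (\<Sum>i<N. ennreal (M (\<bar>a i\<bar> * b i)) * ennreal (of_bool (run 0 (n i) t)))" for t
  proof (cases "\<exists>i<N. run 0 (n i) t")
    case True
    then obtain i where i: "i < N" "run 0 (n i) t" by blast
    have other: "b j * of_bool (run 0 (n j) t) = 0" if "j \<noteq> i" for j
    proof -
      have "n j \<noteq> n i" using that n by (simp add: strict_mono_eq)
      then show ?thesis using run_unique[OF i(2), of "n j"] by auto
    qed
    have "(\<Sum>j<N. a j * (rad (Suc j) t * (b j * of_bool (run 0 (n j) t)))) = (\<Sum>j<N. if j = i then a i * (rad (Suc i) t * b i) else 0)"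
      using other i by (intro sum.cong) auto
    also have "\<dots> = a i * (rad (Suc i) t * b i)" using i by simp
    finally have "\<bar>\<Sum>i<N. a i * (rad (Suc i) t * (b i * of_bool (run 0 (n i) t)))\<bar> = \<bar>a i\<bar> * b i"
      using b(1)[of i] by (simp add: abs_mult)
    then have "ennreal (M \<bar>\<Sum>i<N. a i * (rad (Suc i) t * (b i * of_bool (run 0 (n i) t)))\<bar>) = ennreal (M (\<bar>a i\<bar> * b i)) * ennreal (of_bool (run 0 (n i) t))"
      using i by simp
    also have "\<dots> \<le> (\<Sum>i<N. ennreal (M (\<bar>a i\<bar> * b i)) * ennreal (of_bool (run 0 (n i) t)))"
      using i by (intro member_le_sum) auto
    finally show ?thesis .
  next
    case False
    then show ?thesis by simp
  qed
  have run_nn: "(\<integral>\<^sup>+ t. ennreal (of_bool (run 0 k t)) \<partial>\<mu>) = ennreal ((1 / 2) ^ Suc k)" for k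
  proof -
    have "integrable \<mu> (\<lambda>t. of_bool (run 0 k t) :: real)" by (rule integrable_of_bool) measurable
    then show ?thesis by (subst nn_integral_eq_integral) (auto simp: run_probability simp del: power_Suc)
  qed
  have "orlicz_modular M (\<lambda>t. \<Sum>i<N. a i * (rad (Suc i) t * (b i * of_bool (run 0 (n i) t))))
    \<le> (\<integral>\<^sup>+ t. (\<Sum>i<N. ennreal (M (\<bar>a i\<bar> * b i)) * ennreal (of_bool (run 0 (n i) t))) \<partial>\<mu>)"
    unfolding orlicz_modular_def by (intro nn_integral_mono pt)
  also have "\<dots> = (\<Sum>i<N. ennreal (M (\<bar>a i\<bar> * b i)) * ennreal ((1 / 2) ^ Suc (n i)))"
    by (subst nn_integral_sum, measurable, subst nn_integral_cmult, measurable) (simp only: run_nn)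
  also have "\<dots> \<le> (\<Sum>i<N. ennreal (2 * \<bar>a i\<bar> powr p + (1 / 2) ^ i))"
  proof (rule sum_mono)
    fix i assume "i \<in> {..<N}"
    then have "M (\<bar>a i\<bar> * b i) \<le> 2 ^ Suc (n i) * (2 * \<bar>a i\<bar> powr p + (1 / 2) ^ i)"
      using dil[of "\<bar>a i\<bar>" i] a1[of i] b(2)[of i] by simp
    then have "M (\<bar>a i\<bar> * b i) * (1 / 2) ^ Suc (n i) \<le> 2 * \<bar>a i\<bar> powr p + (1 / 2) ^ i"
      by (simp add: power_divide field_simps del: power_Suc)
    then show "ennreal (M (\<bar>a i\<bar> * b i)) * ennreal ((1 / 2) ^ Suc (n i)) \<le> ennreal (2 * \<bar>a i\<bar> powr p + (1 / 2) ^ i)"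
      using b(1)[of i] by (subst ennreal_mult[symmetric]) (simp_all add: ennreal_leI del: ennreal_plus power_Suc)
  qed
  also have "\<dots> = ennreal (\<Sum>i<N. 2 * \<bar>a i\<bar> powr p + (1 / 2) ^ i)" by (rule sum_ennreal) simp
  also have "\<dots> \<le> ennreal 4"
  proof (rule ennreal_leI)
    have "(\<Sum>i<N. (1 / 2 :: real) ^ i) \<le> 2" by (simp add: sum_gp_strict)
    then show "(\<Sum>i<N. 2 * \<bar>a i\<bar> powr p + (1 / 2) ^ i) \<le> 4" using a by (simp add: sum.distrib sum_distrib_left[symmetric])
  qed
  finally show ?thesis .
qed

text \<open>A lower bound in measure that is insensitive to any further nonnegative contribution \<open>v\<close>. The waiting
  times \<open>m i\<close> are those for which \<open>\<bar>a_i\<bar> heavy\<close> just exceeds 1; their probabilities are between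
  \<open>\<bar>a_i\<bar>^p / 4\<close> and \<open>\<bar>a_i\<bar>^p / 2\<close>, so they add up to some \<open>q\<close> in \<open>[1/4, 1/2]\<close>.\<close>
lemma heavy_sum_lower_bound:
  assumes a: "(\<Sum>i<N. \<bar>a i\<bar> powr p) = 1"
    and v: "\<And>i. v i \<in> borel_measurable borel" and v0: "\<And>i t. 0 \<le> v i t"
    and v_inv: "\<And>i l t. v i (sign_flip l t) = v i t"
  shows "1 / 16 \<le> measure \<mu>
     {t \<in> {0..1}. 1 \<le> \<bar>\<Sum>i<N. a i * (rad (Suc i) t * (heavy (Suc i) t + v i t))\<bar>}"
proof -
  note [measurable] = v
  let ?S = "\<lambda>t. \<Sum>i<N. a i * (rad (Suc i) t * (heavy (Suc i) t + v i t))"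
  have a1: "\<bar>a i\<bar> \<le> 1" if "i < N" for i using coefficient_le_1[OF _ that] a by simp
  have "\<exists>m. 1 < \<bar>a i\<bar> * \<beta> ^ m \<and> \<bar>a i\<bar> powr p / 2 \<le> (1 / 2) ^ m \<and> (1 / 2) ^ m \<le> \<bar>a i\<bar> powr p"
    if "i < N" "a i \<noteq> 0" for i
    using bracket_reciprocal[of "\<bar>a i\<bar>"] a1[OF that(1)] that(2) by (metis zero_less_abs_iff)
  then obtain m where m: "\<And>i. i < N \<Longrightarrow> a i \<noteq> 0 \<Longrightarrow>
      1 < \<bar>a i\<bar> * \<beta> ^ m i \<and> \<bar>a i\<bar> powr p / 2 \<le> (1 / 2) ^ m i \<and> (1 / 2) ^ m i \<le> \<bar>a i\<bar> powr p"
    by metis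
  define J where "J = Suc ` {i. i < N \<and> a i \<noteq> 0}"
  define k where "k j = m (j - 1)" for j
  define h where "h j t = (if j = 0 then 0 else a (j - 1) * (heavy j t + v (j - 1) t))" for j t
  have h_meas: "h j \<in> borel_measurable borel" for j unfolding h_def[abs_def] by measurable
  have h_inv: "h j (sign_flip l t) = h j t" for j l t unfolding h_def by (simp add: v_inv)
  have comb: "?S t = (\<Sum>j\<in>Suc ` {..<N}. rad j t * h j t)" for t
    by (subst sum.reindex) (auto simp: h_def ac_simps)
  have large: "1 \<le> \<bar>h j t\<bar>" if j: "j \<in> J" and r: "run j (k j) t" for j t
  proof -
    obtain i where i: "j = Suc i" "i < N" "a i \<noteq> 0" using j unfolding J_def by auto
    have "1 < \<bar>a i\<bar> * \<beta> ^ m i" using m i by blast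
    also have "\<dots> \<le> \<bar>a i\<bar> * (heavy j t + v i t)"
      using r i v0[of i t] by (intro mult_left_mono) (auto simp: k_def heavy_run)
    also have "\<dots> = \<bar>h j t\<bar>" unfolding h_def using i heavy_nonneg[of j t] v0[of i t] by (simp add: abs_mult)
    finally show ?thesis by simp
  qed
  define q where "q = (\<Sum>j\<in>J. (1 / 2 :: real) ^ Suc (k j))"
  have q_eq: "q = (\<Sum>i | i < N \<and> a i \<noteq> 0. (1 / 2) ^ m i) / 2"
    unfolding q_def J_def by (subst sum.reindex) (auto simp: k_def sum_divide_distrib)
  have nz: "(\<Sum>i | i < N \<and> a i \<noteq> 0. \<bar>a i\<bar> powr p) = 1"
    unfolding a[symmetric] by (rule sum.mono_neutral_left) auto
  have "(\<Sum>i | i < N \<and> a i \<noteq> 0. (1 / 2) ^ m i) \<le> (\<Sum>i | i < N \<and> a i \<noteq> 0. \<bar>a i\<bar> powr p)"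
    using m by (intro sum_mono) auto
  then have q_le: "q \<le> 1 / 2" unfolding q_eq nz by simp
  have "(\<Sum>i | i < N \<and> a i \<noteq> 0. \<bar>a i\<bar> powr p / 2) \<le> (\<Sum>i | i < N \<and> a i \<noteq> 0. (1 / 2) ^ m i)"
    using m by (intro sum_mono) auto
  then have q_ge: "1 / 4 \<le> q" unfolding q_eq sum_divide_distrib[symmetric] nz by simp
  have "1 / 4 * (1 / 2) \<le> q * (1 - q)" using q_le q_ge by (intro mult_mono) auto
  then have "1 / 16 \<le> q * (1 - q) / 2" by simp
  also have "\<dots> \<le> (\<integral>t. of_bool (1 \<le> \<bar>\<Sum>j\<in>Suc ` {..<N}. rad j t * h j t\<bar>) \<partial>\<mu>)"
    by (rule rademacher_lower_bound[OF _ h_meas h_inv large _ q_def]) (auto simp: J_def)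
  also have "\<dots> = measure \<mu> {t \<in> {0..1}. 1 \<le> \<bar>?S t\<bar>}"
    unfolding comb[symmetric] by (rule integral_of_bool) measurable
  finally show ?thesis .
qed

end

section \<open>Closed linear spans\<close>

definition finite_combination :: "(nat \<Rightarrow> real \<Rightarrow> real) \<Rightarrow> nat \<Rightarrow> (nat \<Rightarrow> real) \<Rightarrow> real \<Rightarrow> real" where
  "finite_combination x n a t = (\<Sum>i<n. a i * x i t)"

text \<open>The closure of the span is taken inside \<open>L_M\<close>, so it automatically contains all functions
  that agree almost everywhere with one of its elements.\<close>
definition closed_span :: "(real \<Rightarrow> real) \<Rightarrow> (nat \<Rightarrow> real \<Rightarrow> real) \<Rightarrow> (real \<Rightarrow> real) set" where
  "closed_span M x = {f \<in> orlicz_space M. \<forall>e>0. \<exists>n a. orlicz_norm M (\<lambda>t. f t - finite_combination x n a t) < e}"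

context orlicz
begin

lemma finite_combination_add:
  "\<exists>k c. (\<lambda>t. finite_combination x n a t + finite_combination x m b t) = finite_combination x k c"
proof (intro exI ext)
  fix t
  let ?k = "max n m" and ?c = "\<lambda>i. (if i < n then a i else 0) + (if i < m then b i else 0)"
  have "(\<Sum>i<n. a i * x i t) = (\<Sum>i<?k. (if i < n then a i else 0) * x i t)"
    by (rule sum.mono_neutral_cong_left) auto
  moreover have "(\<Sum>i<m. b i * x i t) = (\<Sum>i<?k. (if i < m then b i else 0) * x i t)"
    by (rule sum.mono_neutral_cong_left) auto
  ultimately show "finite_combination x n a t + finite_combination x m b t = finite_combination x ?k ?c t"
    unfolding finite_combination_def by (simp only: distrib_right sum.distrib)
qed

lemma closed_subspace_closed_span:
  assumes x: "\<And>n a. finite_combination x n a \<in> orlicz_space M"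
  shows "closed_subspace M (closed_span M x)"
  unfolding closed_subspace_def
proof (intro conjI ballI allI impI)
  show "closed_span M x \<subseteq> orlicz_space M" unfolding closed_span_def by blast
  show "(\<lambda>t. 0) \<in> closed_span M x"
    unfolding closed_span_def using norm_zero zero_in_orlicz_space
    by (auto intro!: exI[of _ 0] simp: finite_combination_def)
next
  fix f g assume "f \<in> closed_span M x" "g \<in> closed_span M x"
  then have f: "f \<in> orlicz_space M" "\<And>e. 0 < e \<Longrightarrow> \<exists>n a. orlicz_norm M (\<lambda>t. f t - finite_combination x n a t) < e"
    and g: "g \<in> orlicz_space M" "\<And>e. 0 < e \<Longrightarrow> \<exists>n a. orlicz_norm M (\<lambda>t. g t - finite_combination x n a t) < e"
    unfolding closed_span_def by auto
  show "(\<lambda>t. f t + g t) \<in> closed_span M x"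
    unfolding closed_span_def
  proof (intro CollectI conjI allI impI)
    show "(\<lambda>t. f t + g t) \<in> orlicz_space M" using f g orlicz_space_add by blast
    fix e :: real assume "0 < e"
    then obtain n a m b where nm: "orlicz_norm M (\<lambda>t. f t - finite_combination x n a t) < e / 2"
      "orlicz_norm M (\<lambda>t. g t - finite_combination x m b t) < e / 2" using f(2)[of "e / 2"] g(2)[of "e / 2"] by auto
    obtain k c where kc: "(\<lambda>t. finite_combination x n a t + finite_combination x m b t) = finite_combination x k c"
      using finite_combination_add by blast
    have "(\<lambda>t. f t + g t - finite_combination x k c t)
        = (\<lambda>t. (f t - finite_combination x n a t) + (g t - finite_combination x m b t))"
      unfolding kc[symmetric] by auto
    then have "orlicz_norm M (\<lambda>t. f t + g t - finite_combination x k c t) < e"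
      using orlicz_space_add(2)[OF orlicz_space_diff(1)[OF f(1) x[of n a]] orlicz_space_diff(1)[OF g(1) x[of m b]]] nm
      by simp
    then show "\<exists>n a. orlicz_norm M (\<lambda>t. f t + g t - finite_combination x n a t) < e" by blast
  qed
next
  fix c f assume "f \<in> closed_span M x"
  then have f: "f \<in> orlicz_space M" "\<And>e. 0 < e \<Longrightarrow> \<exists>n a. orlicz_norm M (\<lambda>t. f t - finite_combination x n a t) < e"
    unfolding closed_span_def by auto
  show "(\<lambda>t. c * f t) \<in> closed_span M x"
    unfolding closed_span_def
  proof (intro CollectI conjI allI impI)
    show "(\<lambda>t. c * f t) \<in> orlicz_space M" using f orlicz_space_scale by blast
    fix e :: real assume e: "0 < e"
    then have "0 < e / (\<bar>c\<bar> + 1)" by simp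
    then obtain n a where n: "orlicz_norm M (\<lambda>t. f t - finite_combination x n a t) < e / (\<bar>c\<bar> + 1)" using f(2) by blast
    have eq: "(\<lambda>t. c * f t - finite_combination x n (\<lambda>i. c * a i) t) = (\<lambda>t. c * (f t - finite_combination x n a t))"
      by (auto simp: finite_combination_def right_diff_distrib sum_distrib_left ac_simps)
    have "orlicz_norm M (\<lambda>t. c * f t - finite_combination x n (\<lambda>i. c * a i) t)
       \<le> \<bar>c\<bar> * orlicz_norm M (\<lambda>t. f t - finite_combination x n a t)"
      unfolding eq using orlicz_space_diff(1)[OF f(1) x] by (rule orlicz_space_scale(2))
    also have "\<dots> \<le> \<bar>c\<bar> * (e / (\<bar>c\<bar> + 1))" using n by (intro mult_left_mono) auto
    also have "\<dots> < e" using e by (simp add: field_simps)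
    finally show "\<exists>n a. orlicz_norm M (\<lambda>t. c * f t - finite_combination x n a t) < e" by blast
  qed
next
  fix X f assume X: "\<forall>n. X n \<in> closed_span M x" and f: "f \<in> orlicz_space M" and lim: "norm_converges M X f"
  show "f \<in> closed_span M x"
    unfolding closed_span_def
  proof (intro CollectI conjI allI impI f)
    fix e :: real assume e: "0 < e"
    have "\<forall>\<^sub>F n in sequentially. orlicz_norm M (\<lambda>t. X n t - f t) < e / 2"
      using lim e unfolding norm_converges_def by (intro order_tendstoD) auto
    then obtain n where n: "orlicz_norm M (\<lambda>t. X n t - f t) < e / 2" unfolding eventually_sequentially by blast
    obtain m a where m: "orlicz_norm M (\<lambda>t. X n t - finite_combination x m a t) < e / 2"
    proof -
      have "0 < e / 2" "X n \<in> closed_span M x" using e X by auto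
      then show ?thesis using that unfolding closed_span_def by blast
    qed
    have Xn: "X n \<in> orlicz_space M" using X unfolding closed_span_def by blast
    have eq: "(\<lambda>t. f t - finite_combination x m a t) = (\<lambda>t. (f t - X n t) + (X n t - finite_combination x m a t))" by auto
    have "orlicz_norm M (\<lambda>t. f t - finite_combination x m a t) \<le>
      orlicz_norm M (\<lambda>t. f t - X n t) + orlicz_norm M (\<lambda>t. X n t - finite_combination x m a t)"
      unfolding eq by (rule orlicz_space_add(2)[OF orlicz_space_diff(1)[OF f Xn] orlicz_space_diff(1)[OF Xn x]])
    then have "orlicz_norm M (\<lambda>t. f t - finite_combination x m a t) < e"
      using n m norm_minus_commute[of f "X n"] by simp
    then show "\<exists>n a. orlicz_norm M (\<lambda>t. f t - finite_combination x n a t) < e" by blast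
  qed
qed

text \<open>The number \<open>A\<close> is a size of the combination that can be seen in measure and that controls its
  norm. Such control passes to the closure by approximation: an element that is
  small off a set of small measure has approximants with small \<open>A\<close>, hence small norm.\<close>
lemma strongly_embedded_closed_span:
  assumes x: "\<And>n a. finite_combination x n a \<in> orlicz_space M" and d: "0 < d" and Q: "0 < Q"
    and est: "\<And>n a. \<exists>A. orlicz_norm M (finite_combination x n a) \<le> Q * A \<and>
      d \<le> measure \<mu> {t \<in> {0..1}. A \<le> \<bar>finite_combination x n a t\<bar>}"
  shows "strongly_embedded M (closed_span M x)"
  unfolding strongly_embedded_def
proof (intro conjI allI impI closed_subspace_closed_span[OF x])
  fix X :: "nat \<Rightarrow> real \<Rightarrow> real" and f
  assume X: "\<forall>n. X n \<in> closed_span M x" and f: "f \<in> closed_span M x"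
  have sub: "closed_span M x \<subseteq> orlicz_space M" unfolding closed_span_def by blast
  show "norm_converges M X f \<longleftrightarrow> converges_in_measure X f"
  proof
    assume "norm_converges M X f"
    then show "converges_in_measure X f"
      using X f sub by (intro norm_converges_imp_converges_in_measure) auto
  next
    assume conv: "converges_in_measure X f"
    \<comment> \<open>With \<open>k = e / (4Q + 4)\<close> an approximant of \<open>y\<close> has \<open>A \<le> 2k\<close>, so the norm of \<open>y\<close> is at most \<open>2Qk + k < e\<close>.\<close>
    have small: "orlicz_norm M y < e"
      if y: "y \<in> closed_span M x" and e: "0 < e"
        and m: "measure \<mu> {t \<in> {0..1}. e / (4 * Q + 4) < \<bar>y t\<bar>} < d / 2" for y e
    proof -
      define k where "k = e / (4 * Q + 4)"
      have k0: "0 < k" unfolding k_def using e Q by simp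
      have "k * (4 * Q + 4) = e" unfolding k_def using Q by simp
      then have k: "0 < k" "4 * Q * k + 4 * k = e" using k0 by (simp_all add: algebra_simps)
      define r where "r = min k (k * d / 2)"
      have r: "0 < r" "r \<le> k" "r / k \<le> d / 2" unfolding r_def using k d by (auto simp: min_def field_simps)
      obtain n a where na: "orlicz_norm M (\<lambda>t. y t - finite_combination x n a t) < r"
        using y r(1) unfolding closed_span_def by blast
      define s where "s = finite_combination x n a"
      have ys: "y \<in> orlicz_space M" "s \<in> orlicz_space M" using y sub x unfolding s_def by auto
      have diff: "(\<lambda>t. y t - s t) \<in> orlicz_space M" by (rule orlicz_space_diff(1)[OF ys])
      note [measurable] = ys[THEN orlicz_space_measurable]
      have cheb: "measure \<mu> {t \<in> {0..1}. k < \<bar>y t - s t\<bar>} \<le> d / 2"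
        using chebyshev[OF diff na[folded s_def] r(2)] r(3) by linarith
      have sets: "{t \<in> space unit_interval. k < \<bar>y t - s t\<bar>} \<in> sets \<mu>"
        "{t \<in> space unit_interval. k < \<bar>y t\<bar>} \<in> sets \<mu>" by measurable
      obtain A where A: "orlicz_norm M s \<le> Q * A" "d \<le> measure \<mu> {t \<in> {0..1}. A \<le> \<bar>s t\<bar>}"
        using est[of n a] unfolding s_def by blast
      have "A \<le> 2 * k"
      proof (rule ccontr)
        assume A2: "\<not> A \<le> 2 * k"
        have "{t \<in> {0..1}. A \<le> \<bar>s t\<bar>} \<subseteq> {t \<in> {0..1}. k < \<bar>y t\<bar>} \<union> {t \<in> {0..1}. k < \<bar>y t - s t\<bar>}"
        proof
          fix t assume t: "t \<in> {t \<in> {0..1}. A \<le> \<bar>s t\<bar>}"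
          then have "k < \<bar>y t\<bar> \<or> k < \<bar>y t - s t\<bar>" using A2 by auto
          with t show "t \<in> {t \<in> {0..1}. k < \<bar>y t\<bar>} \<union> {t \<in> {0..1}. k < \<bar>y t - s t\<bar>}" by auto
        qed
        then have "measure \<mu> {t \<in> {0..1}. A \<le> \<bar>s t\<bar>}
          \<le> measure \<mu> ({t \<in> {0..1}. k < \<bar>y t\<bar>} \<union> {t \<in> {0..1}. k < \<bar>y t - s t\<bar>})"
          using sets by (intro unit_interval.finite_measure_mono) auto
        also have "\<dots> \<le> measure \<mu> {t \<in> {0..1}. k < \<bar>y t\<bar>} + measure \<mu> {t \<in> {0..1}. k < \<bar>y t - s t\<bar>}"
          using sets by (intro measure_Un_le) auto
        also have "\<dots> < d" using cheb m unfolding k_def[symmetric] by linarith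
        finally show False using A(2) by simp
      qed
      then have "Q * A \<le> Q * (2 * k)" using Q by (intro mult_left_mono) auto
      then have s_le: "orlicz_norm M s \<le> 2 * Q * k" using A(1) by simp
      have "orlicz_norm M (\<lambda>t. (y t - s t) + s t) \<le> orlicz_norm M (\<lambda>t. y t - s t) + orlicz_norm M s"
        by (rule orlicz_space_add(2)[OF diff ys(2)])
      moreover have "0 < Q * k" using Q k by simp
      moreover have "orlicz_norm M (\<lambda>t. y t - s t) < k" using na[folded s_def] r(2) by linarith
      ultimately show ?thesis using s_le k by simp
    qed
    have sub_closed: "(\<lambda>t. X n t - f t) \<in> closed_span M x" for n
    proof -
      note cs = closed_subspace_closed_span[OF x, unfolded closed_subspace_def]
      have scale: "\<And>c f. f \<in> closed_span M x \<Longrightarrow> (\<lambda>t. c * f t) \<in> closed_span M x"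
        and add: "\<And>f g. f \<in> closed_span M x \<Longrightarrow> g \<in> closed_span M x \<Longrightarrow> (\<lambda>t. f t + g t) \<in> closed_span M x"
        using cs by simp_all
      from add[OF X[rule_format, of n] scale[OF f, of "- 1"]] show ?thesis by simp
    qed
    show "norm_converges M X f"
      unfolding norm_converges_def
    proof (rule order_tendstoI)
      fix a :: real assume "a < 0"
      then show "\<forall>\<^sub>F n in sequentially. a < orlicz_norm M (\<lambda>t. X n t - f t)"
        using norm_nonneg sub_closed sub by (intro always_eventually allI) (meson less_le_trans subsetD)
    next
      fix e :: real assume e: "0 < e"
      then have "0 < e / (4 * Q + 4)" using Q by simp
      then have "(\<lambda>n. measure \<mu> {t \<in> {0..1}. e / (4 * Q + 4) < \<bar>X n t - f t\<bar>}) \<longlonglongrightarrow> 0"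
        using conv unfolding converges_in_measure_def by blast
      then have "\<forall>\<^sub>F n in sequentially. measure \<mu> {t \<in> {0..1}. e / (4 * Q + 4) < \<bar>X n t - f t\<bar>} < d / 2"
        using d by (intro order_tendstoD) auto
      then show "\<forall>\<^sub>F n in sequentially. orlicz_norm M (\<lambda>t. X n t - f t) < e"
        by eventually_elim (rule small[OF sub_closed e])
    qed
  qed
qed

lemma mem_closed_span:
  assumes "finite_combination x n a \<in> orlicz_space M"
  shows "finite_combination x n a \<in> closed_span M x"
  unfolding closed_span_def using assms norm_zero by (auto intro!: exI[of _ n] exI[of _ a])

end

section \<open>Convergent series\<close>

context rv_orlicz
begin

text \<open>The span of the functions \<open>rad (heavy + spike)\<close>. Giving both parts the same sign ensures that they
  never cancel: the lower bound in measure is inherited from the heavy part, and on the support of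
  the spike the function is at least as large as the spike.\<close>
lemma summable_imp_counterexample:
  assumes W: "summable (\<lambda>k. M (\<beta> ^ k) / 2 ^ k)"
  obtains H where "strongly_embedded M H" "\<not> equi_absolutely_continuous_norms M (orlicz_unit_ball M H)"
proof -
  obtain Q1 where Q1: "1 \<le> Q1"
    "\<And>(n::nat) a. (\<Sum>i<n. \<bar>a i\<bar> powr p) \<le> 1 \<Longrightarrow>
      orlicz_modular M (\<lambda>t. \<Sum>i<n. a i * (rad (Suc i) t * heavy (Suc i) t)) \<le> ennreal Q1"
    using heavy_sum_modular_bound[OF W] by blast
  obtain n :: "nat \<Rightarrow> nat" and b :: "nat \<Rightarrow> real" where n: "strict_mono n" and b: "\<And>i. 0 < b i" "\<And>i. M (b i) = 2 ^ Suc (n i)"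
    and dil: "\<And>i a. 0 \<le> a \<Longrightarrow> a \<le> 1 \<Longrightarrow> M (a * b i) \<le> M (b i) * (2 * a powr p + (1 / 2) ^ i)"
    using spike_parameters by blast
  define spike where "spike i t = b i * of_bool (run 0 (n i) t)" for i t
  define x where "x i t = rad (Suc i) t * (heavy (Suc i) t + spike i t)" for i t
  have spike_meas [measurable]: "spike i \<in> borel_measurable borel" for i unfolding spike_def[abs_def] by measurable
  have x_meas [measurable]: "x i \<in> borel_measurable borel" for i unfolding x_def[abs_def] by measurable
  have comb_meas [measurable]: "finite_combination x N a \<in> borel_measurable borel" for N a
    unfolding finite_combination_def[abs_def] by measurable
  have spike_nonneg: "0 \<le> spike i t" for i t unfolding spike_def using b(1)[of i] by simp
  have spike_mod: "orlicz_modular M (\<lambda>t. \<Sum>i<N. a i * (rad (Suc i) t * spike i t)) \<le> ennreal 4"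
    if "(\<Sum>i<N. \<bar>a i\<bar> powr p) \<le> 1" for N a
    unfolding spike_def by (rule spike_sum_modular_bound[OF n b dil that])
  define Q where "Q = 2 * (Q1 + 4)"
  have Q: "1 \<le> Q" "0 < Q" unfolding Q_def using Q1(1) by auto
  have upper: "finite_combination x N a \<in> orlicz_space M \<and> orlicz_norm M (finite_combination x N a) \<le> Q"
    if a: "(\<Sum>i<N. \<bar>a i\<bar> powr p) \<le> 1" for N a
  proof -
    let ?f = "\<lambda>t. \<Sum>i<N. a i * (rad (Suc i) t * heavy (Suc i) t)"
    let ?v = "\<lambda>t. \<Sum>i<N. a i * (rad (Suc i) t * spike i t)"
    have f: "?f \<in> orlicz_space M" "orlicz_norm M ?f \<le> Q1"
      using orlicz_space_of_modular[OF _ Q1(1) Q1(2)[OF a]] by auto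
    have v: "?v \<in> orlicz_space M" "orlicz_norm M ?v \<le> 4"
      using orlicz_space_of_modular[OF _ _ spike_mod[OF a]] by auto
    have "finite_combination x N a = (\<lambda>t. ?f t + ?v t)"
      unfolding finite_combination_def x_def by (auto simp: distrib_left sum.distrib)
    then show ?thesis using orlicz_space_add[OF f(1) v(1)] f(2) v(2) Q1(1) unfolding Q_def by auto
  qed
  have lower: "1 / 16 \<le> measure \<mu> {t \<in> {0..1}. 1 \<le> \<bar>finite_combination x N a t\<bar>}"
    if "(\<Sum>i<N. \<bar>a i\<bar> powr p) = 1" for N a
    unfolding finite_combination_def x_def
    by (rule heavy_sum_lower_bound[OF that spike_meas spike_nonneg]) (simp add: spike_def)
  have est: "finite_combination x N a \<in> orlicz_space M \<and> (\<exists>A. orlicz_norm M (finite_combination x N a) \<le> Q * A \<and>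
      1 / 16 \<le> measure \<mu> {t \<in> {0..1}. A \<le> \<bar>finite_combination x N a t\<bar>})" for N a
  proof (cases "(\<Sum>i<N. \<bar>a i\<bar> powr p) = 0")
    case True
    then have "a i = 0" if "i < N" for i using that by (simp add: sum_nonneg_eq_0_iff)
    then have "finite_combination x N a = (\<lambda>t. 0)" unfolding finite_combination_def by auto
    moreover have "{t \<in> {0..1}. 0 \<le> \<bar>finite_combination x N a t\<bar>} = {0..1}" by auto
    then have "1 / 16 \<le> measure \<mu> {t \<in> {0..1}. 0 \<le> \<bar>finite_combination x N a t\<bar>}"
      by (simp only: measure_unit_interval)
    ultimately show ?thesis
      using zero_in_orlicz_space norm_zero by (intro conjI exI[of _ 0]) simp_all
  next
    case False
    define A where "A = (\<Sum>i<N. \<bar>a i\<bar> powr p) powr (1 / p)"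
    have pos: "0 < (\<Sum>i<N. \<bar>a i\<bar> powr p)" using False sum_nonneg[of "{..<N}" "\<lambda>i. \<bar>a i\<bar> powr p"] by simp
    then have A0: "0 < A" unfolding A_def by simp
    have Ap: "A powr p = (\<Sum>i<N. \<bar>a i\<bar> powr p)" unfolding A_def using pos p_gt_1 by (simp add: powr_powr)
    define c where "c i = a i / A" for i
    have c: "(\<Sum>i<N. \<bar>c i\<bar> powr p) = 1"
    proof -
      have "\<bar>c i\<bar> powr p = \<bar>a i\<bar> powr p / A powr p" for i
        unfolding c_def using A0 by (simp add: abs_divide powr_divide)
      then show ?thesis using pos by (simp add: sum_divide_distrib[symmetric] Ap)
    qed
    have eq: "finite_combination x N a = (\<lambda>t. A * finite_combination x N c t)"
      unfolding finite_combination_def c_def using A0 by (auto simp: sum_distrib_left)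
    have u: "finite_combination x N c \<in> orlicz_space M" "orlicz_norm M (finite_combination x N c) \<le> Q"
      using upper[of c N] c by auto
    have "orlicz_norm M (finite_combination x N a) \<le> \<bar>A\<bar> * orlicz_norm M (finite_combination x N c)"
      unfolding eq by (rule orlicz_space_scale(2)[OF u(1)])
    also have "\<dots> \<le> Q * A" using u(2) A0 by (simp add: mult.commute mult_left_mono)
    finally have 1: "orlicz_norm M (finite_combination x N a) \<le> Q * A" .
    have "A \<le> \<bar>finite_combination x N a t\<bar> \<longleftrightarrow> 1 \<le> \<bar>finite_combination x N c t\<bar>" for t
      unfolding eq using A0 by (simp add: abs_mult)
    then have "1 / 16 \<le> measure \<mu> {t \<in> {0..1}. A \<le> \<bar>finite_combination x N a t\<bar>}"
      using lower[OF c] by simp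
    moreover have "finite_combination x N a \<in> orlicz_space M" unfolding eq by (rule orlicz_space_scale(1)[OF u(1)])
    ultimately show ?thesis using 1 by blast
  qed
  have H: "strongly_embedded M (closed_span M x)"
    using est Q by (intro strongly_embedded_closed_span[where d = "1 / 16" and Q = Q]) auto
  have "\<not> equi_absolutely_continuous_norms M (orlicz_unit_ball M (closed_span M x))"
  proof
    assume "equi_absolutely_continuous_norms M (orlicz_unit_ball M (closed_span M x))"
    then obtain \<delta> where \<delta>: "0 < \<delta>" "\<And>E y. E \<in> sets \<mu> \<Longrightarrow> measure \<mu> E < \<delta> \<Longrightarrow>
        y \<in> orlicz_unit_ball M (closed_span M x) \<Longrightarrow> orlicz_norm M (\<lambda>t. y t * indicator E t) \<le> 1 / (4 * Q)"
    proof -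
      have "0 < 1 / (4 * Q)" using Q(2) by simp
      then show ?thesis
        using \<open>equi_absolutely_continuous_norms M (orlicz_unit_ball M (closed_span M x))\<close> that
        unfolding equi_absolutely_continuous_norms_iff by blast
    qed
    obtain i where i: "(1 / 2) ^ i < \<delta>" using real_arch_pow_inv[OF \<delta>(1), of "1 / 2"] by auto
    define E where "E = {t \<in> {0..1}. run 0 (n i) t}"
    have E: "E \<in> sets \<mu>"
    proof -
      have "Measurable.pred \<mu> (run 0 (n i))"
        by (intro measurable_restrict_space1 measurable_completion) simp
      then have "{t \<in> space unit_interval. run 0 (n i) t} \<in> sets \<mu>" by (rule predE)
      then show ?thesis unfolding E_def by simp
    qed
    have mE: "measure \<mu> E = (1 / 2) ^ Suc (n i)"
      unfolding E_def by (subst integral_of_bool[symmetric], measurable) (rule run_probability)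
    have "i \<le> n i" using n by (rule strict_mono_imp_increasing)
    then have "(1 / 2 :: real) ^ Suc (n i) \<le> (1 / 2) ^ i" by (intro power_decreasing) auto
    then have small: "measure \<mu> E < \<delta>" unfolding mE using i by linarith
    define a where "a j = (if j = i then 1 / Q else 0)" for j
    define y where "y = finite_combination x (Suc i) a"
    have y_eq: "y t = x i t / Q" for t
      unfolding y_def finite_combination_def a_def by (simp add: if_distrib sum.delta cong: if_cong)
    have a_sum: "(\<Sum>j<Suc i. \<bar>Q * a j\<bar> powr p) \<le> 1"
    proof -
      have "(\<Sum>j<Suc i. \<bar>Q * a j\<bar> powr p) = (\<Sum>j<Suc i. if j = i then 1 else 0)"
        using Q by (intro sum.cong) (auto simp: a_def)
      then show ?thesis by simp
    qed
    have yL: "y \<in> orlicz_space M" unfolding y_def using est by blast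
    have "orlicz_norm M y \<le> 1"
    proof -
      have "y = (\<lambda>t. 1 / Q * finite_combination x (Suc i) (\<lambda>j. Q * a j) t)"
        unfolding y_def finite_combination_def using Q
        by (simp add: sum_divide_distrib del: sum.lessThan_Suc)
      then have "orlicz_norm M y \<le> \<bar>1 / Q\<bar> * orlicz_norm M (finite_combination x (Suc i) (\<lambda>j. Q * a j))"
        using orlicz_space_scale(2)[of "finite_combination x (Suc i) (\<lambda>j. Q * a j)" "1 / Q"] est by simp
      also have "\<dots> \<le> \<bar>1 / Q\<bar> * Q" using upper[OF a_sum] by (intro mult_left_mono) auto
      finally show ?thesis using Q by simp
    qed
    moreover have "y \<in> closed_span M x" unfolding y_def using est by (intro mem_closed_span) blast
    ultimately have "y \<in> orlicz_unit_ball M (closed_span M x)" unfolding orlicz_unit_ball_def by blast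
    then have ub: "orlicz_norm M (\<lambda>t. y t * indicator E t) \<le> 1 / (4 * Q)" using \<delta>(2) E small by blast
    have yE_meas: "(\<lambda>t. y t * indicator E t) \<in> borel_measurable \<mu>"
      using yL[THEN orlicz_space_measurable] E by measurable
    have yE: "(\<lambda>t. y t * indicator E t) \<in> orlicz_space M"
    proof -
      obtain r where r: "0 < r" "orlicz_modular M (\<lambda>t. y t / r) \<le> 1" using yL unfolding orlicz_space_def by auto
      have "orlicz_modular M (\<lambda>t. y t * indicator E t / r) \<le> orlicz_modular M (\<lambda>t. y t / r)"
        by (intro modular_mono) (auto simp: indicator_def)
      then show ?thesis unfolding orlicz_space_def using yE_meas r by (auto intro!: exI[of _ r])
    qed
    \<comment> \<open>On \<open>E\<close> the function is at least \<open>b i / Q\<close>, and \<open>M(b i)\<close> times the measure of \<open>E\<close> is 1, so dividing by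
      \<open>1/(2Q)\<close> produces a modular of at least 2.\<close>
    have "ennreal 2 \<le> (\<integral>\<^sup>+ t. ennreal (2 * M (b i)) * indicator E t \<partial>\<mu>)"
    proof -
      have "(\<integral>\<^sup>+ t. ennreal (2 * M (b i)) * indicator E t \<partial>\<mu>) = ennreal (2 * M (b i)) * ennreal ((1 / 2) ^ Suc (n i))"
        using E by (simp add: nn_integral_cmult_indicator unit_interval.emeasure_eq_measure mE del: power_Suc)
      also have "\<dots> = ennreal (2 * M (b i) * (1 / 2) ^ Suc (n i))" using b(1)[of i] by (subst ennreal_mult) auto
      also have "2 * M (b i) * (1 / 2) ^ Suc (n i) = 2" unfolding b(2) by (simp add: power_divide)
      finally show ?thesis by simp
    qed
    also have "\<dots> \<le> orlicz_modular M (\<lambda>t. y t * indicator E t / (1 / (2 * Q)))"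
      unfolding orlicz_modular_def
    proof (rule nn_integral_mono)
      fix t
      show "ennreal (2 * M (b i)) * indicator E t \<le> ennreal (M \<bar>y t * indicator E t / (1 / (2 * Q))\<bar>)"
      proof (cases "t \<in> E")
        case True
        then have "run 0 (n i) t" unfolding E_def by auto
        then have "b i \<le> \<bar>x i t\<bar>" unfolding x_def spike_def using heavy_nonneg[of "Suc i" t] b(1)[of i] by (simp add: abs_mult)
        then have "2 * b i \<le> \<bar>y t * indicator E t / (1 / (2 * Q))\<bar>" using True Q by (simp add: y_eq)
        then have "M (2 * b i) \<le> M \<bar>y t * indicator E t / (1 / (2 * Q))\<bar>" using b(1)[of i] by (intro M_mono) auto
        moreover have "2 * M (b i) \<le> M (2 * b i)" using b(1)[of i] by (intro M_expand) auto
        ultimately show ?thesis using True by (auto intro: ennreal_leI)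
      qed auto
    qed
    finally have "1 < orlicz_modular M (\<lambda>t. y t * indicator E t / (1 / (2 * Q)))"
      by (rule less_le_trans[rotated]) simp
    then have "1 / (2 * Q) \<le> orlicz_norm M (\<lambda>t. y t * indicator E t)" by (rule norm_ge[OF yE])
    then show False using ub Q by (simp add: field_simps)
  qed
  with H show ?thesis using that by blast
qed

end

theorem corollary3:
  fixes p :: real and M :: "real \<Rightarrow> real"
  assumes "1 < p" and "p < 2"
    and "orlicz_function M"
    and "regularly_varying M p"
  shows "(\<forall>H. strongly_embedded M H \<longrightarrow>
             equi_absolutely_continuous_norms M (orlicz_unit_ball M H))
         \<longleftrightarrow> (\<lambda>t. t powr (- 1 / p)) \<notin> orlicz_space M"
proof -
  interpret rv_orlicz M p
    using assms by unfold_locales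
  show ?thesis
    unfolding power_mem_orlicz_space_iff
  proof
    assume equi: "\<forall>H. strongly_embedded M H \<longrightarrow> equi_absolutely_continuous_norms M (orlicz_unit_ball M H)"
    show "\<not> summable (\<lambda>k. M (\<beta> ^ k) / 2 ^ k)"
    proof
      assume "summable (\<lambda>k. M (\<beta> ^ k) / 2 ^ k)"
      then obtain H where "strongly_embedded M H"
        "\<not> equi_absolutely_continuous_norms M (orlicz_unit_ball M H)"
        by (rule summable_imp_counterexample)
      then show False using equi by simp
    qed
  next
    assume "\<not> summable (\<lambda>k. M (\<beta> ^ k) / 2 ^ k)"
    then show "\<forall>H. strongly_embedded M H \<longrightarrow> equi_absolutely_continuous_norms M (orlicz_unit_ball M H)"
      using strongly_embedded_imp_equi_absolutely_continuous by simp
  qed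
qed

end
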